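(* Let $k\ge3$ be a fixed integer. There are constants $C_1,C_2$ depending only on $k$ such that for every integer $n$ with $|n|$ sufficiently large (in terms of $k$) and every bipartite Diophantine tuple $(A,B)$ with property $BD_k(n)$, $$\text{either}\quad|A|\le C_1\log\log|n|,\qquad\text{or}\quad|B|\le C_2\log|n|\cdot(\log\log|n|)^2.$$
   Context: $\mathbb{N}$ denotes the set of positive integers, and a (perfect) $k$-th power means an integer $x^k$ with $x\in\mathbb{N}$. For an integer $k\ge2$ and a nonzero integer $n$, a pair $(A,B)$ is a bipartite Diophantine tuple with property $BD_k(n)$ if $A,B\subseteq\mathbb{N}$ each have size at least $2$ and $ab+n$ is a $k$-th power for every $a\in A$, $b\in B$. $\log$ is the natural logarithm. *)

theory Defs
  imports Complex_Main
begin

text \<open>The base is a positive integer, so 0 and negative integers are never perfect powers. This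
  differs from the library's \<open>is_nth_power\<close>, which accepts 0 (and negative integers for odd
  exponents).\<close>

definition perfect_power :: "nat \<Rightarrow> int \<Rightarrow> bool" where
  "perfect_power k m \<longleftrightarrow> (\<exists>x::nat. x > 0 \<and> m = int x ^ k)"

text \<open>The sets may be infinite; since \<open>card\<close> is 0 on infinite sets, ``size at least 2'' needs
  the extra disjunct.\<close>

definition size_at_least_two :: "'a set \<Rightarrow> bool" where
  "size_at_least_two S \<longleftrightarrow> infinite S \<or> card S \<ge> 2"

definition bipartite_diophantine :: "nat \<Rightarrow> int \<Rightarrow> nat set \<Rightarrow> nat set \<Rightarrow> bool" where
  "bipartite_diophantine k n A B \<longleftrightarrow>
     k \<ge> 2 \<and> n \<noteq> 0 \<and>
     A \<subseteq> {0<..} \<and> B \<subseteq> {0<..} \<and>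
     size_at_least_two A \<and> size_at_least_two B \<and>
     (\<forall>a\<in>A. \<forall>b\<in>B. perfect_power k (int a * int b + n))"

end

theory Submission
  imports Defs "HOL-Number_Theory.Number_Theory" "HOL-Computational_Algebra.Computational_Algebra"
    "HOL-Real_Asymp.Real_Asymp"
begin

text \<open>
  Let \<open>d\<close> be a prime divisor of \<open>k\<close>. If \<open>a\<^sub>1 < a\<^sub>2\<close> lie in \<open>A\<close>, then every \<open>b \<in> B\<close> yields a solution of
  the Thue equation \<open>a\<^sub>2 * x ^ k - a\<^sub>1 * y ^ k = (a\<^sub>2 - a\<^sub>1) * n\<close>. Its solutions obey a gap principle, and the diagonal
  Pade approximants of \<open>(1 + z) powr (1 / k)\<close> show that no solution exceeds the 16th power of a
  sufficiently large one; so only boundedly many are large. Comparing \<open>A\<close> with \<open>B\<close>, one of the sets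
  is bounded, or all but seven elements of each are at most a fixed power of \<open>|n|\<close>.

  In the latter case suppose that \<open>A\<close> contains \<open>m\<close> such elements with \<open>m\<close> of order \<open>ln (ln |n|)\<close>, and let
  \<open>p \<equiv> 1 (mod d)\<close> be a prime not dividing \<open>n\<close>, these elements, or their differences. Modulo \<open>p\<close>,
  every \<open>b \<in> B\<close> makes all the \<open>a * b + n\<close> \<open>d\<close>-th powers. Averaging over exponent vectors reduces the
  count of such residues to the residues where one polynomial is a \<open>d\<close>-th power, which Stepanov's
  method bounds elementarily; hence \<open>B\<close> occupies \<open>O(m * sqrt p)\<close> classes as soon as
  \<open>sqrt p \<le> d ^ m\<close>. Gallagher's larger sieve over the primes \<open>p \<le> x\<close>, with \<open>x\<close> of order
  \<open>(ln |n| * ln (ln |n|))\<^sup>2\<close>, then bounds \<open>B\<close>. It needs the lower bound \<open>c * x\<close> for the sum of \<open>ln p\<close> over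
  primes \<open>p \<equiv> 1 (mod d)\<close>, which follows from Mertens' theorem in that progression, that is, from the
  nonvanishing of \<open>L(1, \<chi>)\<close>: Monsky's argument for real \<open>\<chi>\<close>, and for the others the fact that
  \<open>\<chi>\<close> and its conjugate cannot both contribute \<open>-ln x\<close> to a sum that is nonnegative.
\<close>

section \<open>Chebyshev bounds and the Mertens sum\<close>

text \<open>Both orders of growth come from balancing the sieve. With about
  \<open>m * sqrt x\<close> classes allowed per prime and elements at most a power of |n|, the
  larger sieve needs \<open>x\<close> to exceed a multiple of \<open>m * sqrt x * ln |n|\<close>, so
  \<open>sqrt x\<close> is about \<open>m * ln |n|\<close>, and the sieve returns about
  \<open>m * sqrt x\<close>, that is \<open>m ^ 2 * ln |n|\<close>. The condition
  \<open>sqrt p \<le> d ^ m\<close> then dictates \<open>m\<close> of order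
  \<open>ln (ln |n|)\<close>. Since constants do not matter, a lower bound of the right order for
  the primes suffices. The obstacle in the Diophantine half is uniformity: the coefficients
  \<open>a1\<close>, \<open>a2\<close> of the Thue equation have no bound in advance, so the
  threshold for large elements of one set depends on the second element of the other. Only explicit
  approximants, with constants polynomial in the coefficients, allow these two thresholds to be
  played against each other. Taking a prime \<open>d\<close> instead of \<open>k\<close> makes every
  nonzero exponent below \<open>d\<close> coprime to \<open>d\<close>, as Stepanov's method needs,
  and lets a discrete logarithm describe all characters modulo \<open>d\<close>.\<close>

lemma sum_divisors_reindex:
  fixes F :: "nat \<Rightarrow> nat \<Rightarrow> 'a::comm_monoid_add"
  shows "(\<Sum>n=1..x. \<Sum>m | m dvd n. F m (n div m)) = (\<Sum>m=1..x. \<Sum>t=1..x div m. F m t)"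
proof -
  have "(\<Sum>n=1..x. \<Sum>m | m dvd n. F m (n div m))
      = (\<Sum>(n, m)\<in>Sigma {1..x} (\<lambda>n. {m. m dvd n}). F m (n div m))"
    by (rule sum.Sigma) (auto intro: finite_divisors_nat)
  also have "\<dots> = (\<Sum>(m, t)\<in>Sigma {1..x} (\<lambda>m. {1..x div m}). F m t)"
  proof (rule sum.reindex_bij_witness[of _ "\<lambda>(m, t). (m * t, m)" "\<lambda>(n, m). (m, n div m)"])
    fix a assume "a \<in> Sigma {1..x} (\<lambda>n. {m. m dvd n})"
    then obtain n m where a: "a = (n, m)" "1 \<le> n" "n \<le> x" "m dvd n" by auto
    from a(2,4) have m: "m > 0" by (cases m) auto
    show "(case case a of (n, m) \<Rightarrow> (m, n div m) of (m, t) \<Rightarrow> (m * t, m)) = a"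
      using a by simp
    have "m \<le> n" using a by (simp add: dvd_imp_le)
    then show "(case a of (n, m) \<Rightarrow> (m, n div m)) \<in> Sigma {1..x} (\<lambda>m. {1..x div m})"
      using a m by (auto simp: div_le_mono Suc_le_eq div_greater_zero_iff)
    show "(case case a of (n, m) \<Rightarrow> (m, n div m) of (m, t) \<Rightarrow> F m t) = (case a of (n, m) \<Rightarrow> F m (n div m))"
      using a by simp
  next
    fix b assume "b \<in> Sigma {1..x} (\<lambda>m. {1..x div m})"
    then obtain m t where b: "b = (m, t)" "1 \<le> m" "m \<le> x" "1 \<le> t" "t \<le> x div m" by auto
    show "(case case b of (m, t) \<Rightarrow> (m * t, m) of (n, m) \<Rightarrow> (m, n div m)) = b"
      using b by simp
    have "m * t \<le> m * (x div m)" using b by simp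
    also have "\<dots> \<le> x" by (rule times_div_less_eq_dividend)
    finally show "(case b of (m, t) \<Rightarrow> (m * t, m)) \<in> Sigma {1..x} (\<lambda>n. {m. m dvd n})"
      using b by (auto simp: Suc_le_eq)
  qed
  also have "\<dots> = (\<Sum>m=1..x. \<Sum>t=1..x div m. F m t)"
    by (rule sum.Sigma[symmetric]) auto
  finally show ?thesis .
qed

lemma of_nat_div_less_Suc:
  assumes "m > 0"
  shows "real x / real m < real (x div m) + 1"
proof -
  have "x < m * (x div m + 1)" using assms dividend_less_times_div[of m x] by simp
  then have "real x < real m * (real (x div m) + 1)"
    by (metis of_nat_less_iff of_nat_mult of_nat_add of_nat_1)
  then show ?thesis using assms by (simp add: divide_less_eq mult.commute)
qed

definition psi :: "nat \<Rightarrow> real" where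
  "psi x = (\<Sum>n=1..x. mangoldt n)"

lemma ln_fact_sum: "ln (fact x :: real) = (\<Sum>n=1..x. ln (real n))"
proof (induction x)
  case (Suc x)
  then show ?case by (simp add: ln_mult)
qed simp

lemma ln_fact_mangoldt: "ln (fact x :: real) = (\<Sum>m=1..x. mangoldt m * real (x div m))"
proof -
  have "ln (fact x :: real) = (\<Sum>n=1..x. \<Sum>m | m dvd n. mangoldt m)"
    unfolding ln_fact_sum
  proof (rule sum.cong)
    fix n assume "n \<in> {1..x}"
    then show "ln (real n) = (\<Sum>m | m dvd n. mangoldt m)"
      using mangoldt_sum[of n, where 'a = real] by simp
  qed simp
  also have "\<dots> = (\<Sum>m=1..x. \<Sum>t=1..x div m. mangoldt m)"
    by (rule sum_divisors_reindex[of "\<lambda>m t. mangoldt m"])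
  finally show ?thesis by (simp add: mult.commute)
qed

lemma ln_fact_bounds:
  assumes "x \<ge> 1"
  shows "ln (fact x :: real) \<le> x * ln x" and "ln (fact x :: real) \<ge> x * ln x - x"
proof -
  have "(\<Sum>n=1..x. ln (real n)) \<le> (\<Sum>n=1..x. ln (real x))"
    by (rule sum_mono) auto
  then show "ln (fact x :: real) \<le> x * ln x" unfolding ln_fact_sum by simp
  \<comment> \<open>The quotient is a single term of the exponential series at \<open>x\<close>;
    this yields a weak form of Stirling's formula.\<close>
  have "real x ^ x / fact x \<le> exp (real x)"
  proof -
    have s: "(\<lambda>n. real x ^ n /\<^sub>R fact n) sums exp (real x)" by (rule exp_converges)
    have "(\<Sum>n\<in>{x}. real x ^ n /\<^sub>R fact n) \<le> (\<Sum>n. real x ^ n /\<^sub>R fact n)"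
      using sums_summable[OF s] by (rule sum_le_suminf) auto
    then show ?thesis using sums_unique[OF s] by (simp add: field_simps)
  qed
  then have "ln (real x ^ x / fact x) \<le> real x"
    using assms by (metis divide_pos_pos fact_gt_zero ln_le_cancel_iff exp_gt_zero ln_exp of_nat_0_less_iff zero_less_power less_le_trans zero_less_one)
  then show "ln (fact x :: real) \<ge> x * ln x - x"
    using assms by (simp add: ln_div ln_realpow)
qed

text \<open>The integer \<open>2 * n div m - 2 * (n div m)\<close> is never negative and is 1 for
  \<open>n < m \<le> 2 * n\<close>. Weighted with \<open>mangoldt\<close>, these integers add up to
  the logarithm of the central binomial coefficient, which is at most
  \<open>2 ^ (2 * n)\<close>.\<close>

lemma psi_double: "psi (2 * n) - psi n \<le> 2 * real n"
proof -
  have mono: "psi (2 * n) - psi n = (\<Sum>m=Suc n..2*n. mangoldt m)"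
  proof -
    have "{1..2*n} = {1..n} \<union> {Suc n..2*n}" by auto
    then have "psi (2*n) = psi n + (\<Sum>m=Suc n..2*n. mangoldt m)"
      unfolding psi_def by (simp add: sum.union_disjoint)
    then show ?thesis by simp
  qed
  have e: "(\<Sum>m=1..n. mangoldt m * real (n div m)) = (\<Sum>m=1..2*n. mangoldt m * real (n div m))"
    by (rule sum.mono_neutral_left) auto
  have "(\<Sum>m=Suc n..2*n. mangoldt m)
      \<le> (\<Sum>m=Suc n..2*n. mangoldt m * (real (2 * n div m) - 2 * real (n div m)))"
  proof (rule sum_mono)
    fix m assume m: "m \<in> {Suc n..2*n}"
    then have "n div m = 0" "2 * n div m \<ge> 1"
      by (auto simp: div_greater_zero_iff Suc_le_eq)
    then have "1 \<le> real (2 * n div m) - 2 * real (n div m)" by simp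
    then show "mangoldt m \<le> mangoldt m * (real (2 * n div m) - 2 * real (n div m))"
      using mult_left_mono[OF _ mangoldt_nonneg[of m]] by force
  qed
  also have "\<dots> \<le> (\<Sum>m=1..2*n. mangoldt m * (real (2 * n div m) - 2 * real (n div m)))"
  proof (rule sum_mono2)
    fix m assume m: "m \<in> {1..2*n} - {Suc n..2*n}"
    have "m * (n div m) \<le> n" by (rule times_div_less_eq_dividend)
    then have "2 * (n div m) \<le> 2 * n div m" using m by (simp add: less_eq_div_iff_mult_less_eq mult_ac)
    then have "0 \<le> real (2 * n div m) - 2 * real (n div m)" by linarith
    then show "0 \<le> mangoldt m * (real (2 * n div m) - 2 * real (n div m))"
      using mangoldt_nonneg by simp
  qed auto
  also have "\<dots> = ln (fact (2*n)) - 2 * ln (fact n :: real)"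
    unfolding ln_fact_mangoldt e
    by (simp add: right_diff_distrib sum_subtractf sum_distrib_left mult_ac)
  also have "\<dots> = ln (real (2 * n choose n))"
  proof -
    have "real (2 * n choose n) = fact (2*n) / (fact n * fact n)"
      using binomial_fact[of n "2*n", where 'a = real] by (simp add: mult_2)
    then show ?thesis by (simp add: ln_div ln_mult)
  qed
  also have "\<dots> \<le> ln (2 ^ (2 * n))"
  proof -
    have "2 * n choose n \<le> 2 ^ (2 * n)" by (rule binomial_le_pow2)
    then have "real (2 * n choose n) \<le> 2 ^ (2 * n)"
      by (metis of_nat_le_iff of_nat_numeral of_nat_power)
    then show ?thesis by (subst ln_le_cancel_iff) (auto simp: zero_less_binomial)
  qed
  also have "\<dots> = 2 * real n * ln 2" by (simp add: ln_realpow)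
  also have "\<dots> \<le> 2 * real n" using ln_2_less_1 by (intro mult_left_le) auto
  finally show ?thesis using mono by simp
qed

text \<open>Repeated halving. The constant 4 leaves room for rounding an odd
  \<open>2 * n + 1\<close> up to \<open>2 * n + 2\<close>, because
  \<open>6 * (n + 1) \<le> 4 * (2 * n + 1)\<close> for \<open>n \<ge> 1\<close>.\<close>

lemma psi_le: "psi x \<le> 4 * real x"
proof (induction x rule: less_induct)
  case (less x)
  consider "x = 0" | "x = 1" | n where "x = 2 * n" "n \<ge> 1" | n where "x = 2 * n + 1" "n \<ge> 1"
  proof -
    have "x = 2 * (x div 2) \<or> x = 2 * (x div 2) + 1" by presburger
    moreover have "x = 0 \<or> x = 1 \<or> x div 2 \<ge> 1" by presburger
    ultimately show ?thesis using that by metis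
  qed
  then show ?case
  proof cases
    case 3
    then show ?thesis using psi_double[of n] less[of n] by simp
  next
    case 4
    have "psi x \<le> psi (2 * (n + 1))"
      unfolding psi_def using 4 by (intro sum_mono2) (auto intro: mangoldt_nonneg)
    then show ?thesis using psi_double[of "n+1"] less[of "n+1"] 4 by simp
  qed (auto simp: psi_def)
qed

text \<open>In \<open>ln (fact x)\<close> the factor \<open>x div m\<close> may be replaced by
  \<open>x / m\<close> at a total cost of \<open>psi x\<close>, which is linear in \<open>x\<close>;
  dividing by \<open>x\<close> leaves a bounded error.\<close>

lemma mertens_mangoldt:
  assumes "x \<ge> 1"
  shows "\<bar>(\<Sum>n=1..x. mangoldt n / real n) - ln (real x)\<bar> \<le> 4"
proof -
  define S where "S = (\<Sum>n=1..x. mangoldt n / real n :: real)"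
  have "ln (fact x :: real) \<le> (\<Sum>m=1..x. x * (mangoldt m / real m))"
    unfolding ln_fact_mangoldt
  proof (rule sum_mono)
    fix m assume "m \<in> {1..x}"
    have "mangoldt m * real (x div m) \<le> mangoldt m * (real x / real m)"
      by (intro mult_left_mono of_nat_div_le_of_nat mangoldt_nonneg)
    then show "mangoldt m * real (x div m) \<le> x * (mangoldt m / real m)" by (simp add: mult_ac)
  qed
  then have u: "ln (fact x :: real) \<le> x * S" by (simp add: S_def sum_distrib_left)
  have "(\<Sum>m=1..x. x * (mangoldt m / real m)) \<le> (\<Sum>m=1..x. mangoldt m * real (x div m) + mangoldt m)"
  proof (rule sum_mono)
    fix m assume "m \<in> {1..x}"
    then have "real x / real m \<le> real (x div m) + 1"
      using of_nat_div_less_Suc[of m x] by simp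
    then have "mangoldt m * (real x / real m) \<le> mangoldt m * (real (x div m) + 1)"
      by (intro mult_left_mono mangoldt_nonneg)
    then show "x * (mangoldt m / real m) \<le> mangoldt m * real (x div m) + mangoldt m"
      by (simp add: algebra_simps)
  qed
  then have l: "x * S \<le> ln (fact x :: real) + psi x"
    by (simp add: S_def sum_distrib_left sum.distrib ln_fact_mangoldt psi_def)
  have "real x * S \<le> real x * (ln x + 4)"
    using l ln_fact_bounds(1)[OF assms] psi_le[of x] by (simp add: algebra_simps)
  moreover have "real x * (ln x - 1) \<le> real x * S"
    using u ln_fact_bounds(2)[OF assms] by (simp add: algebra_simps)
  ultimately have "S \<le> ln x + 4" "ln x - 1 \<le> S" using assms by auto
  then show ?thesis unfolding S_def by linarith
qed

section \<open>Moebius inversion of the von Mangoldt function\<close>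

definition moebius :: "nat \<Rightarrow> real" where
  "moebius n = (if squarefree n then (-1) ^ card (prime_factors n) else 0)"

lemma abs_moebius_le: "\<bar>moebius n\<bar> \<le> 1"
  by (simp add: moebius_def)

lemma moebius_mult_prime:
  assumes "prime q" "\<not> q dvd t" "t > 0"
  shows "moebius (q * t) = - moebius t"
proof -
  have cop: "coprime q t" using assms by (simp add: prime_imp_coprime)
  have "squarefree (q * t) \<longleftrightarrow> squarefree t"
    using assms cop by (metis squarefree_mult_coprime squarefree_prime squarefree_multD(2))
  moreover have "prime_factors (q * t) = insert q (prime_factors t)"
    using assms by (subst prime_factors_product) (auto simp: prime_factorization_prime)
  moreover have "q \<notin> prime_factors t" using assms by auto
  ultimately show ?thesis by (simp add: moebius_def)
qed

text \<open>For a prime \<open>q\<close> dividing \<open>n\<close>, the divisors \<open>t\<close>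
  prime to \<open>q\<close> cancel against \<open>q * t\<close>, and those divisible by
  \<open>q\<^sup>2\<close> have value 0.\<close>

lemma sum_moebius_divisors:
  assumes "n > 0"
  shows "(\<Sum>t | t dvd n. moebius t) = (if n = 1 then 1 else 0)"
proof (cases "n = 1")
  case True
  then show ?thesis by (simp add: moebius_def)
next
  case False
  then obtain q where q: "prime q" "q dvd n" using prime_factor_nat by blast
  define A where "A = {t. t dvd n \<and> \<not> q dvd t}"
  define B where "B = {t. t dvd n \<and> q dvd t \<and> \<not> q\<^sup>2 dvd t}"
  have fin: "finite {t. t dvd n}" using assms by simp
  have "(\<Sum>t | t dvd n. moebius t) = (\<Sum>t\<in>A \<union> B. moebius t)"
  proof (rule sum.mono_neutral_right[OF fin])
    show "A \<union> B \<subseteq> {t. t dvd n}" by (auto simp: A_def B_def)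
    show "\<forall>t\<in>{t. t dvd n} - (A \<union> B). moebius t = 0"
    proof
      fix t assume "t \<in> {t. t dvd n} - (A \<union> B)"
      then have "q\<^sup>2 dvd t" by (auto simp: A_def B_def)
      then have "\<not> squarefree t" using q(1) by (metis not_squarefreeI not_prime_unit)
      then show "moebius t = 0" by (simp add: moebius_def)
    qed
  qed
  also have "\<dots> = (\<Sum>t\<in>A. moebius t) + (\<Sum>t\<in>B. moebius t)"
    by (rule sum.union_disjoint) (auto simp: A_def B_def intro: finite_subset[OF _ fin])
  also have "(\<Sum>t\<in>B. moebius t) = (\<Sum>t\<in>A. moebius (q * t))"
  proof (rule sum.reindex_bij_witness[of _ "\<lambda>t. q * t" "\<lambda>t. t div q"])
    fix t assume "t \<in> B"
    then show "q * (t div q) = t" "t div q \<in> A" "moebius (q * (t div q)) = moebius t"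
      using q by (auto simp: A_def B_def power2_eq_square elim!: dvdE intro: dvd_mult_right)
  next
    fix t assume t: "t \<in> A"
    show "q * t div q = t" using q by (simp add: prime_gt_0_nat)
    have "q * t dvd n"
      using t q by (intro divides_mult) (auto simp: A_def prime_imp_coprime)
    then show "q * t \<in> B" using t q by (auto simp: A_def B_def power2_eq_square prime_gt_0_nat)
  qed
  also have "\<dots> = (\<Sum>t\<in>A. - moebius t)"
    using q assms by (intro sum.cong refl moebius_mult_prime) (auto simp: A_def intro: Nat.gr0I)
  finally show ?thesis using False by (simp add: sum_negf)
qed

lemma sum_moebius_ln:
  assumes "n > 0"
  shows "(\<Sum>t | t dvd n. moebius t * ln (real (n div t))) = mangoldt n"
proof -
  have *: "ln (real (n div t)) = (\<Sum>m | m dvd n div t. mangoldt m)" if "t dvd n" for t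
  proof -
    have "n div t > 0" using that assms by (auto elim!: dvdE)
    then show ?thesis using mangoldt_sum[of "n div t", where 'a = real] by simp
  qed
  have "(\<Sum>t | t dvd n. moebius t * ln (real (n div t)))
      = (\<Sum>t | t dvd n. \<Sum>m | m dvd n div t. moebius t * mangoldt m)"
    using * by (intro sum.cong) (auto simp: sum_distrib_left)
  also have "\<dots> = (\<Sum>(t, m)\<in>Sigma {t. t dvd n} (\<lambda>t. {m. m dvd n div t}). moebius t * mangoldt m)"
    using assms by (intro sum.Sigma) (auto intro!: finite_divisors_nat elim!: dvdE)
  also have "\<dots> = (\<Sum>(m, t)\<in>Sigma {m. m dvd n} (\<lambda>m. {t. t dvd n div m}). moebius t * mangoldt m)"
    using assms by (intro sum.reindex_bij_witness[of _ "\<lambda>(m, t). (t, m)" "\<lambda>(t, m). (m, t)"])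
      (auto simp: dvd_div_iff_mult elim!: dvdE)
  also have "\<dots> = (\<Sum>m | m dvd n. \<Sum>t | t dvd n div m. moebius t * mangoldt m)"
    using assms by (intro sum.Sigma[symmetric]) (auto intro!: finite_divisors_nat elim!: dvdE)
  also have "\<dots> = (\<Sum>m | m dvd n. if m = n then mangoldt n else 0)"
  proof (intro sum.cong refl)
    fix m assume "m \<in> {m. m dvd n}"
    then have m: "m dvd n" "n div m > 0" using assms by (auto elim!: dvdE)
    have "(\<Sum>t | t dvd n div m. moebius t * mangoldt m) = (if n div m = 1 then 1 else 0) * mangoldt m"
      unfolding sum_distrib_right[symmetric] sum_moebius_divisors[OF m(2)] ..
    also have "n div m = 1 \<longleftrightarrow> m = n" using m assms by (auto elim!: dvdE)
    finally show "(\<Sum>t | t dvd n div m. moebius t * mangoldt m) = (if m = n then mangoldt n else 0)"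
      by auto
  qed
  also have "\<dots> = mangoldt n" using assms by simp
  finally show ?thesis .
qed

text \<open>Abel summation: by monotonicity the boundary term and the telescoping differences add up
  to \<open>K * f a\<close>, whatever the length of the interval. It is applied to
  \<open>1 / n\<close>, \<open>ln n / n\<close> and Monsky's weights.\<close>

lemma sum_by_parts_norm_le:
  fixes \<chi> :: "nat \<Rightarrow> complex" and f :: "nat \<Rightarrow> real"
  assumes bd: "\<And>a b. norm (\<Sum>n=a..b. \<chi> n) \<le> K"
    and dec: "\<And>n. n \<ge> a \<Longrightarrow> f (Suc n) \<le> f n" and nonneg: "\<And>n. n \<ge> a \<Longrightarrow> 0 \<le> f n"
  shows "norm (\<Sum>n=a..b. \<chi> n * of_real (f n)) \<le> K * f a"
proof (cases "a \<le> b")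
  case True
  define A where "A n = (\<Sum>i=a..n. \<chi> i)" for n
  have K: "K \<ge> 0" using bd[of 0 0] norm_ge_zero order_trans by blast
  have "(\<Sum>n=a..b. \<chi> n * of_real (f n)) = A b * of_real (f b) + (\<Sum>n=a..<b. A n * of_real (f n - f (Suc n)))"
    using True
  proof (induction b rule: dec_induct)
    case base
    then show ?case by (simp add: A_def)
  next
    case (step b)
    have "A (Suc b) = A b + \<chi> (Suc b)" using step by (simp add: A_def)
    then show ?case using step by (simp add: algebra_simps)
  qed
  also have "norm \<dots> \<le> K * f b + (\<Sum>n=a..<b. K * (f n - f (Suc n)))"
  proof (rule order_trans[OF norm_triangle_ineq] add_mono)+
    show "norm (A b * of_real (f b)) \<le> K * f b"
      using bd[of a b] nonneg[of b] True by (simp add: norm_mult A_def mult_right_mono)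
    show "norm (\<Sum>n=a..<b. A n * of_real (f n - f (Suc n))) \<le> (\<Sum>n=a..<b. K * (f n - f (Suc n)))"
    proof (rule sum_norm_le)
      fix n assume "n \<in> {a..<b}"
      then have "f n - f (Suc n) \<ge> 0" using dec[of n] by simp
      then show "norm (A n * of_real (f n - f (Suc n))) \<le> K * (f n - f (Suc n))"
        using bd[of a n] by (simp only: norm_mult norm_of_real A_def abs_of_nonneg) (rule mult_right_mono)
    qed
  qed
  also have "(\<Sum>n=a..<b. K * (f n - f (Suc n))) = K * (f a - f b)"
    unfolding sum_distrib_left[symmetric]
    using sum_Suc_diff'[OF True, of "\<lambda>n. - f n"] by simp
  finally show ?thesis by (simp add: algebra_simps)
next
  case False
  have "K \<ge> 0" using bd[of 0 0] norm_ge_zero order_trans by blast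
  then show ?thesis using False nonneg[of a] by simp
qed

section \<open>Sums of a bounded character\<close>

text \<open>What the analytic argument takes from a nonprincipal character; periodicity enters only
  through the bound \<open>K\<close> for sums over intervals.\<close>

locale bounded_character =
  fixes \<chi> :: "nat \<Rightarrow> complex" and K :: real
  assumes mult: "\<chi> (m * n) = \<chi> m * \<chi> n"
    and one: "\<chi> 1 = 1"
    and norm_le: "norm (\<chi> n) \<le> 1"
    and bd: "norm (\<Sum>n=a..b. \<chi> n) \<le> K"
begin

lemma K_nonneg: "K \<ge> 0"
  using bd[of 0 0] norm_ge_zero order_trans by blast

definition S :: "nat \<Rightarrow> complex" where
  "S N = (\<Sum>n=1..N. \<chi> n / of_nat n)"

text \<open>This is \<open>L(1, \<chi>)\<close>; \<open>S_tendsto\<close> shows that the limit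
  exists.\<close>

definition L :: complex where
  "L = lim S"

text \<open>Truncated Dirichlet series of \<open>- L' / L\<close> at 1. It stays bounded if
  \<open>L \<noteq> 0\<close> and is within a constant of \<open>- ln x\<close> if
  \<open>L = 0\<close>.\<close>

definition E :: "nat \<Rightarrow> complex" where
  "E x = (\<Sum>n=1..x. \<chi> n * mangoldt n / of_nat n)"

lemma S_diff:
  assumes "a \<le> b"
  shows "norm (S b - S a) \<le> K / (real a + 1)"
proof -
  have "{1..b} = {1..a} \<union> {Suc a..b}" using assms by auto
  then have "S b = S a + (\<Sum>n=Suc a..b. \<chi> n / of_nat n)"
    unfolding S_def by (simp add: sum.union_disjoint)
  then have "S b - S a = (\<Sum>n=Suc a..b. \<chi> n * of_real (1 / real n))" by simp
  moreover have "norm (\<Sum>n=Suc a..b. \<chi> n * of_real (1 / real n)) \<le> K * (1 / real (Suc a))"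
    by (rule sum_by_parts_norm_le[OF bd]) (auto simp: field_simps)
  ultimately show ?thesis by (simp add: add.commute)
qed

lemma S_tendsto: "S \<longlonglongrightarrow> L"
proof -
  have "Cauchy S"
  proof (rule metric_CauchyI)
    fix e :: real assume e: "e > 0"
    obtain M where M: "K / e < real M" using reals_Archimedean2 by blast
    have *: "dist (S m) (S n) < e" if "M \<le> m" "m \<le> n" for m n
    proof -
      have "dist (S m) (S n) \<le> K / (real m + 1)"
        using S_diff[OF that(2)] by (simp add: dist_norm norm_minus_commute)
      also have "\<dots> \<le> K / (real M + 1)"
        using that K_nonneg by (intro divide_left_mono) auto
      also have "\<dots> < e" using M e by (simp add: field_simps)
      finally show ?thesis .
    qed
    show "\<exists>M. \<forall>m\<ge>M. \<forall>n\<ge>M. dist (S m) (S n) < e"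
      using * by (metis dist_commute nle_le)
  qed
  then show ?thesis unfolding L_def by (simp add: Cauchy_convergent_iff convergent_LIMSEQ_iff)
qed

lemma S_minus_L: "norm (S N - L) \<le> K / (real N + 1)"
proof (rule tendsto_upperbound)
  show "(\<lambda>n. norm (S N - S n)) \<longlonglongrightarrow> norm (S N - L)"
    by (intro tendsto_intros S_tendsto)
  show "\<forall>\<^sub>F n in sequentially. norm (S N - S n) \<le> K / (real N + 1)"
    using eventually_ge_at_top[of N]
    by eventually_elim (metis S_diff norm_minus_commute)
qed simp

lemma S_div_minus_L:
  assumes "m > 0" "x > 0"
  shows "norm (S (x div m) - L) \<le> K * real m / real x"
proof -
  have "norm (S (x div m) - L) \<le> K / (real (x div m) + 1)" by (rule S_minus_L)
  also have "\<dots> \<le> K / (real x / real m)"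
    using of_nat_div_less_Suc[OF assms(1), of x] assms K_nonneg
    by (intro divide_left_mono) auto
  finally show ?thesis by simp
qed

lemma log_sum_bounded: "\<exists>C. \<forall>x. norm (\<Sum>n=1..x. \<chi> n * of_real (ln (real n)) / of_nat n) \<le> C"
proof -
  define f where "f n = ln (real n) / real n" for n
  have eq: "\<chi> n * of_real (ln (real n)) / of_nat n = \<chi> n * of_real (f n)" for n
    by (simp add: f_def)
  \<comment> \<open>\<open>ln n / n\<close> decreases only beyond \<open>exp 1\<close>, so summation
    by parts starts at 3.\<close>
  have tail: "norm (\<Sum>n=3..x. \<chi> n * of_real (f n)) \<le> K * f 3" for x
  proof (rule sum_by_parts_norm_le[OF bd])
    fix n :: nat assume n: "n \<ge> 3"
    then have "exp 1 \<le> real n" using exp_le by simp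
    then show "f (Suc n) \<le> f n" unfolding f_def by (intro ln_x_over_x_mono) auto
    show "0 \<le> f n" using n by (simp add: f_def)
  qed
  have "norm (\<Sum>n=1..x. \<chi> n * of_real (f n)) \<le> (\<Sum>n=1..2. f n) + K * f 3" for x
  proof -
    have "{1..x} = {1..min x 2} \<union> {3..x}" by auto
    then have "(\<Sum>n=1..x. \<chi> n * of_real (f n))
        = (\<Sum>n=1..min x 2. \<chi> n * of_real (f n)) + (\<Sum>n=3..x. \<chi> n * of_real (f n))"
      by (simp add: sum.union_disjoint)
    also have "norm \<dots> \<le> (\<Sum>n=1..min x 2. f n) + K * f 3"
    proof (rule order_trans[OF norm_triangle_ineq add_mono[OF _ tail]])
      show "norm (\<Sum>n=1..min x 2. \<chi> n * of_real (f n)) \<le> (\<Sum>n=1..min x 2. f n)"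
      proof (rule sum_norm_le)
        fix n assume "n \<in> {1..min x 2}"
        then have "f n \<ge> 0" by (simp add: f_def)
        then show "norm (\<chi> n * of_real (f n)) \<le> f n"
          using norm_le[of n] by (simp add: norm_mult mult_left_le_one_le)
      qed
    qed
    also have "(\<Sum>n=1..min x 2. f n) \<le> (\<Sum>n=1..2. f n)"
      by (rule sum_mono2) (auto simp: f_def)
    finally show ?thesis by simp
  qed
  then show ?thesis unfolding eq by blast
qed

text \<open>Since \<open>ln n\<close> is the sum of \<open>mangoldt m\<close> over the divisors
  \<open>m\<close> of \<open>n\<close>, the bounded sum of \<open>\<chi> n * ln n / n\<close> equals
  that of \<open>\<chi> m * mangoldt m / m * S (x div m)\<close>. Replacing
  \<open>S (x div m)\<close> by \<open>L\<close> costs in total at most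
  \<open>K * psi x / x \<le> 4 * K\<close>.\<close>

lemma L_mult_E_bounded: "\<exists>C. \<forall>x\<ge>1. norm (L * E x) \<le> C"
proof -
  obtain C where C: "\<And>x. norm (\<Sum>n=1..x. \<chi> n * of_real (ln (real n)) / of_nat n) \<le> C"
    using log_sum_bounded by blast
  have "norm (L * E x) \<le> C + 4 * K" if x: "x \<ge> 1" for x
  proof -
    have "(\<Sum>n=1..x. \<chi> n * of_real (ln (real n)) / of_nat n)
       = (\<Sum>n=1..x. \<Sum>m | m dvd n. (\<chi> m * mangoldt m / of_nat m) * (\<chi> (n div m) / of_nat (n div m)))"
    proof (rule sum.cong)
      fix n assume n: "n \<in> {1..x}"
      have "\<chi> n * of_real (ln (real n)) / of_nat n = (\<Sum>m | m dvd n. \<chi> n * mangoldt m / of_nat n)"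
        using mangoldt_sum[of n, where 'a = complex] n
        by (simp add: sum_distrib_left[symmetric] sum_divide_distrib[symmetric])
      also have "\<dots> = (\<Sum>m | m dvd n. (\<chi> m * mangoldt m / of_nat m) * (\<chi> (n div m) / of_nat (n div m)))"
      proof (rule sum.cong)
        fix m assume "m \<in> {m. m dvd n}"
        then have "n = m * (n div m)" by simp
        then have "\<chi> n = \<chi> m * \<chi> (n div m)" "(of_nat n :: complex) = of_nat m * of_nat (n div m)"
          by (metis mult, metis of_nat_mult)
        then show "\<chi> n * mangoldt m / of_nat n = (\<chi> m * mangoldt m / of_nat m) * (\<chi> (n div m) / of_nat (n div m))"
          by simp
      qed simp
      finally show "\<chi> n * of_real (ln (real n)) / of_nat n = \<dots>" .
    qed simp
    also have "\<dots> = (\<Sum>m=1..x. \<chi> m * mangoldt m / of_nat m * S (x div m))"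
      unfolding S_def sum_distrib_left by (rule sum_divisors_reindex)
    also have "\<dots> = L * E x + (\<Sum>m=1..x. \<chi> m * mangoldt m / of_nat m * (S (x div m) - L))"
      by (simp add: E_def sum_distrib_left sum.distrib[symmetric] algebra_simps diff_divide_distrib)
    finally have "L * E x = (\<Sum>n=1..x. \<chi> n * of_real (ln (real n)) / of_nat n)
        - (\<Sum>m=1..x. \<chi> m * mangoldt m / of_nat m * (S (x div m) - L))" by simp
    also have "norm \<dots> \<le> C + 4 * K"
    proof (rule order_trans[OF norm_triangle_ineq4] add_mono C)+
      have "norm (\<Sum>m=1..x. \<chi> m * mangoldt m / of_nat m * (S (x div m) - L))
          \<le> (\<Sum>m=1..x. mangoldt m * (K / real x))"
      proof (rule sum_norm_le)
        fix m assume m: "m \<in> {1..x}"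
        have "norm (\<chi> m * mangoldt m / of_nat m * (S (x div m) - L))
            = norm (\<chi> m) * (mangoldt m / real m * norm (S (x div m) - L))"
          by (simp add: norm_mult norm_divide)
        also have "\<dots> \<le> 1 * (mangoldt m / real m * (K * real m / real x))"
          using m x by (intro mult_mono norm_le S_div_minus_L mult_nonneg_nonneg divide_nonneg_nonneg
            mangoldt_nonneg) auto
        also have "\<dots> = mangoldt m * (K / real x)" using m by simp
        finally show "norm (\<chi> m * mangoldt m / of_nat m * (S (x div m) - L)) \<le> mangoldt m * (K / real x)" .
      qed
      also have "\<dots> = psi x * (K / real x)" by (simp only: psi_def sum_distrib_right)
      also have "\<dots> \<le> 4 * real x * (K / real x)"
        using K_nonneg by (intro mult_right_mono psi_le) auto
      also have "\<dots> = 4 * K" using x by simp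
      finally show "norm (\<Sum>m=1..x. \<chi> m * mangoldt m / of_nat m * (S (x div m) - L)) \<le> 4 * K" .
    qed
    finally show ?thesis .
  qed
  then show ?thesis by blast
qed

text \<open>Summing \<open>moebius t * ln (x / t)\<close> over the divisors \<open>t\<close> of
  \<open>n\<close> gives \<open>mangoldt n\<close>, plus \<open>ln x\<close> if
  \<open>n = 1\<close>; twisted by \<open>\<chi>\<close> this produces \<open>ln x + E x\<close>. If
  \<open>L = 0\<close>, the inner sums \<open>S (x div t)\<close> are at most
  \<open>K * t / x\<close>, and the terms add up to \<open>K / x\<close> times
  \<open>x * ln x - ln (fact x)\<close>, hence to at most \<open>K\<close>.\<close>

lemma E_if_L_zero:
  assumes "L = 0"
  shows "\<forall>x\<ge>1. norm (of_real (ln (real x)) + E x) \<le> K"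
proof (intro allI impI)
  fix x :: nat assume x: "x \<ge> 1"
  define G where "G t = \<chi> t * of_real (moebius t * ln (real x / real t)) / of_nat t" for t
  have "(\<Sum>n=1..x. \<Sum>t | t dvd n. G t * (\<chi> (n div t) / of_nat (n div t)))
      = (\<Sum>n=1..x. (if n = 1 then of_real (ln (real x)) else 0) + \<chi> n * mangoldt n / of_nat n)"
  proof (rule sum.cong)
    fix n assume n: "n \<in> {1..x}"
    have "(\<Sum>t | t dvd n. G t * (\<chi> (n div t) / of_nat (n div t)))
        = (\<Sum>t | t dvd n. \<chi> n / of_nat n * of_real (moebius t * (ln (real x) - ln (real n)) + moebius t * ln (real (n div t))))"
    proof (rule sum.cong)
      fix t assume "t \<in> {t. t dvd n}"
      then have t: "n = t * (n div t)" by simp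
      have pos: "t > 0" "n div t > 0" using n t by (auto intro!: Nat.gr0I)
      from t have e1: "\<chi> n = \<chi> t * \<chi> (n div t)" and e2: "(of_nat n :: complex) = of_nat t * of_nat (n div t)"
        by (metis mult, metis of_nat_mult)
      have e3: "ln (real x / real t) = ln (real x) - ln (real n) + ln (real (n div t))"
      proof -
        have "real n = real t * real (n div t)" using t by (metis of_nat_mult)
        then have "ln (real n) = ln (real t) + ln (real (n div t))" using pos by (simp add: ln_mult)
        then show ?thesis using pos x by (simp add: ln_div)
      qed
      show "G t * (\<chi> (n div t) / of_nat (n div t)) = \<chi> n / of_nat n * of_real (moebius t * (ln (real x) - ln (real n)) + moebius t * ln (real (n div t)))"
        unfolding G_def e3 e1 e2 by (simp add: algebra_simps add_divide_distrib diff_divide_distrib)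
    qed simp
    also have "\<dots> = \<chi> n / of_nat n * of_real ((\<Sum>t | t dvd n. moebius t) * (ln (real x) - ln (real n)) + (\<Sum>t | t dvd n. moebius t * ln (real (n div t))))"
      by (simp only: sum_distrib_right sum.distrib[symmetric] of_real_sum sum_distrib_left)
    also have "\<dots> = (if n = 1 then of_real (ln (real x)) else 0) + \<chi> n * mangoldt n / of_nat n"
      using n sum_moebius_divisors[of n] sum_moebius_ln[of n] one by (auto simp: algebra_simps)
    finally show "(\<Sum>t | t dvd n. G t * (\<chi> (n div t) / of_nat (n div t))) = \<dots>" .
  qed simp
  also have "\<dots> = of_real (ln (real x)) + E x"
    using x by (simp add: sum.distrib E_def sum.delta)
  finally have "of_real (ln (real x)) + E x = (\<Sum>t=1..x. G t * S (x div t))"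
    unfolding S_def sum_distrib_left sum_divisors_reindex[of "\<lambda>t s. G t * (\<chi> s / of_nat s)"] by simp
  also have "norm \<dots> \<le> (\<Sum>t=1..x. (ln (real x) - ln (real t)) * (K / real x))"
  proof (rule sum_norm_le)
    fix t assume t: "t \<in> {1..x}"
    have l: "ln (real x / real t) = ln (real x) - ln (real t)" "ln (real x) - ln (real t) \<ge> 0" using t x by (auto simp: ln_div)
    have "norm (G t * S (x div t)) = norm (\<chi> t) * (\<bar>moebius t\<bar> * ((ln (real x) - ln (real t)) / real t * norm (S (x div t))))"
      using l by (simp add: G_def norm_mult norm_divide abs_mult flip: of_real_diff)
    also have "\<dots> \<le> 1 * (1 * ((ln (real x) - ln (real t)) / real t * (K * real t / real x)))"
      using t x l S_div_minus_L[of t x] assms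
      by (intro mult_mono norm_le abs_moebius_le mult_nonneg_nonneg divide_nonneg_nonneg) auto
    also have "\<dots> = (ln (real x) - ln (real t)) * (K / real x)" using t by simp
    finally show "norm (G t * S (x div t)) \<le> (ln (real x) - ln (real t)) * (K / real x)" .
  qed
  also have "\<dots> = (real x * ln (real x) - ln (fact x)) * (K / real x)"
    unfolding sum_distrib_right[symmetric] sum_subtractf ln_fact_sum by simp
  also have "\<dots> \<le> real x * (K / real x)"
    using ln_fact_bounds(2)[OF x] K_nonneg by (intro mult_right_mono) auto
  also have "\<dots> = K" using x by simp
  finally show "norm (of_real (ln (real x)) + E x) \<le> K" .
qed

lemma E_bounds:
  shows "\<exists>C. \<forall>x\<ge>1. Re (E x) \<le> C"
    and "L \<noteq> 0 \<Longrightarrow> \<exists>C. \<forall>x\<ge>1. norm (E x) \<le> C"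
proof -
  show *: "\<exists>C. \<forall>x\<ge>1. norm (E x) \<le> C" if "L \<noteq> 0"
  proof -
    obtain C where C: "\<And>x. x \<ge> 1 \<Longrightarrow> norm (L * E x) \<le> C" using L_mult_E_bounded by blast
    then have "norm (E x) \<le> C / norm L" if "x \<ge> 1" for x
      using \<open>L \<noteq> 0\<close> C[OF that] by (simp add: norm_mult field_simps)
    then show ?thesis by blast
  qed
  show "\<exists>C. \<forall>x\<ge>1. Re (E x) \<le> C"
  proof (cases "L = 0")
    case True
    have "Re (E x) \<le> K" if "x \<ge> 1" for x
    proof -
      have "ln (real x) + Re (E x) \<le> K"
        using E_if_L_zero[OF True] that complex_Re_le_cmod[of "of_real (ln (real x)) + E x"] by force
      moreover have "ln (real x) \<ge> 0" using that by simp
      ultimately show ?thesis by linarith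
    qed
    then show ?thesis by blast
  next
    case False
    then show ?thesis using * complex_Re_le_cmod order_trans by meson
  qed
qed

end

section \<open>Nonvanishing of L(1, chi) for real characters\<close>

lemma sum_divisors_prime_power_mult:
  fixes c :: "nat \<Rightarrow> real"
  assumes mult: "\<And>m n. c (m * n) = c m * c n" and one: "c 1 = 1"
    and p: "prime p" "\<not> p dvd m" "m > 0"
  shows "(\<Sum>t | t dvd p ^ a * m. c t) = (\<Sum>i\<le>a. c p ^ i) * (\<Sum>t | t dvd m. c t)"
proof -
  have pow: "c (p ^ i) = c p ^ i" for i by (induction i) (use one in \<open>auto simp: mult\<close>)
  have inj: "inj_on (\<lambda>(i, t). p ^ i * t) ({..a} \<times> {t. t dvd m})"
  proof (rule inj_onI, clarsimp)
    fix i t j s assume *: "t dvd m" "s dvd m" "p ^ i * t = p ^ j * s"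
    have mu: "multiplicity p (p ^ i * t) = i" if "t dvd m" for i t
    proof (rule multiplicity_eqI)
      have "\<not> p dvd t" using that p dvd_trans by blast
      then show "\<not> p ^ Suc i dvd p ^ i * t" using p(1) by (simp add: mult.commute[of p])
    qed simp
    have "i = j" using mu[OF *(1), of i] mu[OF *(2), of j] *(3) by simp
    then show "i = j \<and> t = s" using * p(1) by simp
  qed
  have img: "{t. t dvd p ^ a * m} = (\<lambda>(i, t). p ^ i * t) ` ({..a} \<times> {t. t dvd m})"
  proof (intro equalityI subsetI)
    fix s assume "s \<in> {t. t dvd p ^ a * m}"
    then obtain u v where "s = u * v" "u dvd p ^ a" "v dvd m" using division_decomp by blast
    moreover obtain i where "i \<le> a" "u = p ^ i"
      using \<open>u dvd p ^ a\<close> p(1) by (auto simp: divides_primepow_nat)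
    ultimately show "s \<in> (\<lambda>(i, t). p ^ i * t) ` ({..a} \<times> {t. t dvd m})" by force
  qed (auto intro!: mult_dvd_mono le_imp_power_dvd)
  have "(\<Sum>t | t dvd p ^ a * m. c t) = (\<Sum>(i, t)\<in>{..a} \<times> {t. t dvd m}. c p ^ i * c t)"
    unfolding img by (subst sum.reindex[OF inj]) (auto simp: mult pow intro!: sum.cong)
  also have "\<dots> = (\<Sum>i\<le>a. c p ^ i) * (\<Sum>t | t dvd m. c t)"
    by (simp add: sum_product sum.cartesian_product)
  finally show ?thesis .
qed

lemma sum_powers_sign:
  fixes x :: real
  assumes "x \<in> {-1, 0, 1}"
  shows "(\<Sum>i\<le>a. x ^ i) \<ge> 0" and "even a \<Longrightarrow> (\<Sum>i\<le>a. x ^ i) \<ge> 1"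
proof -
  consider "x = -1" | "x = 0" | "x = 1" using assms by auto
  then have "(\<Sum>i\<le>a. x ^ i) \<ge> (if even a then 1 else 0)"
  proof cases
    case 1
    have "(\<Sum>i\<le>a. x ^ i) = (if even a then 1 else 0)"
      unfolding 1 by (induction a) auto
    then show ?thesis by simp
  next
    case 2
    have "(\<Sum>i\<le>a. x ^ i) = 1" unfolding 2 by (induction a) auto
    then show ?thesis by simp
  next
    case 3
    then show ?thesis by simp
  qed
  then show "(\<Sum>i\<le>a. x ^ i) \<ge> 0" and "even a \<Longrightarrow> (\<Sum>i\<le>a. x ^ i) \<ge> 1"
    by (auto split: if_splits)
qed

text \<open>The divisor sum is multiplicative. Its factor \<open>1 + c p + ... + c p ^ a\<close> at
  a prime \<open>p\<close> is never negative, and it is at least 1 when \<open>a\<close> is even, as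
  it is for squares.\<close>

lemma sum_divisors_real_character:
  fixes c :: "nat \<Rightarrow> real"
  assumes mult: "\<And>m n. c (m * n) = c m * c n" and one: "c 1 = 1"
    and vals: "\<And>n. c n \<in> {-1, 0, 1}" and n: "n > 0"
  shows "(\<Sum>t | t dvd n. c t) \<ge> 0 \<and> (\<Sum>t | t dvd n\<^sup>2. c t) \<ge> 1"
  using n
proof (induction n rule: less_induct)
  case (less n)
  show ?case
  proof (cases "n = 1")
    case True
    then show ?thesis using one by simp
  next
    case False
    then obtain p where p: "prime p" "p dvd n" using prime_factor_nat by blast
    obtain m where m: "n = p ^ multiplicity p n * m" "\<not> p dvd m"
      using multiplicity_decompose'[of n p] less.prems p by (metis not_prime_unit less_numeral_extra(3))
    define a where "a = multiplicity p n"
    have nn: "n = p ^ a * m" using m(1) by (simp only: a_def)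
    have m0: "m > 0" using m less.prems by (auto intro: Nat.gr0I)
    have a: "a \<ge> 1" using p less.prems unfolding a_def
      by (metis One_nat_def Suc_leI multiplicity_gt_zero_iff prime_gt_0_nat not_prime_unit neq0_conv)
    have mn: "m < n"
    proof -
      have "1 < p ^ a" using one_less_power[OF prime_gt_1_nat[OF p(1)], of a] a by simp
      then have "1 * m < p ^ a * m" using m0 by (intro mult_strict_right_mono) auto
      then show ?thesis using nn by simp
    qed
    have "(\<Sum>t | t dvd n. c t) = (\<Sum>i\<le>a. c p ^ i) * (\<Sum>t | t dvd m. c t)"
      using sum_divisors_prime_power_mult[OF mult one p(1) m(2) m0, of a] nn by simp
    moreover have "(\<Sum>t | t dvd n\<^sup>2. c t) = (\<Sum>i\<le>2*a. c p ^ i) * (\<Sum>t | t dvd m\<^sup>2. c t)"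
    proof -
      have "n\<^sup>2 = p ^ (2 * a) * m\<^sup>2"
        using nn by (simp add: power_mult_distrib mult.commute[of 2] flip: power_mult)
      moreover have "\<not> p dvd m\<^sup>2" using m(2) p(1) prime_dvd_power by blast
      ultimately show ?thesis
        using sum_divisors_prime_power_mult[OF mult one p(1), of "m\<^sup>2" "2*a"] m0 by simp
    qed
    moreover have "1 * 1 \<le> (\<Sum>i\<le>2*a. c p ^ i) * (\<Sum>t | t dvd m\<^sup>2. c t)"
      using sum_powers_sign(2)[OF vals[of p], of "2*a"] less.IH[OF mn m0] by (intro mult_mono) auto
    ultimately show ?thesis
      using sum_powers_sign(1)[OF vals[of p], of a] less.IH[OF mn m0] by simp
  qed
qed

text \<open>Monsky's weights: the sum of \<open>\<chi> n * monsky y n\<close> over \<open>n\<close> is \<open>L / (1 - y)\<close> minus the Lambert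
  series with the nonnegative coefficients \<open>\<Sum>t | t dvd m. \<chi> t\<close>.\<close>
definition monsky :: "real \<Rightarrow> nat \<Rightarrow> real" where
  "monsky y n = 1 / (real n * (1 - y)) - y ^ n / (1 - y ^ n)"

lemma monsky_nonneg:
  assumes "0 < y" "y < 1" "n \<ge> 1"
  shows "monsky y n \<ge> 0"
proof -
  have "real n * y ^ n = (\<Sum>i<n. y ^ n)" by simp
  also have "\<dots> \<le> (\<Sum>i<n. y ^ i)" using assms by (intro sum_mono power_decreasing) auto
  also have "\<dots> = (1 - y ^ n) / (1 - y)" using assms by (simp add: sum_gp_strict)
  finally have "real n * y ^ n * (1 - y) \<le> 1 - y ^ n" using assms by (simp add: pos_le_divide_eq)
  moreover have "y ^ n < 1" using assms by (simp add: power_less_one_iff)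
  ultimately have "y ^ n / (1 - y ^ n) \<le> 1 / (real n * (1 - y))"
    using assms by (simp add: pos_divide_le_eq pos_le_divide_eq mult_ac)
  then show ?thesis unfolding monsky_def by simp
qed

text \<open>Pairing \<open>(i, j)\<close> with \<open>(n - 1 - i, n - j)\<close> and AM-GM give
  \<open>(1 + \<dots> + y ^ (n - 1)) * (1 + \<dots> + y ^ n) \<ge> n * (n + 1) * y ^ n\<close>.\<close>
lemma monsky_decreasing:
  assumes y: "0 < y" "y < 1" and n: "n \<ge> 1"
  shows "monsky y (Suc n) \<le> monsky y n"
proof -
  define P where "P = (\<Sum>(i, j)\<in>{..<n} \<times> {..n}. y ^ (i + j))"
  have pair: "2 * y ^ n \<le> y ^ a + y ^ b" if sum: "a + b = 2 * n - 1" for a b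
  proof -
    have *: "2 * y ^ n \<le> y ^ a + y ^ b" if ab: "a + b = 2 * n - 1" "a < n" for a b
    proof -
      have "y ^ (2 * n - a) \<le> y ^ b" using ab y n by (intro power_decreasing) auto
      moreover have "y ^ (2 * n - a) = y ^ a * (y ^ (n - a))\<^sup>2" "y ^ n = y ^ a * y ^ (n - a)"
        using ab by (simp_all flip: power_add power_mult) (rule arg_cong[of _ _ "power y"], simp)
      moreover have "0 \<le> y ^ a * (1 - y ^ (n - a))\<^sup>2" using y by simp
      ultimately show ?thesis by (simp add: power2_eq_square algebra_simps)
    qed
    consider "a < n" | "b < n" using sum n by linarith
    then show ?thesis using *[of a b] *[of b a] sum by cases (auto simp: add.commute)
  qed
  have refl: "P = (\<Sum>(i, j)\<in>{..<n} \<times> {..n}. y ^ ((n - 1 - i) + (n - j)))"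
    unfolding P_def
    by (rule sum.reindex_bij_witness[of _ "\<lambda>(i, j). (n - 1 - i, n - j)" "\<lambda>(i, j). (n - 1 - i, n - j)"]) auto
  have "(\<Sum>(i, j)\<in>{..<n} \<times> {..n}. 2 * y ^ n)
      \<le> (\<Sum>(i, j)\<in>{..<n} \<times> {..n}. y ^ (i + j) + y ^ ((n - 1 - i) + (n - j)))"
    by (rule sum_mono) (auto intro!: pair)
  also have "\<dots> = P + P"
    by (subst (2) refl) (simp add: P_def sum.distrib[symmetric] case_prod_beta)
  finally have "real n * (real n + 1) * y ^ n \<le> P"
    by (simp add: case_prod_beta algebra_simps)
  also have "P = (\<Sum>i<n. y ^ i) * (\<Sum>j\<le>n. y ^ j)"
    by (simp add: P_def sum_product sum.cartesian_product power_add)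
  also have "\<dots> = (1 - y ^ n) / (1 - y) * ((1 - y ^ Suc n) / (1 - y))"
    using y by (simp add: sum_gp_strict sum_gp0)
  finally have "real n * (real n + 1) * y ^ n * (1 - y)\<^sup>2 \<le> (1 - y ^ n) * (1 - y ^ Suc n)"
    using y by (simp add: power2_eq_square pos_le_divide_eq mult_ac)
  moreover have lt: "y ^ n < 1" "y ^ Suc n < 1" using y n by (simp_all add: power_less_one_iff del: power_Suc)
  ultimately have main: "y ^ n * (1 - y) / ((1 - y ^ n) * (1 - y ^ Suc n)) \<le> 1 / (real n * (real n + 1) * (1 - y))"
    using y n by (simp add: divide_simps power2_eq_square mult_ac del: power_Suc)
  have "monsky y n - monsky y (Suc n)
    = (1 / (real n * (1 - y)) - 1 / (real (Suc n) * (1 - y))) - (y ^ n / (1 - y ^ n) - y ^ Suc n / (1 - y ^ Suc n))"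
    by (simp add: monsky_def)
  also have "1 / (real n * (1 - y)) - 1 / (real (Suc n) * (1 - y)) = 1 / (real n * (real n + 1) * (1 - y))"
    using y n by (simp add: divide_simps)
  also have "y ^ n / (1 - y ^ n) - y ^ Suc n / (1 - y ^ Suc n) = y ^ n * (1 - y) / ((1 - y ^ n) * (1 - y ^ Suc n))"
    using lt by (simp add: divide_simps del: power_Suc) (simp add: algebra_simps)
  finally show ?thesis using main by simp
qed

context bounded_character
begin

text \<open>If \<open>L = 0\<close>, the Lambert series is minus the sum of
  \<open>\<chi> n * monsky y n\<close>, which is at most \<open>K * monsky y 1 = K\<close> in norm.
  So the power series with coefficients \<open>r n\<close> stays below \<open>K\<close> as
  \<open>y\<close> tends to 1, although \<open>r\<close> is at least 1 at every square.\<close>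

lemma L_nonzero_if_real:
  assumes vals: "\<And>n. \<chi> n \<in> {-1, 0, 1}"
  shows "L \<noteq> 0"
proof
  assume L0: "L = 0"
  define c where "c n = Re (\<chi> n)" for n
  have \<chi>: "\<chi> n = of_real (c n)" for n using vals[of n] by (auto simp: c_def)
  have cm: "c (m * n) = c m * c n" for m n
    using mult[of m n] unfolding \<chi> by (metis of_real_eq_iff of_real_mult)
  have c1: "c 1 = 1" using one by (simp add: c_def)
  have cv: "c n \<in> {-1, 0, 1}" for n using vals[of n] by (auto simp: c_def)
  define r where "r n = (\<Sum>t | t dvd n. c t)" for n
  have r0: "r n \<ge> 0" if "n \<ge> 1" for n
    using sum_divisors_real_character[OF cm c1 cv] that by (simp add: r_def)
  have r1: "r (n\<^sup>2) \<ge> 1" if "n \<ge> 1" for n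
    using sum_divisors_real_character[OF cm c1 cv] that by (simp add: r_def)
  have bound: "(\<Sum>n=1..X. r n * y ^ n) \<le> K" if y: "0 < y" "y < 1" for y X
  proof -
    define F where "F X = (\<Sum>n=1..X. r n * y ^ n)" for X
    \<comment> \<open>The three errors of truncating at \<open>X\<close>: the tails of the geometric
      series, the distance of \<open>S X\<close> from \<open>L = 0\<close>, and the sum with
      Monsky's weights. Only the last survives as \<open>X\<close> grows.\<close>
    define G where "G X = real X * y ^ X / (1 - y) + (K / (real X + 1) / (1 - y) + K)" for X :: nat
    have FG: "F X \<le> G X" for X
    proof -
      have yt: "y ^ t \<le> y" "y ^ t < 1" if "t \<ge> 1" for t
      proof -
        show "y ^ t \<le> y" using power_decreasing[OF that, of y] y by simp
        then show "y ^ t < 1" using y by simp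
      qed
      have "F X = (\<Sum>n=1..X. \<Sum>t | t dvd n. c t * (y ^ t) ^ (n div t))"
        unfolding F_def r_def sum_distrib_right
        by (intro sum.cong refl) (auto simp flip: power_mult)
      also have "\<dots> = (\<Sum>t=1..X. \<Sum>s=1..X div t. c t * (y ^ t) ^ s)"
        by (rule sum_divisors_reindex)
      also have "\<dots> = (\<Sum>t=1..X. c t * (y ^ t / (1 - y ^ t)) - c t * ((y ^ t) ^ (X div t + 1) / (1 - y ^ t)))"
      proof (rule sum.cong)
        fix t assume t: "t \<in> {1..X}"
        then have "X div t \<ge> 1" by (simp add: div_greater_zero_iff Suc_le_eq)
        then have "(\<Sum>s=1..X div t. (y ^ t) ^ s) = ((y ^ t) ^ 1 - (y ^ t) ^ (X div t + 1)) / (1 - y ^ t)"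
          using yt(2)[of t] t by (subst sum_gp) auto
        then show "(\<Sum>s=1..X div t. c t * (y ^ t) ^ s)
          = c t * (y ^ t / (1 - y ^ t)) - c t * ((y ^ t) ^ (X div t + 1) / (1 - y ^ t))"
          unfolding sum_distrib_left[symmetric] by (simp add: diff_divide_distrib right_diff_distrib)
      qed simp
      also have "\<dots> = (\<Sum>t=1..X. c t * (y ^ t / (1 - y ^ t))) + (\<Sum>t=1..X. - (c t * ((y ^ t) ^ (X div t + 1) / (1 - y ^ t))))"
        by (simp add: sum_subtractf sum_negf)
      also have "(\<Sum>t=1..X. - (c t * ((y ^ t) ^ (X div t + 1) / (1 - y ^ t)))) \<le> (\<Sum>t=1..X. y ^ X / (1 - y))"
      proof (rule sum_mono)
        fix t assume t: "t \<in> {1..X}"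
        have "X \<le> t * (X div t + 1)" using dividend_less_times_div[of t X] t by simp
        then have "(y ^ t) ^ (X div t + 1) \<le> y ^ X"
          using y by (simp only: power_mult[symmetric]) (rule power_decreasing, auto)
        then have le: "(y ^ t) ^ (X div t + 1) / (1 - y ^ t) \<le> y ^ X / (1 - y)"
          using yt[of t] t y by (intro frac_le) auto
        have ge: "0 \<le> (y ^ t) ^ (X div t + 1) / (1 - y ^ t)" using yt[of t] t y by simp
        show "- (c t * ((y ^ t) ^ (X div t + 1) / (1 - y ^ t))) \<le> y ^ X / (1 - y)"
          using cv[of t] le ge by auto
      qed
      also have "(\<Sum>t=1..X. y ^ X / (1 - y)) = real X * y ^ X / (1 - y)" by simp
      also have "(\<Sum>t=1..X. c t * (y ^ t / (1 - y ^ t))) = Re (S X) / (1 - y) - Re (\<Sum>t=1..X. \<chi> t * of_real (monsky y t))"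
        unfolding S_def Re_sum sum_divide_distrib sum_subtractf[symmetric]
        by (intro sum.cong refl) (simp add: monsky_def c_def right_diff_distrib)
      also have "\<dots> \<le> K / (real X + 1) / (1 - y) + K"
      proof -
        have "norm (\<Sum>t=1..X. \<chi> t * of_real (monsky y t)) \<le> K * monsky y 1"
          using monsky_decreasing[OF y] monsky_nonneg[OF y] by (intro sum_by_parts_norm_le[OF bd]) auto
        also have "monsky y 1 = 1" using y by (simp add: monsky_def divide_simps)
        finally have 1: "- Re (\<Sum>t=1..X. \<chi> t * of_real (monsky y t)) \<le> K"
          using abs_Re_le_cmod[of "\<Sum>t=1..X. \<chi> t * of_real (monsky y t)"] by linarith
        have "Re (S X) \<le> K / (real X + 1)"
          using S_minus_L[of X] complex_Re_le_cmod[of "S X"] L0 by simp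
        then have "Re (S X) / (1 - y) \<le> K / (real X + 1) / (1 - y)"
          using y by (intro divide_right_mono) auto
        then show ?thesis using 1 by linarith
      qed
      finally show ?thesis unfolding G_def by linarith
    qed
    have "G \<longlonglongrightarrow> 0 / (1 - y) + (0 / (1 - y) + K)"
      unfolding G_def
    proof (intro tendsto_add tendsto_divide tendsto_const)
      show "(\<lambda>X. real X * y ^ X) \<longlonglongrightarrow> 0"
        using powser_times_n_limit_0[of y] y by simp
      show "(\<lambda>X. K / (real X + 1)) \<longlonglongrightarrow> 0" by real_asymp
    qed (use y in auto)
    then have lim: "G \<longlonglongrightarrow> K" by simp
    have "F X \<le> K"
    proof (rule tendsto_lowerbound[OF lim])
      show "\<forall>\<^sub>F n in sequentially. F X \<le> G n"
        using eventually_ge_at_top[of X]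
      proof eventually_elim
        case (elim n)
        have "F X \<le> F n" unfolding F_def using elim r0 y by (intro sum_mono2) auto
        then show ?case using FG[of n] by simp
      qed
    qed simp
    then show ?thesis by (simp add: F_def)
  qed
  have sum_r: "(\<Sum>n=1..X. r n) \<le> K" for X
  proof (rule tendsto_upperbound)
    show "((\<lambda>y. \<Sum>n=1..X. r n * y ^ n) \<longlongrightarrow> (\<Sum>n=1..X. r n)) (at_left (1::real))"
      by (rule tendsto_eq_intros refl | simp)+
    show "\<forall>\<^sub>F y in at_left (1::real). (\<Sum>n=1..X. r n * y ^ n) \<le> K"
      using eventually_at_left_field[of _ "1::real"] bound by (intro eventually_at_leftI[of 0]) auto
  qed simp
  obtain N :: nat where N: "K < real N" using reals_Archimedean2 by blast
  have "real N = (\<Sum>s=1..N. 1)" by simp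
  also have "\<dots> \<le> (\<Sum>s=1..N. r (s\<^sup>2))" by (rule sum_mono) (use r1 in auto)
  also have "\<dots> = (\<Sum>n\<in>(\<lambda>s. s\<^sup>2) ` {1..N}. r n)"
    by (subst sum.reindex) (auto simp: inj_on_def)
  also have "\<dots> \<le> (\<Sum>n=1..N\<^sup>2. r n)"
    using r0 by (intro sum_mono2) (auto intro: power_mono)
  also have "\<dots> \<le> K" by (rule sum_r)
  finally show False using N by simp
qed

end

section \<open>Dirichlet characters modulo a prime\<close>

lemma root_of_unity_power_cong:
  fixes z :: complex
  assumes "z ^ k = 1" "[a = b] (mod k)"
  shows "z ^ a = z ^ b"
proof -
  have "z ^ a = z ^ (a mod k)" for a
  proof -
    have "z ^ a = z ^ (k * (a div k) + a mod k)" by simp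
    also have "\<dots> = z ^ (a mod k)" unfolding power_add power_mult assms(1) by simp
    finally show ?thesis .
  qed
  from this[of a] this[of b] show ?thesis using assms(2) by (simp add: Cong.cong_def)
qed

lemma norm_periodic_sum_le:
  fixes f :: "nat \<Rightarrow> complex"
  assumes zero: "\<And>a. (\<Sum>n=a..<a+d. f n) = 0" and le: "\<And>n. norm (f n) \<le> 1" and d: "d > 0"
  shows "norm (\<Sum>n=a..<b. f n) \<le> real d"
proof (induction "b - a" arbitrary: a rule: less_induct)
  case less
  show ?case
  proof (cases "a + d \<le> b")
    case True
    have "(\<Sum>n=a..<b. f n) = (\<Sum>n=a..<a+d. f n) + (\<Sum>n=a+d..<b. f n)"
      using True by (subst sum.atLeastLessThan_concat) auto
    then show ?thesis using zero[of a] less[of "a + d"] True d by simp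
  next
    case False
    have "norm (\<Sum>n=a..<b. f n) \<le> (\<Sum>n=a..<b. 1)" by (rule sum_norm_le) (rule le)
    also have "\<dots> \<le> real d" using False by simp
    finally show ?thesis .
  qed
qed

text \<open>Only the powers of \<open>d\<close> contribute, and they are dominated by a geometric
  series of ratio 1/2. The sum is what separates the principal character modulo \<open>d\<close>
  from the full Mertens sum.\<close>

lemma sum_mangoldt_multiples_le:
  assumes d: "prime d"
  shows "(\<Sum>n\<in>{n\<in>{1..x}. d dvd n}. mangoldt n / real n) \<le> ln (real d)"
proof -
  let ?D = "{n\<in>{1..x}. d dvd n}"
  have d2: "d \<ge> 2" using prime_ge_2_nat[OF d] .
  have "(\<Sum>n\<in>?D. mangoldt n / real n) = (\<Sum>n\<in>{n\<in>?D. primepow n}. mangoldt n / real n)"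
    by (rule sum.mono_neutral_right) (auto simp: mangoldt_def)
  also have "\<dots> \<le> (\<Sum>n\<in>(\<lambda>j. d ^ j) ` {1..x}. mangoldt n / real n)"
  proof (rule sum_mono2)
    show "{n\<in>?D. primepow n} \<subseteq> (\<lambda>j. d ^ j) ` {1..x}"
    proof
      fix n assume n: "n \<in> {n\<in>?D. primepow n}"
      then obtain p k where pk: "prime p" "k > 0" "n = p ^ k" by (auto simp: primepow_def)
      then have "d = p" using n d by (metis (no_types, lifting) mem_Collect_eq prime_dvd_power primes_dvd_imp_eq)
      moreover have "k < d ^ k" using d2 by (intro power_gt_expt) auto
      ultimately show "n \<in> (\<lambda>j. d ^ j) ` {1..x}" using pk n by auto
    qed
  qed (auto intro: divide_nonneg_nonneg mangoldt_nonneg)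
  also have "\<dots> = (\<Sum>j=1..x. mangoldt (d ^ j) / real (d ^ j))"
    using d2 by (subst sum.reindex) (auto intro!: inj_onI)
  also have "\<dots> \<le> (\<Sum>j=1..x. ln (real d) * (1 / 2) ^ j)"
  proof (rule sum_mono)
    fix j assume j: "j \<in> {1..x}"
    have "(2::real) ^ j \<le> real d ^ j" using d2 by (intro power_mono) auto
    then have "ln (real d) / real d ^ j \<le> ln (real d) / 2 ^ j"
      using d2 by (intro divide_left_mono) auto
    then show "mangoldt (d ^ j) / real (d ^ j) \<le> ln (real d) * (1 / 2) ^ j"
      using mangoldt_primepow'[OF d, of j, where 'a = real] j by (simp add: power_one_over)
  qed
  also have "\<dots> = ln (real d) * (\<Sum>j=1..x. (1 / 2) ^ j)" by (simp add: sum_distrib_left)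
  also have "(\<Sum>j=1..x. (1 / 2 :: real) ^ j) = 1 - (1 / 2) ^ x"
    by (induction x) auto
  also have "ln (real d) * (1 - (1 / 2) ^ x) \<le> ln (real d)"
    using d2 by (intro mult_left_le) auto
  finally show ?thesis .
qed

locale prime_modulus =
  fixes d g :: nat
  assumes d: "prime d" and g: "residue_primroot d g"
begin

definition phi :: nat where "phi = d - 1"

text \<open>Discrete logarithm to the base \<open>g\<close>. At multiples of \<open>d\<close> the
  value is arbitrary; \<open>char\<close> overrides it by 0.\<close>

definition ind :: "nat \<Rightarrow> nat" where
  "ind n = (SOME i. i < phi \<and> g ^ i mod d = n mod d)"

text \<open>The units modulo \<open>d\<close> form a cyclic group, so the \<open>phi\<close>-th
  roots of unity \<open>z\<close> parametrise all characters; \<open>z = 1\<close> is the principal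
  one.\<close>

definition char :: "complex \<Rightarrow> nat \<Rightarrow> complex" where
  "char z n = (if d dvd n then 0 else z ^ ind n)"

lemma d_gt_1: "d > 1"
  using prime_gt_1_nat[OF d] .

lemma phi_pos: "phi > 0"
  using d_gt_1 by (simp add: phi_def)

lemma totient_d: "totient d = phi"
  using totient_prime[OF d] by (simp only: phi_def)

lemma totatives_d: "totatives d = {1..<d}"
proof -
  have "{0<..<d} = {1..<d}" using atLeastSucLessThan_greaterThanLessThan[of 0 d] by simp
  then show ?thesis using totatives_prime[OF d] by (simp only:)
qed

lemma generator: "bij_betw (\<lambda>i. g ^ i mod d) {..<phi} {1..<d}"
  using residue_primroot_is_generator[OF d_gt_1 g] unfolding totient_d totatives_d .

lemma ind:
  assumes "\<not> d dvd n"
  shows "ind n < phi" and "[g ^ ind n = n] (mod d)"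
proof -
  have "n mod d \<in> {1..<d}" using assms d_gt_1 by (auto simp: Suc_le_eq mod_greater_zero_iff_not_dvd)
  then have "\<exists>i. i < phi \<and> g ^ i mod d = n mod d"
    using generator unfolding bij_betw_def by (metis (no_types, lifting) imageE lessThan_iff)
  from someI_ex[OF this] show "ind n < phi" and "[g ^ ind n = n] (mod d)"
    by (auto simp: ind_def Cong.cong_def)
qed

lemma g_power_cong_iff: "[g ^ a = g ^ b] (mod d) \<longleftrightarrow> [a = b] (mod phi)"
  using g order_divides_expdiff[of d g a b] by (simp add: residue_primroot_def totient_d)

lemma char_mult:
  assumes "z ^ phi = 1"
  shows "char z (m * n) = char z m * char z n"
proof (cases "d dvd m \<or> d dvd n")
  case True
  then show ?thesis by (auto simp: char_def)
next
  case False
  then have nd: "\<not> d dvd m * n" using d by (simp add: prime_dvd_mult_iff)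
  have "[g ^ ind m * g ^ ind n = m * n] (mod d)"
    using ind(2) False by (intro cong_mult) auto
  then have "[g ^ (ind m + ind n) = g ^ ind (m * n)] (mod d)"
    using ind(2)[OF nd] by (simp add: power_add) (metis cong_sym cong_trans)
  then have "z ^ (ind m + ind n) = z ^ ind (m * n)"
    using assms by (intro root_of_unity_power_cong) (auto simp: g_power_cong_iff)
  then show ?thesis using False nd by (simp add: char_def power_add)
qed

lemma ind_eq_0_iff:
  assumes "\<not> d dvd n"
  shows "ind n = 0 \<longleftrightarrow> [n = 1] (mod d)"
proof
  assume "ind n = 0"
  then show "[n = 1] (mod d)" using ind(2)[OF assms] by (simp add: cong_sym)
next
  assume "[n = 1] (mod d)"
  then have "[g ^ ind n = g ^ 0] (mod d)" using ind(2)[OF assms] cong_trans by force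
  then have "[ind n = 0] (mod phi)" by (simp only: g_power_cong_iff)
  then show "ind n = 0" using ind(1)[OF assms] by (simp add: Cong.cong_def)
qed

lemma char_1: "char z 1 = 1"
  using ind_eq_0_iff[of 1] d_gt_1 by (simp add: char_def)

lemma norm_char:
  assumes "z ^ phi = 1"
  shows "norm (char z n) \<le> 1"
proof -
  have "norm z ^ phi = 1 ^ phi" using arg_cong[OF assms, of norm] by (simp add: norm_power)
  then have "norm z = 1" using phi_pos by (subst (asm) power_eq_iff_eq_base) auto
  then show ?thesis by (simp add: char_def norm_power)
qed

lemma char_periodic: "char z (n + d) = char z n"
  by (simp add: char_def ind_def)

text \<open>Over the period starting at 0, reindexing by powers of \<open>g\<close> yields a full
  geometric sum in \<open>z\<close>. Other periods follow by moving the window one step at a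
  time.\<close>

lemma char_sum_period:
  assumes "z ^ phi = 1" "z \<noteq> 1"
  shows "(\<Sum>n=a..<a+d. char z n) = 0"
proof (induction a)
  case 0
  have ig: "ind (g ^ i mod d) = i" if "i < phi" for i
  proof -
    have "g ^ i mod d \<in> {1..<d}" using generator that unfolding bij_betw_def by blast
    then have nd: "\<not> d dvd (g ^ i mod d)" by (auto dest: dvd_imp_le)
    have "[g ^ ind (g ^ i mod d) = g ^ i] (mod d)" using ind(2)[OF nd] by (simp add: Cong.cong_def)
    then have "[ind (g ^ i mod d) = i] (mod phi)" by (simp only: g_power_cong_iff)
    then show ?thesis using ind(1)[OF nd] that by (simp add: Cong.cong_def)
  qed
  have "(\<Sum>n=0..<0+d. char z n) = (\<Sum>n\<in>{1..<d}. char z n)"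
    using d_gt_1 by (intro sum.mono_neutral_right) (auto simp: char_def Suc_le_eq)
  also have "\<dots> = (\<Sum>i<phi. char z (g ^ i mod d))"
    using sum.reindex_bij_betw[OF generator, of "char z"] by simp
  also have "\<dots> = (\<Sum>i<phi. z ^ i)"
  proof (rule sum.cong)
    fix i assume i: "i \<in> {..<phi}"
    have "g ^ i mod d \<in> {1..<d}" using generator i unfolding bij_betw_def by blast
    then show "char z (g ^ i mod d) = z ^ i" using ig[of i] i by (auto simp: char_def dest: dvd_imp_le)
  qed simp
  also have "\<dots> = 0" using assms by (simp add: sum_gp_strict)
  finally show ?case .
next
  case (Suc a)
  have e1: "(\<Sum>n=a..<a+d. char z n) = char z a + (\<Sum>n=Suc a..<a+d. char z n)"
    using d_gt_1 by (intro sum.atLeast_Suc_lessThan) auto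
  have e2: "(\<Sum>n=Suc a..<Suc a+d. char z n) = (\<Sum>n=Suc a..<a+d. char z n) + char z (a + d)"
    using d_gt_1 by simp
  show ?case unfolding e2 using e1 Suc char_periodic[of z a] by (metis add.commute)
qed

lemma bounded_character_char:
  assumes "z ^ phi = 1" "z \<noteq> 1"
  shows "bounded_character (char z) (real d)"
proof
  show "norm (\<Sum>n=a..b. char z n) \<le> real d" for a b
    using norm_periodic_sum_le[OF char_sum_period[OF assms] norm_char[OF assms(1)], of a "Suc b"] d_gt_1
    by (simp add: atLeastLessThanSuc_atLeastAtMost)
qed (use assms char_mult char_1 norm_char in auto)

definition roots :: "complex set" where
  "roots = {z. z ^ phi = 1}"

lemma finite_roots: "finite roots" and card_roots: "card roots = phi"
  using card_roots_unity_eq[OF phi_pos] finite_roots_unity[of phi] phi_pos by (auto simp: roots_def Suc_le_eq)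

text \<open>Multiplication by a primitive root of unity \<open>w\<close> permutes the roots and
  multiplies the sum by \<open>w ^ i\<close>, which is not 1 for \<open>0 < i < phi\<close>.\<close>

lemma sum_roots_power:
  assumes "i < phi"
  shows "(\<Sum>z\<in>roots. z ^ i) = (if i = 0 then of_nat phi else 0)"
proof (cases "i = 0")
  case True
  then show ?thesis by (simp add: card_roots)
next
  case False
  define w where "w = cis (2 * pi * real 1 / real phi)"
  have w: "w ^ phi = 1" unfolding w_def DeMoivre using phi_pos by simp
  have "inj_on (\<lambda>k. cis (2 * pi * real k / real phi)) {..<phi}"
    using bij_betw_roots_unity[OF phi_pos] by (simp add: bij_betw_def)
  then have "cis (2 * pi * real i / real phi) \<noteq> cis (2 * pi * real 0 / real phi)"
    using False assms phi_pos by (metis inj_onD lessThan_iff)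
  moreover have "w ^ i = cis (2 * pi * real i / real phi)"
    unfolding w_def DeMoivre by (simp add: mult_ac)
  ultimately have wi: "w ^ i \<noteq> 1" by simp
  have w0: "w \<noteq> 0" using w phi_pos by (auto simp: zero_power)
  have "(\<Sum>z\<in>roots. z ^ i) = (\<Sum>z\<in>roots. (w * z) ^ i)"
    by (rule sum.reindex_bij_witness[of _ "\<lambda>z. w * z" "\<lambda>z. z / w"])
      (use w w0 in \<open>auto simp: roots_def power_mult_distrib power_divide\<close>)
  also have "\<dots> = w ^ i * (\<Sum>z\<in>roots. z ^ i)" by (simp add: power_mult_distrib sum_distrib_left)
  finally have "(1 - w ^ i) * (\<Sum>z\<in>roots. z ^ i) = 0" by (simp add: algebra_simps)
  then show ?thesis using wi False by simp
qed

lemma sum_roots_char: "(\<Sum>z\<in>roots. char z n) = (if [n = 1] (mod d) then of_nat phi else 0)"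
proof (cases "d dvd n")
  case True
  then have "\<not> [n = 1] (mod d)" using d_gt_1 by (auto simp: Cong.cong_def)
  then show ?thesis using True by (simp add: char_def)
next
  case False
  then show ?thesis using sum_roots_power[OF ind(1)[OF False]] ind_eq_0_iff[OF False]
    by (simp add: char_def)
qed

definition EE :: "complex \<Rightarrow> nat \<Rightarrow> complex" where
  "EE z x = (\<Sum>n=1..x. char z n * mangoldt n / of_nat n)"

definition U :: "nat \<Rightarrow> real" where
  "U x = (\<Sum>n\<in>{n\<in>{1..x}. [n = 1] (mod d)}. mangoldt n / real n)"

lemma sum_EE: "(\<Sum>z\<in>roots. EE z x) = of_real (real phi * U x)"
proof -
  have "(\<Sum>z\<in>roots. EE z x) = (\<Sum>n=1..x. (\<Sum>z\<in>roots. char z n) * mangoldt n / of_nat n)"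
    unfolding EE_def by (subst sum.swap) (simp add: sum_distrib_right sum_divide_distrib)
  also have "\<dots> = (\<Sum>n=1..x. if [n = 1] (mod d) then of_nat phi * mangoldt n / of_nat n else 0)"
    unfolding sum_roots_char by (intro sum.cong) auto
  also have "\<dots> = (\<Sum>n\<in>{n\<in>{1..x}. [n = 1] (mod d)}. of_nat phi * mangoldt n / of_nat n)"
    by (rule sum.inter_filter[symmetric]) simp
  finally show ?thesis by (simp add: U_def sum_distrib_left)
qed

lemma EE_1:
  assumes "x \<ge> 1"
  shows "\<bar>Re (EE 1 x) - ln (real x)\<bar> \<le> 4 + ln (real d)"
proof -
  let ?D = "{n\<in>{1..x}. d dvd n}"
  have nn: "(\<Sum>n\<in>?D. mangoldt n / real n :: real) \<ge> 0"
    by (intro sum_nonneg divide_nonneg_nonneg mangoldt_nonneg) auto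
  have "Re (EE 1 x) = (\<Sum>n=1..x. mangoldt n / real n - (if d dvd n then mangoldt n / real n else 0))"
    unfolding EE_def Re_sum
    by (intro sum.cong refl) (auto simp: char_def Re_divide_of_nat)
  also have "\<dots> = (\<Sum>n=1..x. mangoldt n / real n) - (\<Sum>n\<in>?D. mangoldt n / real n)"
    by (simp only: sum_subtractf sum.inter_filter finite_atLeastAtMost)
  finally have "Re (EE 1 x) = \<dots>" .
  then show ?thesis using mertens_mangoldt[OF assms] sum_mangoldt_multiples_le[OF d, of x] nn by linarith
qed

lemma EE_upper:
  assumes "z \<in> roots" "z \<noteq> 1"
  shows "\<exists>C. \<forall>x\<ge>1. Re (EE z x) \<le> C"
proof -
  interpret bounded_character "char z" "real d" using assms bounded_character_char by (simp add: roots_def)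
  show ?thesis using E_bounds(1) unfolding E_def EE_def .
qed

lemma EE_bounded:
  assumes z: "z \<in> roots" "z \<noteq> 1"
  shows "\<exists>C. \<forall>x\<ge>1. norm (EE z x) \<le> C"
proof (rule ccontr)
  assume unb: "\<not> ?thesis"
  interpret bounded_character "char z" "real d" using z bounded_character_char by (simp add: roots_def)
  have L0: "L = 0" using unb E_bounds(2) unfolding E_def EE_def by blast
  have low: "Re (EE z x) \<le> real d - ln (real x)" if "x \<ge> 1" for x
    using E_if_L_zero[OF L0] that complex_Re_le_cmod[of "of_real (ln (real x)) + E x"]
    unfolding E_def EE_def by force
  show False
  proof (cases "cnj z = z")
    case True
    then have "z \<in> \<real>" by (simp add: Reals_cnj_iff)
    then obtain r where r: "z = of_real r" by (auto elim: Reals_cases)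
    have "complex_of_real (r ^ phi) = complex_of_real 1" using z(1) r by (simp add: roots_def)
    then have "r ^ phi = 1" by (simp only: of_real_eq_iff)
    then have "\<bar>r\<bar> ^ phi = 1 ^ phi" by (metis power_abs abs_one power_one)
    then have "\<bar>r\<bar> = 1" using phi_pos by (subst (asm) power_eq_iff_eq_base) auto
    then have "z = -1" using r z(2) by (auto simp: abs_if split: if_splits)
    then have "char z n \<in> {-1, 0, 1}" for n
      by (cases "even (ind n)") (auto simp: char_def)
    then show False using L_nonzero_if_real L0 by blast
  next
    case False
    define w where "w = cnj z"
    have "w ^ phi = 1" using z(1) by (simp add: roots_def w_def flip: complex_cnj_power)
    then have w: "w \<in> roots" "w \<noteq> 1" "w \<noteq> z"
      using z False by (simp_all add: w_def roots_def)
    have EEw: "Re (EE w x) = Re (EE z x)" for x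
    proof -
      have "char w n = cnj (char z n)" for n by (simp add: char_def w_def)
      then show ?thesis by (simp add: EE_def Re_divide_of_nat)
    qed
    \<comment> \<open>The remaining characters need only an upper bound for the real part, which
      holds whether or not their own \<open>L\<close> vanishes. Two terms near \<open>- ln x\<close>
      then outweigh the single \<open>ln x\<close> of the principal character.\<close>
    define R where "R = roots - {1, z, w}"
    have "\<forall>v\<in>R. \<exists>C. \<forall>x\<ge>1. Re (EE v x) \<le> C" using EE_upper by (auto simp: R_def)
    then obtain C where C: "\<And>v x. v \<in> R \<Longrightarrow> x \<ge> 1 \<Longrightarrow> Re (EE v x) \<le> C v" by metis
    have fR: "finite R" using finite_roots by (simp add: R_def)
    have nR: "1 \<notin> R" "z \<notin> R" "w \<notin> R" by (simp_all add: R_def)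
    have one: "1 \<in> roots" by (simp add: roots_def)
    have split: "roots = insert 1 (insert z (insert w R))" using z w one by (auto simp: R_def)
    have bound: "ln (real x) \<le> 4 + ln (real d) + 2 * real d + sum C R" if x: "x \<ge> 1" for x
    proof -
      have "0 \<le> real phi * U x"
        unfolding U_def by (intro mult_nonneg_nonneg sum_nonneg divide_nonneg_nonneg mangoldt_nonneg) auto
      also have "\<dots> = Re (\<Sum>v\<in>roots. EE v x)" unfolding sum_EE by simp
      also have "\<dots> = Re (EE 1 x) + Re (EE z x) + Re (EE w x) + (\<Sum>v\<in>R. Re (EE v x))"
        unfolding split using fR nR z(2) w(2,3) by simp
      also have "(\<Sum>v\<in>R. Re (EE v x)) \<le> sum C R" using C x by (intro sum_mono) auto
      finally show ?thesis using EE_1[OF x] EEw[of x] low[OF x] by linarith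
    qed
    define B where "B = 4 + ln (real d) + 2 * real d + sum C R"
    obtain N :: nat where N: "exp (B + 1) < real N" using reals_Archimedean2 by blast
    then have "N \<ge> 1" using exp_gt_zero[of "B+1"] by (cases N) auto
    then have "exp (ln (real N)) \<le> exp B" using bound[of N] by (simp add: B_def del: exp_ln)
    moreover have "exp B < exp (B + 1)" by simp
    ultimately show False using N \<open>N \<ge> 1\<close> by (simp del: exp_less_cancel_iff)
  qed
qed

lemma mertens_one_mod: "\<exists>C. \<forall>x\<ge>1. \<bar>real phi * U x - ln (real x)\<bar> \<le> C"
proof -
  define R where "R = roots - {1}"
  have "\<forall>v\<in>R. \<exists>C. \<forall>x\<ge>1. norm (EE v x) \<le> C" using EE_bounded by (auto simp: R_def)
  then obtain C where C: "\<And>v x. v \<in> R \<Longrightarrow> x \<ge> 1 \<Longrightarrow> norm (EE v x) \<le> C v" by metis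
  have fR: "finite R" using finite_roots by (simp add: R_def)
  have split: "roots = insert 1 R" by (auto simp: R_def roots_def)
  have nR: "1 \<notin> R" by (simp add: R_def)
  have "\<bar>real phi * U x - ln (real x)\<bar> \<le> 4 + ln (real d) + sum C R" if x: "x \<ge> 1" for x
  proof -
    have "real phi * U x = Re (\<Sum>v\<in>roots. EE v x)" unfolding sum_EE by simp
    also have "\<dots> = Re (EE 1 x) + (\<Sum>v\<in>R. Re (EE v x))"
      unfolding split using fR nR by simp
    finally have "real phi * U x = \<dots>" .
    moreover have "\<bar>\<Sum>v\<in>R. Re (EE v x)\<bar> \<le> sum C R"
      using C x by (intro order_trans[OF sum_abs] sum_mono) (meson abs_Re_le_cmod order_trans)
    ultimately show ?thesis using EE_1[OF x] by linarith
  qed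
  then show ?thesis by blast
qed

end

section \<open>Primes congruent to one modulo a prime\<close>

text \<open>A prime power \<open>p ^ j \<le> x\<close> with \<open>j \<ge> 2\<close> has
  \<open>p \<le> sqrt x\<close> and \<open>j \<le> log 2 x\<close>, so there are few of
  them.\<close>

lemma sum_mangoldt_proper_powers_le:
  assumes "x \<ge> 1"
  shows "(\<Sum>n\<in>{n\<in>{1..x}. primepow n \<and> \<not> prime n}. mangoldt n) \<le> sqrt x * log 2 x * ln (real x)"
proof -
  define W where "W = {n\<in>{1..x}. primepow n \<and> \<not> prime n}"
  define s where "s = nat \<lfloor>sqrt x\<rfloor>"
  define l where "l = nat \<lfloor>log 2 x\<rfloor>"
  have "W \<subseteq> (\<lambda>(p, j). p ^ j) ` ({1..s} \<times> {1..l})"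
  proof
    fix n assume n: "n \<in> W"
    then obtain p j where pj: "prime p" "j > 0" "n = p ^ j" by (auto simp: W_def primepow_def)
    have p2: "p \<ge> 2" using pj(1) prime_ge_2_nat by blast
    have "j \<noteq> 1" using n pj by (auto simp: W_def)
    then have j2: "j \<ge> 2" using pj(2) by simp
    have nx: "n \<le> x" using n by (simp add: W_def)
    have "p\<^sup>2 \<le> p ^ j" using p2 j2 by (intro power_increasing) auto
    then have "p\<^sup>2 \<le> x" using pj nx by simp
    then have "(real p)\<^sup>2 \<le> real x" by (metis of_nat_le_iff of_nat_power)
    then have "real p \<le> sqrt x" by (rule real_le_rsqrt)
    then have "p \<le> s" unfolding s_def by (simp add: le_nat_floor)
    have "2 ^ j \<le> p ^ j" using p2 by (intro power_mono) auto
    then have "2 ^ j \<le> x" using pj(3) nx order_trans by blast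
    then have "(2::real) ^ j \<le> real x" by (metis of_nat_le_iff of_nat_numeral of_nat_power)
    then have "real j \<le> log 2 x" using assms by (simp add: le_log_iff powr_realpow)
    then have "j \<le> l" unfolding l_def by (simp add: le_nat_floor)
    show "n \<in> (\<lambda>(p, j). p ^ j) ` ({1..s} \<times> {1..l})"
      using pj \<open>p \<le> s\<close> \<open>j \<le> l\<close> p2 by (intro image_eqI[of _ _ "(p, j)"]) auto
  qed
  then have "card W \<le> card ((\<lambda>(p, j). p ^ j) ` ({1..s} \<times> {1..l}))"
    by (intro card_mono) auto
  also have "\<dots> \<le> card ({1..s} \<times> {1..l})" by (rule card_image_le) auto
  also have "\<dots> = s * l" by simp
  finally have "real (card W) \<le> real s * real l" by (metis of_nat_le_iff of_nat_mult)
  also have "\<dots> \<le> sqrt x * log 2 x"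
    using assms unfolding s_def l_def by (intro mult_mono) auto
  finally have card: "real (card W) \<le> sqrt x * log 2 x" .
  have "(\<Sum>n\<in>W. mangoldt n) \<le> (\<Sum>n\<in>W. ln (real x))"
  proof (rule sum_mono)
    fix n assume n: "n \<in> W"
    then have "mangoldt n \<le> ln (real n)" by (intro mangoldt_le) (auto simp: W_def)
    also have "\<dots> \<le> ln (real x)" using n by (auto simp: W_def)
    finally show "mangoldt n \<le> ln (real x)" .
  qed
  also have "\<dots> = real (card W) * ln (real x)" by simp
  also have "\<dots> \<le> sqrt x * log 2 x * ln (real x)" using card assms by (intro mult_right_mono) auto
  finally show ?thesis by (simp add: W_def)
qed

text \<open>Because the error in Mertens' theorem is bounded, \<open>U\<close> grows by at least 1
  between \<open>x / M\<close> and \<open>x\<close> for a suitable \<open>M\<close>. On that range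
  \<open>1 / n\<close> is at most \<open>M / x\<close>, so the unweighted sum is at least
  \<open>x / M\<close>; the proper prime powers take away at most half of this for large
  \<open>x\<close>.\<close>

lemma theta_one_mod_lower:
  assumes "prime d"
  shows "\<exists>c>0. \<exists>x0. \<forall>x\<ge>x0. c * real x \<le> (\<Sum>p\<in>{p\<in>{1..x}. prime p \<and> [p = 1] (mod d)}. ln (real p))"
proof -
  obtain g where "residue_primroot d g"
    using prime_primitive_root_exists[OF prime_gt_1_nat[OF assms] assms] by blast
  then interpret prime_modulus d g using assms by unfold_locales
  obtain C where C: "\<And>x. x \<ge> 1 \<Longrightarrow> \<bar>real phi * U x - ln (real x)\<bar> \<le> C"
    using mertens_one_mod by blast
  \<comment> \<open>The exponent pays the error \<open>C\<close> at both ends and leaves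
    \<open>phi\<close>, that is, an increase of \<open>U\<close> by 1.\<close>
  define M where "M = nat \<lceil>exp (2 * C + real phi)\<rceil>"
  have expM: "exp (2 * C + real phi) \<le> real M" unfolding M_def by linarith
  have M: "M > 0" using expM exp_gt_zero[of "2 * C + real phi"] by (cases M) auto
  have lnM: "2 * C + real phi \<le> ln (real M)" using expM M by (simp add: ln_ge_iff)
  define T where "T x = (\<Sum>p\<in>{p\<in>{1..x}. prime p \<and> [p = 1] (mod d)}. ln (real p))" for x
  have main: "real x / real M \<le> T x + sqrt x * log 2 x * ln (real x)" if x: "x \<ge> M" for x
  proof -
    define y where "y = x div M"
    have y: "y \<ge> 1" using x M by (simp add: y_def div_greater_zero_iff Suc_le_eq)
    have yx: "y \<le> x" by (simp add: y_def)
    have x1: "x \<ge> 1" using x M by simp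
    have "real y \<le> real x / real M" unfolding y_def by (rule of_nat_div_le_of_nat)
    then have "ln (real y) \<le> ln (real x / real M)" using y x1 M by (subst ln_le_cancel_iff) auto
    then have "ln (real x) - ln (real y) \<ge> ln (real M)" using x1 M by (simp add: ln_div)
    then have "real phi * U x - real phi * U y \<ge> real phi"
      using C[OF x1] C[OF y] lnM by linarith
    then have "real phi * (U x - U y) \<ge> real phi * 1" by (simp add: algebra_simps)
    then have U1: "U x - U y \<ge> 1" using phi_pos by (subst (asm) mult_le_cancel_left_pos) auto
    have sets: "{n\<in>{1..x}. [n = 1] (mod d)} = {n\<in>{1..y}. [n = 1] (mod d)} \<union> {n\<in>{Suc y..x}. [n = 1] (mod d)}"
      using yx y by auto
    have "U x = U y + (\<Sum>n\<in>{n\<in>{Suc y..x}. [n = 1] (mod d)}. mangoldt n / real n)"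
      unfolding U_def sets by (rule sum.union_disjoint) auto
    also have "(\<Sum>n\<in>{n\<in>{Suc y..x}. [n = 1] (mod d)}. mangoldt n / real n)
        \<le> (\<Sum>n\<in>{n\<in>{Suc y..x}. [n = 1] (mod d)}. mangoldt n * (real M / real x))"
    proof (rule sum_mono)
      fix n assume n: "n \<in> {n\<in>{Suc y..x}. [n = 1] (mod d)}"
      have "real x / real M < real y + 1" unfolding y_def by (rule of_nat_div_less_Suc[OF M])
      then have "real x / real M \<le> real n" using n by simp
      then have "1 / real n \<le> real M / real x" using n x1 M by (simp add: field_simps)
      then show "mangoldt n / real n \<le> mangoldt n * (real M / real x)"
        using mult_left_mono[OF _ mangoldt_nonneg[of n]] by force
    qed
    also have "\<dots> = (\<Sum>n\<in>{n\<in>{Suc y..x}. [n = 1] (mod d)}. mangoldt n) * (real M / real x)"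
      by (simp only: sum_distrib_right)
    finally have "1 \<le> (\<Sum>n\<in>{n\<in>{Suc y..x}. [n = 1] (mod d)}. mangoldt n) * (real M / real x)"
      using U1 by linarith
    then have "real x / real M \<le> (\<Sum>n\<in>{n\<in>{Suc y..x}. [n = 1] (mod d)}. mangoldt n)"
      using x1 M by (simp add: field_simps)
    also have "\<dots> = (\<Sum>n\<in>{n\<in>{Suc y..x}. [n = 1] (mod d) \<and> primepow n}. mangoldt n)"
      by (rule sum.mono_neutral_right) (auto simp: mangoldt_def)
    also have "\<dots> \<le> (\<Sum>n\<in>{p\<in>{1..x}. prime p \<and> [p = 1] (mod d)} \<union> {n\<in>{1..x}. primepow n \<and> \<not> prime n}. mangoldt n)"
      by (rule sum_mono2) (auto intro: mangoldt_nonneg)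
    also have "\<dots> = T x + (\<Sum>n\<in>{n\<in>{1..x}. primepow n \<and> \<not> prime n}. mangoldt n)"
      unfolding T_def by (subst sum.union_disjoint) auto
    finally show ?thesis using sum_mangoldt_proper_powers_le[OF x1] by linarith
  qed
  have "(\<lambda>x::nat. sqrt x * log 2 x * ln (real x) / real x) \<longlonglongrightarrow> 0" by real_asymp
  then have "\<forall>\<^sub>F x in sequentially. sqrt x * log 2 x * ln (real x) / real x < 1 / (2 * real M)"
    using M by (intro order_tendstoD) auto
  then obtain x0 where x0: "\<And>x. x \<ge> x0 \<Longrightarrow> sqrt x * log 2 x * ln (real x) / real x < 1 / (2 * real M)"
    by (auto simp: eventually_sequentially)
  have "1 / (2 * real M) * real x \<le> T x" if x: "x \<ge> max x0 M" for x
  proof -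
    have "real x > 0" using x M by simp
    then have "sqrt x * log 2 x * ln (real x) < 1 / (2 * real M) * real x"
      using x0[of x] x by (simp add: pos_divide_less_eq)
    moreover have "real x / real M = 1 / (2 * real M) * real x + 1 / (2 * real M) * real x"
      using M by (simp add: field_simps)
    ultimately show ?thesis using main[of x] x by linarith
  qed
  then show ?thesis unfolding T_def using M
    by (intro exI[of _ "1 / (2 * real M)"] conjI exI[of _ "max x0 M"]) auto
qed

section \<open>Polynomials modulo a prime and Stepanov's method\<close>

text \<open>Polynomials over the field with \<open>p\<close> elements are represented by integer
  polynomials, and vanishing modulo \<open>p\<close> by divisibility by \<open>[:int p:]\<close>.
  Primality of this constant expresses the absence of zero divisors.\<close>

lemma prime_elem_const_poly: "prime (p::int) \<Longrightarrow> prime_elem [:p:]"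
  using prime_elem_const_poly_iff[of p] prime_imp_prime_elem by blast

lemma const_dvd_poly_cases:
  fixes F :: "int poly"
  assumes "p dvd poly F s"
  obtains G H where "F = [:-s, 1:] * G + [:p:] * H"
proof -
  from assms obtain c where c: "poly F s = p * c" by (auto elim: dvdE)
  have "F = [:-s, 1:] * synthetic_div F s + [:p:] * [:c:]"
    using synthetic_div_correct'[of s F] c by (simp add: mult.commute)
  then show ?thesis by (rule that)
qed

lemma poly_higher_pderiv_linear_power:
  fixes G :: "'a::{idom,semiring_char_0} poly"
  shows "poly ((pderiv ^^ j) ([:-s, 1:] ^ j * G)) s = fact j * poly G s"
proof (induction j arbitrary: G)
  case (Suc j)
  have "pderiv ([:-s, 1:] ^ Suc j * G) = [:-s, 1:] ^ j * (smult (of_nat (Suc j)) G + [:-s, 1:] * pderiv G)"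
    by (simp add: pderiv_mult pderiv_power_Suc pderiv_pCons algebra_simps del: power_Suc)
      (simp add: algebra_simps)
  then have "poly ((pderiv ^^ Suc j) ([:-s, 1:] ^ Suc j * G)) s
      = fact j * poly (smult (of_nat (Suc j)) G + [:-s, 1:] * pderiv G) s"
    by (simp only: funpow_Suc_right o_apply Suc.IH)
  then show ?case by (simp add: algebra_simps)
qed simp

lemma higher_pderiv_const_mult: "(pderiv ^^ j) ([:c:] * F) = [:c:] * (pderiv ^^ j) (F :: 'a::idom poly)"
  by (induction j) (auto simp: pderiv_smult)

text \<open>Raising the order from \<open>M\<close> to \<open>M + 1\<close> divides by
  \<open>fact M\<close>, which is a unit modulo \<open>p\<close> since \<open>M < p\<close> at that
  point.\<close>

lemma multiple_root_mod_prime: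
  fixes F :: "int poly" and p :: nat
  assumes p: "prime p" and "M \<le> p" and "\<And>l. l < M \<Longrightarrow> int p dvd poly ((pderiv ^^ l) F) s"
  shows "\<exists>G H. F = [:-s, 1:] ^ M * G + [:int p:] * H"
  using assms(2,3)
proof (induction M)
  case 0
  show ?case by (intro exI[of _ F] exI[of _ 0]) simp
next
  case (Suc M)
  then obtain G H where F: "F = [:-s, 1:] ^ M * G + [:int p:] * H" by auto
  have "int p dvd poly ((pderiv ^^ M) F) s" using Suc.prems by simp
  also have "poly ((pderiv ^^ M) F) s = fact M * poly G s + int p * poly ((pderiv ^^ M) H) s"
    unfolding F higher_pderiv_add poly_add poly_higher_pderiv_linear_power higher_pderiv_const_mult by simp
  finally have "int p dvd fact M * poly G s" using dvd_add_left_iff dvd_triv_left by blast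
  moreover have "\<not> int p dvd fact M"
  proof -
    have "\<not> p dvd fact M" using Suc.prems p by (simp add: prime_dvd_fact_iff)
    then show ?thesis by (metis of_nat_dvd_iff of_nat_fact)
  qed
  ultimately have "int p dvd poly G s" using p by (simp add: prime_dvd_mult_iff)
  then obtain G1 H1 where G: "G = [:-s, 1:] * G1 + [:int p:] * H1" by (rule const_dvd_poly_cases)
  have "F = [:-s, 1:] ^ Suc M * G1 + [:int p:] * ([:-s, 1:] ^ M * H1 + H)"
    unfolding F G by (simp only: power_Suc ring_distribs ac_simps)
  then show ?case by blast
qed

lemma not_const_dvd_linear: "prime p \<Longrightarrow> \<not> [:int p:] dvd [:-s, 1:]"
  by (auto simp: const_poly_dvd_iff intro!: exI[of _ "Suc 0"])

lemma linear_power_dvd_mod_prime: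
  fixes G W A :: "int poly" and p :: nat
  assumes p: "prime p" and W: "\<not> int p dvd poly W s"
    and "[:int p:] dvd W * G - [:-s, 1:] ^ M * A"
  shows "\<exists>G1 H. G = [:-s, 1:] ^ M * G1 + [:int p:] * H"
  using assms(3)
proof (induction M arbitrary: G)
  case 0
  show ?case by (intro exI[of _ G] exI[of _ 0]) simp
next
  case (Suc M)
  from Suc.prems obtain R where R: "W * G - [:-s, 1:] ^ Suc M * A = [:int p:] * R" by (auto elim: dvdE)
  have "poly W s * poly G s = int p * poly R s"
    using arg_cong[OF R, of "\<lambda>F. poly F s"] by simp
  then have "int p dvd poly W s * poly G s" by simp
  then have "int p dvd poly G s" using p W by (simp add: prime_dvd_mult_iff)
  then obtain G1 H1 where G: "G = [:-s, 1:] * G1 + [:int p:] * H1" by (rule const_dvd_poly_cases)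
  have pe: "prime_elem [:int p:]" using p by (intro prime_elem_const_poly) simp
  have "[:-s, 1:] * (W * G1 - [:-s, 1:] ^ M * A) = [:int p:] * (R - W * H1)"
    using R unfolding G by (simp add: algebra_simps)
  then have "[:int p:] dvd [:-s, 1:] * (W * G1 - [:-s, 1:] ^ M * A)" by (metis dvd_triv_left)
  then have "[:int p:] dvd W * G1 - [:-s, 1:] ^ M * A"
    using prime_elem_dvd_mult_iff[OF pe] not_const_dvd_linear[OF p] by blast
  from Suc.IH[OF this] obtain G2 H where "G1 = [:-s, 1:] ^ M * G2 + [:int p:] * H" by blast
  then have "G = [:-s, 1:] ^ Suc M * G2 + [:int p:] * ([:-s, 1:] * H + H1)"
    unfolding G by (simp add: algebra_simps)
  then show ?case by blast
qed

text \<open>The factors \<open>(x - s) ^ M\<close> belong to different roots modulo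
  \<open>p\<close>, so they can be split off from \<open>F\<close> one after the other, and their
  product has degree \<open>card S * M\<close>.\<close>

lemma card_multiple_roots_mod_prime:
  fixes F :: "int poly" and p :: nat
  assumes p: "prime p" and M: "M \<le> p" and F: "\<not> [:int p:] dvd F"
    and fin: "finite S" and inj: "\<And>s t. s \<in> S \<Longrightarrow> t \<in> S \<Longrightarrow> int p dvd s - t \<Longrightarrow> s = t"
    and der: "\<And>s l. s \<in> S \<Longrightarrow> l < M \<Longrightarrow> int p dvd poly ((pderiv ^^ l) F) s"
  shows "card S * M \<le> degree F"
proof -
  have "\<exists>G H. F = (\<Prod>s\<in>S. [:-s, 1:] ^ M) * G + [:int p:] * H"
    using fin inj der
  proof (induction S rule: finite_induct)
    case empty
    show ?case by (intro exI[of _ F] exI[of _ 0]) simp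
  next
    case (insert s S)
    let ?P = "\<Prod>s\<in>S. [:-s, 1:] ^ M"
    have "\<exists>G H. F = ?P * G + [:int p:] * H" by (rule insert.IH) (use insert.prems in auto)
    then obtain G H where 1: "F = ?P * G + [:int p:] * H" by blast
    obtain A H' where 2: "F = [:-s, 1:] ^ M * A + [:int p:] * H'"
      using multiple_root_mod_prime[OF p M, of F s] insert.prems by auto
    have "\<not> int p dvd poly ?P s"
    proof
      assume "int p dvd poly ?P s"
      then have "int p dvd (\<Prod>t\<in>S. (s - t) ^ M)" by (simp add: poly_prod)
      then obtain t where "t \<in> S" "int p dvd (s - t) ^ M"
        using p insert.hyps by (auto simp: prime_dvd_prod_iff)
      then have "int p dvd s - t" using prime_dvd_power[of "int p" "s - t" M] p by simp
      then have "s = t" using insert.prems(1)[of s t] \<open>t \<in> S\<close> by simp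
      then show False using insert.hyps \<open>t \<in> S\<close> by simp
    qed
    moreover have "?P * G - [:-s, 1:] ^ M * A = [:int p:] * (H' - H)"
      using 1 2 by (simp add: algebra_simps smult_diff_right)
    then have "[:int p:] dvd ?P * G - [:-s, 1:] ^ M * A" by (simp only: dvd_triv_left)
    ultimately obtain G1 H1 where 3: "G = [:-s, 1:] ^ M * G1 + [:int p:] * H1"
      using linear_power_dvd_mod_prime[OF p] by blast
    have "(\<Prod>s\<in>insert s S. [:-s, 1:] ^ M) = [:-s, 1:] ^ M * ?P"
      using insert.hyps by (rule prod.insert)
    then have "F = (\<Prod>s\<in>insert s S. [:-s, 1:] ^ M) * G1 + [:int p:] * (?P * H1 + H)"
      unfolding 1 3 by (simp only:) (simp add: algebra_simps)
    then show ?case by blast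
  qed
  then obtain G H where FG: "F = (\<Prod>s\<in>S. [:-s, 1:] ^ M) * G + [:int p:] * H" by blast
  define W where "W = (\<Prod>s\<in>S. [:-s, 1:] ^ M)"
  \<comment> \<open>With reduced coefficients the leading coefficient of the cofactor is a unit
    modulo \<open>p\<close>. As \<open>W\<close> is monic, the top coefficient of
    \<open>W * G0\<close> cannot be cancelled by a multiple of \<open>p\<close> and is visible in
    \<open>F\<close>.\<close>
  define G0 where "G0 = map_poly (\<lambda>c. c mod int p) G"
  have c0: "coeff G0 i = coeff G i mod int p" for i by (simp add: G0_def coeff_map_poly)
  have "[:int p:] dvd G - G0"
    by (auto simp: const_poly_dvd_iff c0 mod_eq_dvd_iff[symmetric])
  then obtain R where R: "G = G0 + [:int p:] * R" by (metis dvdE diff_eq_eq add.commute)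
  have F2: "F = W * G0 + [:int p:] * (W * R + H)"
    unfolding FG R W_def[symmetric] by (simp add: algebra_simps)
  have "G0 \<noteq> 0" using F F2 by (metis dvd_triv_left mult_zero_right add_0)
  have "W \<noteq> 0" "lead_coeff W = 1" "degree W = card S * M"
  proof -
    show l: "lead_coeff W = 1" unfolding W_def by (simp add: lead_coeff_prod lead_coeff_power)
    then show "W \<noteq> 0" by auto
    show "degree W = card S * M"
      unfolding W_def by (subst degree_prod_eq_sum_degree) (auto simp: degree_power_eq)
  qed
  have lG: "\<not> int p dvd lead_coeff G0"
  proof
    assume "int p dvd lead_coeff G0"
    moreover have "0 \<le> lead_coeff G0" "lead_coeff G0 < int p"
      using prime_gt_0_nat[OF p] by (auto simp: c0)
    ultimately have "lead_coeff G0 = 0" by (meson zdvd_imp_le not_le order_le_less)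
    then show False using \<open>G0 \<noteq> 0\<close> by simp
  qed
  define n where "n = degree (W * G0)"
  have "coeff F n = lead_coeff (W * G0) + int p * coeff (W * R + H) n"
    unfolding F2 n_def by simp
  also have "lead_coeff (W * G0) = lead_coeff G0" by (simp only: lead_coeff_mult \<open>lead_coeff W = 1\<close> mult_1)
  finally have "\<not> int p dvd coeff F n" using lG by (simp add: dvd_add_left_iff)
  then have "n \<le> degree F" by (metis dvd_0_right le_degree)
  moreover have "card S * M \<le> n"
    unfolding n_def using \<open>W \<noteq> 0\<close> \<open>G0 \<noteq> 0\<close> \<open>degree W = _\<close> by (simp add: degree_mult_eq)
  ultimately show ?thesis by simp
qed

text \<open>Pigeonhole in place of a rank argument: the \<open>p ^ card I\<close> vectors have at
  most \<open>p ^ card T\<close> tuples of values, and the difference of two vectors with the same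
  tuple lies in the kernel.\<close>

lemma mod_prime_kernel:
  fixes L :: "'b \<Rightarrow> ('a \<Rightarrow> int) \<Rightarrow> int" and p :: nat
  assumes fin: "finite I" "finite T" and card: "card T < card I" and p: "p > 1"
    and lin: "\<And>t \<phi> \<psi>. t \<in> T \<Longrightarrow> L t (\<lambda>x. \<phi> x - \<psi> x) = L t \<phi> - L t \<psi>"
  shows "\<exists>\<chi>. (\<forall>x. x \<notin> I \<longrightarrow> \<chi> x = 0) \<and> (\<exists>x\<in>I. \<not> int p dvd \<chi> x) \<and> (\<forall>t\<in>T. int p dvd L t \<chi>)"
proof -
  define X where "X = (I \<rightarrow>\<^sub>E {0..<int p})"
  define Y where "Y = (T \<rightarrow>\<^sub>E {0..<int p})"
  define \<Phi> where "\<Phi> \<phi> = (\<lambda>t\<in>T. L t \<phi> mod int p)" for \<phi>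
  have "\<Phi> ` X \<subseteq> Y" using p by (auto simp: \<Phi>_def Y_def)
  have "card Y = p ^ card T" "card X = p ^ card I"
    using fin by (simp_all add: X_def Y_def card_PiE)
  then have "card Y < card X" using card p by simp
  moreover have "finite Y" using fin by (simp add: Y_def finite_PiE)
  ultimately have "card (\<Phi> ` X) < card X"
    using \<open>\<Phi> ` X \<subseteq> Y\<close> card_mono le_less_trans by blast
  then have "\<not> inj_on \<Phi> X" by (rule pigeonhole)
  then obtain \<phi> \<psi> where *: "\<phi> \<in> X" "\<psi> \<in> X" "\<phi> \<noteq> \<psi>" "\<Phi> \<phi> = \<Phi> \<psi>" by (auto simp: inj_on_def)
  define \<chi> where "\<chi> = (\<lambda>x. \<phi> x - \<psi> x)"
  have "\<chi> x = 0" if "x \<notin> I" for x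
    using *(1,2) that by (auto simp: \<chi>_def X_def PiE_def extensional_def)
  moreover have "\<exists>x\<in>I. \<not> int p dvd \<chi> x"
  proof -
    obtain x where x: "x \<in> I" "\<phi> x \<noteq> \<psi> x"
      using *(1-3) unfolding X_def by (metis PiE_ext)
    then have "\<phi> x \<in> {0..<int p}" "\<psi> x \<in> {0..<int p}" using * by (auto simp: X_def)
    then have "\<phi> x mod int p = \<phi> x" "\<psi> x mod int p = \<psi> x" by auto
    then have "\<not> int p dvd \<chi> x" using x unfolding \<chi>_def by (metis mod_eq_dvd_iff)
    then show ?thesis using x by blast
  qed
  moreover have "int p dvd L t \<chi>" if "t \<in> T" for t
  proof -
    have "L t \<phi> mod int p = L t \<psi> mod int p"
      using fun_cong[OF *(4), of t] that by (simp add: \<Phi>_def)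
    then show ?thesis using lin[OF that, of \<phi> \<psi>] by (simp add: \<chi>_def mod_eq_dvd_iff)
  qed
  ultimately show ?thesis by blast
qed

text \<open>If \<open>X\<close> has derivative 0 modulo \<open>p\<close>, then \<open>h ^ l\<close>
  times the \<open>l\<close>-th derivative of \<open>f * X * h ^ c\<close> is this polynomial times
  \<open>X * h ^ c\<close>. In the factor \<open>c - l\<close>, which may be negative,
  \<open>c\<close> comes from differentiating \<open>h ^ c\<close> and \<open>- l\<close> from the
  product rule for \<open>h ^ l\<close>.\<close>

primrec stepanov_op :: "int poly \<Rightarrow> nat \<Rightarrow> nat \<Rightarrow> int poly \<Rightarrow> int poly" where
  "stepanov_op h c 0 f = f"
| "stepanov_op h c (Suc l) f = h * pderiv (stepanov_op h c l f)
     + smult (int c - int l) (pderiv h * stepanov_op h c l f)"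

lemma stepanov_op_diff: "stepanov_op h c l (f - g) = stepanov_op h c l f - stepanov_op h c l g"
proof (induction l)
  case (Suc l)
  show ?case unfolding stepanov_op.simps Suc.IH
    by (simp add: pderiv_diff algebra_simps smult_diff_right)
qed simp

lemma degree_stepanov_op:
  assumes "degree h \<le> T"
  shows "degree (stepanov_op h c l f) \<le> degree f + l * T"
proof (induction l)
  case (Suc l)
  let ?B = "stepanov_op h c l f"
  have "degree (h * pderiv ?B) \<le> T + degree ?B"
    using assms degree_mult_le[of h "pderiv ?B"] by (simp add: degree_pderiv)
  moreover have "degree (smult (int c - int l) (pderiv h * ?B)) \<le> T + degree ?B"
    using assms degree_smult_le[of "int c - int l" "pderiv h * ?B"] degree_mult_le[of "pderiv h" ?B] by (simp add: degree_pderiv)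
  ultimately have "degree (stepanov_op h c (Suc l) f) \<le> T + degree ?B"
    by (simp add: degree_add_le)
  then show ?case using Suc by simp
qed simp

lemma base_mult_pderiv_power: "h * pderiv (h ^ n) = smult (of_nat n) (pderiv h * h ^ n)"
  for h :: "'a::idom poly"
  by (cases n) (simp_all only: pderiv_power_Suc, simp_all add: mult_ac)

lemma stepanov_op_eq:
  fixes p :: nat
  assumes X: "[:int p:] dvd pderiv X"
  shows "[:int p:] dvd h ^ l * (pderiv ^^ l) (f * X * h ^ c) - stepanov_op h c l f * X * h ^ c"
proof (induction l)
  case (Suc l)
  define A where "A = (pderiv ^^ l) (f * X * h ^ c)"
  define B where "B = stepanov_op h c l f"
  from Suc obtain R where R: "h ^ l * A - B * X * h ^ c = [:int p:] * R"
    unfolding A_def B_def by (auto elim: dvdE)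
  obtain X1 where X1: "pderiv X = [:int p:] * X1" using X by (auto elim: dvdE)
  have hA: "h ^ l * A = B * X * h ^ c + [:int p:] * R" using R by (simp add: algebra_simps)
  have "h * pderiv (h ^ l * A) = h * pderiv (B * X * h ^ c + [:int p:] * R)" unfolding hA ..
  then have "h ^ Suc l * pderiv A + (h * pderiv (h ^ l)) * A
      = h * pderiv B * X * h ^ c + h * B * pderiv X * h ^ c + B * X * (h * pderiv (h ^ c)) + [:int p:] * (h * pderiv R)"
    by (simp add: pderiv_mult pderiv_add pderiv_smult algebra_simps)
  then have "h ^ Suc l * pderiv A = h * pderiv B * X * h ^ c + [:int p:] * (h * B * X1 * h ^ c + h * pderiv R)
      + smult (int c) (pderiv h * B * X * h ^ c) - smult (int l) (pderiv h * (h ^ l * A))"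
    unfolding base_mult_pderiv_power X1 by (simp add: algebra_simps)
  also have "\<dots> = stepanov_op h c (Suc l) f * X * h ^ c
      + [:int p:] * (h * B * X1 * h ^ c + h * pderiv R - smult (int l) (pderiv h * R))"
    unfolding hA by (simp add: B_def[symmetric] algebra_simps smult_add_right smult_diff_left)
  finally have "h ^ Suc l * pderiv A - stepanov_op h c (Suc l) f * X * h ^ c
      = [:int p:] * (h * B * X1 * h ^ c + h * pderiv R - smult (int l) (pderiv h * R))"
    by (simp only: add_diff_cancel_left')
  then show ?case by (simp only: A_def funpow.simps o_apply dvd_triv_left)
qed simp

lemma coeff_mult_lowest:
  fixes f v :: "int poly"
  assumes "\<And>l. l < m \<Longrightarrow> q dvd coeff f l"
  shows "n < m \<Longrightarrow> q dvd coeff (f * v) n" and "q dvd coeff (f * v) m - coeff f m * coeff v 0"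
proof -
  show "n < m \<Longrightarrow> q dvd coeff (f * v) n"
    unfolding coeff_mult using assms by (intro dvd_sum dvd_mult2) auto
  have "coeff (f * v) m = (\<Sum>i<m. coeff f i * coeff v (m - i)) + coeff f m * coeff v 0"
    unfolding coeff_mult by (simp add: lessThan_Suc_atMost[symmetric])
  moreover have "q dvd (\<Sum>i<m. coeff f i * coeff v (m - i))"
    using assms by (intro dvd_sum dvd_mult2) auto
  ultimately show "q dvd coeff (f * v) m - coeff f m * coeff v 0" by simp
qed

text \<open>The order of vanishing at 0 of \<open>f * X ^ (p * j) * h ^ (i * P)\<close> determines \<open>(i, j)\<close>, because
  \<open>i * e * P\<close> runs modulo \<open>p\<close> through points spaced by about \<open>P\<close>.\<close>
lemma stepanov_exponents_distinct:
  fixes p d P D e :: nat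
  assumes p: "p = d * P + 1" and D: "D + d \<le> P" and e: "e < d" "coprime e d"
    and i: "i1 < d" "i2 < d" and m: "m1 < D" "m2 < D"
    and eq: "m1 + p * j1 + i1 * e * P = m2 + p * j2 + i2 * e * P"
  shows "i1 = i2 \<and> j1 = j2"
proof -
  have d: "d > 0" using e by simp
  \<comment> \<open>With \<open>i * e = d * q + r\<close> and \<open>d * P = p - 1\<close> the
    exponent is \<open>p * (j + q) + r * P + m - q\<close>. Adding \<open>d \<ge> q\<close> keeps
    the remainder nonnegative; it is below \<open>p\<close>, and its quotient by \<open>P\<close> is
    \<open>r\<close>.\<close>
  have main: "m + p * j + i * e * P + d = p * (j + i * e div d) + ((i * e mod d) * P + (m + d - i * e div d))
       \<and> m + d - i * e div d < P \<and> (i * e mod d) * P + (m + d - i * e div d) < p"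
    if "i < d" "m < D" for i m j
  proof -
    let ?q = "i * e div d" and ?r = "i * e mod d"
    have "i * e \<le> d * d" using that e by (intro mult_mono) auto
    then have q: "?q \<le> d" using d by (metis div_le_mono nonzero_mult_div_cancel_right neq0_conv)
    have w: "m + d - ?q < P" using that D by linarith
    have "i * e * P = (d * ?q + ?r) * P" by simp
    also have "\<dots> = d * P * ?q + ?r * P" by (simp only: distrib_right) (simp add: mult_ac)
    finally have "m + p * j + i * e * P + d = p * (j + ?q) + (?r * P + (m + d - ?q))"
      using q unfolding p by (simp add: algebra_simps)
    moreover have "?r * P + (m + d - ?q) < p"
    proof -
      have "?r \<le> d - 1" using mod_less_divisor[OF d, of "i * e"] by linarith
      then have "?r * P \<le> (d - 1) * P" by simp
      also have "(d - 1) * P + P = d * P" using d by (cases d) auto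
      finally show ?thesis using w p by linarith
    qed
    ultimately show ?thesis using w by simp
  qed
  define w1 where "w1 = (i1 * e mod d) * P + (m1 + d - i1 * e div d)"
  define w2 where "w2 = (i2 * e mod d) * P + (m2 + d - i2 * e div d)"
  note a1 = main[OF i(1) m(1), of j1, folded w1_def] and a2 = main[OF i(2) m(2), of j2, folded w2_def]
  have E: "p * (j1 + i1 * e div d) + w1 = p * (j2 + i2 * e div d) + w2" using a1 a2 eq by linarith
  have "w1 = (p * (j1 + i1 * e div d) + w1) mod p" using a1 by simp
  also have "\<dots> = w2" unfolding E using a2 by simp
  finally have w: "w1 = w2" .
  have P: "P > 0" using D d by simp
  have "i1 * e mod d = w1 div P" using a1 P unfolding w1_def by simp
  also have "\<dots> = i2 * e mod d" unfolding w using a2 P unfolding w2_def by simp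
  finally have "[i1 * e = i2 * e] (mod d)" by (simp add: Cong.cong_def)
  then have "[i1 = i2] (mod d)" using e(2) by (simp add: cong_mult_rcancel_nat coprime_commute)
  then have i12: "i1 = i2" using i by (simp add: Cong.cong_def)
  have p0: "p > 0" using p by simp
  have "p * (j1 + i1 * e div d) = p * (j2 + i2 * e div d)" using E w by simp
  then have "j1 + i1 * e div d = j2 + i2 * e div d" using p0 by simp
  then show ?thesis using i12 by simp
qed

text \<open>The terms that do not vanish modulo \<open>p\<close> have pairwise distinct orders at 0,
  so the coefficient at the smallest order comes from one term alone. It is a unit modulo
  \<open>p\<close> because \<open>coeff u 0\<close> is.\<close>

lemma stepanov_nonzero:
  fixes p d P D e :: nat and u :: "int poly" and f :: "nat \<Rightarrow> nat \<Rightarrow> int poly"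
  assumes prime: "prime p" and p: "p = d * P + 1" and D: "D + d \<le> P" and e: "e < d" "coprime e d"
    and u: "\<not> int p dvd coeff u 0"
    and f: "\<And>i j l. l \<ge> D \<Longrightarrow> coeff (f i j) l = 0"
    and nz: "i0 < d" "j0 < J" "\<not> [:int p:] dvd f i0 j0"
  shows "\<not> [:int p:] dvd (\<Sum>i<d. \<Sum>j<J. f i j * monom 1 (p * j) * (monom 1 e * u) ^ (i * P))"
proof -
  define N where "N = {(i, j). i < d \<and> j < J \<and> \<not> [:int p:] dvd f i j}"
  define m where "m x = (LEAST l. \<not> int p dvd coeff (f (fst x) (snd x)) l)" for x
  define w where "w x = m x + p * snd x + fst x * e * P" for x
  have m1: "\<not> int p dvd coeff (f i j) (m (i, j))" and mD: "m (i, j) < D" if "(i, j) \<in> N" for i j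
  proof -
    have "\<exists>l. \<not> int p dvd coeff (f i j) l" using that by (auto simp: N_def const_poly_dvd_iff)
    then show *: "\<not> int p dvd coeff (f i j) (m (i, j))" unfolding m_def fst_conv snd_conv by (rule LeastI_ex)
    show "m (i, j) < D"
    proof (rule ccontr)
      assume "\<not> ?thesis"
      then have "coeff (f i j) (m (i, j)) = 0" by (intro f) simp
      then show False using * by simp
    qed
  qed
  have m2: "int p dvd coeff (f i j) l" if "l < m (i, j)" for i j l
    using not_less_Least[of l "\<lambda>l. \<not> int p dvd coeff (f i j) l"] that by (simp add: m_def)
  have "(i0, j0) \<in> N" using nz by (simp add: N_def)
  from ex_has_least_nat[of "\<lambda>x. x \<in> N", OF this, of w]
  obtain x where x: "x \<in> N" "\<And>y. y \<in> N \<Longrightarrow> w x \<le> w y" by auto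
  obtain i1 j1 where x1: "x = (i1, j1)" by force
  define n where "n = w x"
  have trm: "coeff (f i j * monom 1 (p * j) * (monom 1 e * u) ^ (i * P)) n
      = (if n < p * j + i * e * P then 0 else coeff (f i j * u ^ (i * P)) (n - (p * j + i * e * P)))" for i j
  proof -
    have "monom 1 (p * j) * monom 1 (e * (i * P)) = monom (1::int) (p * j + i * e * P)"
      by (simp add: mult_monom mult_ac)
    then have eq: "f i j * monom 1 (p * j) * (monom 1 e * u) ^ (i * P)
        = monom 1 (p * j + i * e * P) * (f i j * u ^ (i * P))"
      by (simp add: power_mult_distrib monom_power algebra_simps)
    show ?thesis unfolding eq coeff_monom_mult by simp
  qed
  have other: "int p dvd coeff (f i j * monom 1 (p * j) * (monom 1 e * u) ^ (i * P)) n"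
    if ij: "i < d" "j < J" "(i, j) \<noteq> x" for i j
  proof (cases "(i, j) \<in> N")
    case False
    then have "[:int p:] dvd f i j" using ij by (simp add: N_def)
    then have "[:int p:] dvd f i j * monom 1 (p * j) * (monom 1 e * u) ^ (i * P)" by (intro dvd_mult2)
    then show ?thesis by (auto simp: const_poly_dvd_iff)
  next
    case True
    have "n \<le> w (i, j)" unfolding n_def by (rule x(2)[OF True])
    moreover have "n \<noteq> w (i, j)"
    proof
      assume "n = w (i, j)"
      then have "m (i, j) + p * j + i * e * P = m (i1, j1) + p * j1 + i1 * e * P"
        by (simp add: n_def x1 w_def)
      then have "i = i1 \<and> j = j1"
        using ij mD[OF True] mD[of i1 j1] x(1)
        by (intro stepanov_exponents_distinct[OF p D e]) (auto simp: N_def x1)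
      then show False using ij x1 by simp
    qed
    ultimately have "n < m (i, j) + (p * j + i * e * P)" by (simp add: w_def)
    then show ?thesis unfolding trm
      using coeff_mult_lowest(1)[of "m (i, j)" "int p" "f i j" "n - (p * j + i * e * P)"] m2 by auto
  qed
  have main: "\<not> int p dvd coeff (f i1 j1 * monom 1 (p * j1) * (monom 1 e * u) ^ (i1 * P)) n"
  proof -
    have "n - (p * j1 + i1 * e * P) = m (i1, j1)" "\<not> n < p * j1 + i1 * e * P"
      by (simp_all add: n_def x1 w_def)
    then have t: "coeff (f i1 j1 * monom 1 (p * j1) * (monom 1 e * u) ^ (i1 * P)) n
        = coeff (f i1 j1 * u ^ (i1 * P)) (m (i1, j1))" unfolding trm by simp
    have "int p dvd coeff (f i1 j1 * u ^ (i1 * P)) (m (i1, j1)) - coeff (f i1 j1) (m (i1, j1)) * coeff (u ^ (i1 * P)) 0"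
      by (rule coeff_mult_lowest(2)) (rule m2)
    moreover have "\<not> int p dvd coeff (f i1 j1) (m (i1, j1)) * coeff (u ^ (i1 * P)) 0"
    proof -
      have "coeff (u ^ (i1 * P)) 0 = coeff u 0 ^ (i1 * P)" by (simp add: coeff_0_power)
      moreover have "\<not> int p dvd coeff u 0 ^ (i1 * P)" using u prime prime_dvd_power[of "int p"] by auto
      ultimately show ?thesis using m1[of i1 j1] x(1) x1 prime by (auto simp: prime_dvd_mult_iff)
    qed
    ultimately show ?thesis unfolding t
      using dvd_diff[of "int p" "coeff (f i1 j1 * u ^ (i1 * P)) (m (i1, j1))"
        "coeff (f i1 j1 * u ^ (i1 * P)) (m (i1, j1)) - coeff (f i1 j1) (m (i1, j1)) * coeff (u ^ (i1 * P)) 0"]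
      by (simp only: diff_diff_eq2 add_diff_cancel_left' diff_add_cancel) blast
  qed
  define t where "t = (\<lambda>(i, j). coeff (f i j * monom 1 (p * j) * (monom 1 e * u) ^ (i * P)) n)"
  have "coeff (\<Sum>i<d. \<Sum>j<J. f i j * monom 1 (p * j) * (monom 1 e * u) ^ (i * P)) n
      = (\<Sum>y\<in>{..<d} \<times> {..<J}. t y)"
    by (simp add: coeff_sum sum.cartesian_product t_def case_prod_beta)
  also have "\<dots> = t x + (\<Sum>y\<in>{..<d} \<times> {..<J} - {x}. t y)"
    using x(1) by (intro sum.remove) (auto simp: N_def)
  finally have c: "coeff (\<Sum>i<d. \<Sum>j<J. f i j * monom 1 (p * j) * (monom 1 e * u) ^ (i * P)) n = \<dots>" .
  have "int p dvd (\<Sum>y\<in>{..<d} \<times> {..<J} - {x}. t y)"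
    using other by (intro dvd_sum) (auto simp: t_def)
  moreover have "\<not> int p dvd t x" using main by (simp add: t_def x1)
  ultimately have "\<not> int p dvd coeff (\<Sum>i<d. \<Sum>j<J. f i j * monom 1 (p * j) * (monom 1 e * u) ^ (i * P)) n"
    unfolding c by (simp add: dvd_add_left_iff)
  then show ?thesis unfolding const_poly_dvd_iff by blast
qed

lemma cong_poly_if_dvd:
  assumes "[:q:] dvd A - (B :: int poly)"
  shows "[poly A s = poly B s] (mod q)"
proof -
  from assms obtain R where "A - B = [:q:] * R" by (auto elim: dvdE)
  then have "poly A s - poly B s = q * poly R s" by (metis poly_diff poly_mult poly_const_conv mult.commute poly_pCons poly_0 mult_zero_right add_0_right)
  then show ?thesis by (simp add: cong_iff_dvd_diff)
qed

lemma fermat_int: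
  assumes "prime p" "\<not> int p dvd s"
  shows "[s ^ (p - 1) = 1] (mod int p)"
proof -
  define a where "a = nat (s mod int p)"
  have pos: "int p > 0" using assms(1) prime_gt_0_nat by simp
  then have a: "int a = s mod int p" by (simp add: a_def)
  have "\<not> p dvd a"
  proof
    assume "p dvd a"
    then have "int p dvd s mod int p" by (simp flip: a)
    then show False using assms(2) by (simp add: dvd_mod_iff)
  qed
  then have "[a ^ (p - 1) = 1] (mod p)" using fermat_theorem assms(1) by blast
  then have "[int a ^ (p - 1) = 1] (mod int p)" by (metis cong_int_iff of_nat_1 of_nat_power)
  moreover have "[s ^ (p - 1) = int a ^ (p - 1)] (mod int p)"
    unfolding a by (intro cong_pow) (simp add: Cong.cong_def)
  ultimately show ?thesis by (rule cong_trans[rotated])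
qed

lemma fermat_int':
  assumes "prime p"
  shows "[s ^ p = s] (mod int p)"
proof (cases "int p dvd s")
  case True
  moreover have "int p dvd s ^ p" using True prime_gt_0_nat[OF assms] by (simp add: dvd_power_same dvd_trans dvd_power)
  ultimately show ?thesis by (simp add: cong_iff_dvd_diff)
next
  case False
  have "s ^ p = s ^ (p - 1) * s" using prime_gt_0_nat[OF assms] by (metis Suc_diff_1 power_Suc2)
  also have "[\<dots> = 1 * s] (mod int p)" by (intro cong_mult fermat_int assms False) simp
  finally show ?thesis by simp
qed

text \<open>At a point where \<open>h ^ P = 1\<close>, the power \<open>x ^ (p * j)\<close> acts as
  \<open>x ^ j\<close> and \<open>h ^ (i * P)\<close> as 1, so each derivative is replaced by a
  polynomial of degree below \<open>D + M * T + J\<close>. Killing \<open>M\<close> of these imposes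
  \<open>M * (D + M * T + J)\<close> linear conditions on the \<open>d * J * D\<close> coefficients
  of the \<open>f i j\<close>.\<close>

lemma stepanov_auxiliary:
  fixes p d P D J M T :: nat and h :: "int poly"
  assumes prime: "prime p" and h: "degree h \<le> T" and T: "T \<ge> 1"
    and count: "M * (D + M * T + J) < d * J * D"
  obtains f :: "nat \<Rightarrow> nat \<Rightarrow> int poly" and i0 j0 where "\<And>i j l. l \<ge> D \<Longrightarrow> coeff (f i j) l = 0"
    "i0 < d" "j0 < J" "\<not> [:int p:] dvd f i0 j0"
    "\<And>l. l < M \<Longrightarrow> [:int p:] dvd (\<Sum>i<d. \<Sum>j<J. stepanov_op h (i * P) l (f i j) * monom 1 j)"
proof -
  define V where "V = D + M * T + J"
  define I where "I = {..<d} \<times> {..<J} \<times> {..<D}"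
  define F where "F \<chi> i j = (\<Sum>l<D. monom (\<chi> (i, j, l)) l)" for \<chi> :: "nat \<times> nat \<times> nat \<Rightarrow> int" and i j
  define G where "G \<chi> l = (\<Sum>i<d. \<Sum>j<J. stepanov_op h (i * P) l (F \<chi> i j) * monom 1 j)" for \<chi> l
  have Fdiff: "F (\<lambda>x. \<phi> x - \<psi> x) i j = F \<phi> i j - F \<psi> i j" for \<phi> \<psi> i j
    by (simp add: F_def sum_subtractf diff_monom[symmetric])
  have "\<exists>\<chi>. (\<forall>x. x \<notin> I \<longrightarrow> \<chi> x = 0) \<and> (\<exists>x\<in>I. \<not> int p dvd \<chi> x)
      \<and> (\<forall>t\<in>{..<M} \<times> {..<V}. int p dvd coeff (G \<chi> (fst t)) (snd t))"
  proof (rule mod_prime_kernel)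
    show "card ({..<M} \<times> {..<V}) < card I" using count by (simp add: I_def V_def mult.assoc)
    show "p > 1" using prime by (rule prime_gt_1_nat)
    show "coeff (G (\<lambda>x. \<phi> x - \<psi> x) (fst t)) (snd t) = coeff (G \<phi> (fst t)) (snd t) - coeff (G \<psi> (fst t)) (snd t)" for t \<phi> \<psi>
      unfolding G_def Fdiff stepanov_op_diff by (simp add: left_diff_distrib sum_subtractf)
  qed (auto simp: I_def)
  then obtain \<chi> where \<chi>2: "\<exists>x\<in>I. \<not> int p dvd \<chi> x"
    and "\<forall>t\<in>{..<M} \<times> {..<V}. int p dvd coeff (G \<chi> (fst t)) (snd t)" by blast
  then have \<chi>3: "int p dvd coeff (G \<chi> l) t" if "l < M" "t < V" for l t
    using that by (metis SigmaI fst_conv lessThan_iff snd_conv)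
  have cF: "coeff (F \<chi> i j) l = (if l < D then \<chi> (i, j, l) else 0)" for i j l
    by (auto simp: F_def coeff_sum sum.delta')
  obtain i0 j0 l0 where x0: "(i0, j0, l0) \<in> I" "\<not> int p dvd \<chi> (i0, j0, l0)" using \<chi>2 by auto
  have D: "D > 0" using x0 by (auto simp: I_def)
  show ?thesis
  proof (rule that[of "F \<chi>" i0 j0])
    show "coeff (F \<chi> i j) l = 0" if "l \<ge> D" for i j l using that by (simp add: cF)
    show "i0 < d" "j0 < J" using x0 by (auto simp: I_def)
    show "\<not> [:int p:] dvd F \<chi> i0 j0"
      using x0 by (auto simp: const_poly_dvd_iff I_def cF intro!: exI[of _ l0])
    show "[:int p:] dvd (\<Sum>i<d. \<Sum>j<J. stepanov_op h (i * P) l (F \<chi> i j) * monom 1 j)" if l: "l < M" for l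
    proof -
      have "degree (stepanov_op h (i * P) l (F \<chi> i j) * monom 1 j) \<le> V - 1" if "j < J" for i j
      proof -
        have "degree (F \<chi> i j) \<le> D - 1" by (rule degree_le) (auto simp: cF)
        moreover have "l * T \<le> M * T" using l by simp
        ultimately have "degree (stepanov_op h (i * P) l (F \<chi> i j)) \<le> D - 1 + M * T"
          using degree_stepanov_op[OF h, of "i * P" l "F \<chi> i j"] by linarith
        moreover have "degree (monom (1::int) j) \<le> j" by (rule degree_monom_le)
        ultimately show ?thesis
          using degree_mult_le[of "stepanov_op h (i * P) l (F \<chi> i j)" "monom 1 j"] that D
          unfolding V_def by linarith
      qed
      then have deg: "degree (G \<chi> l) \<le> V - 1"
        unfolding G_def by (intro degree_sum_le) auto
      have "int p dvd coeff (G \<chi> l) t" for t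
      proof (cases "t < V")
        case False
        then have "coeff (G \<chi> l) t = 0" using deg D by (intro coeff_eq_0) (simp add: V_def)
        then show ?thesis by simp
      qed (use \<chi>3 l in blast)
      then show ?thesis unfolding const_poly_dvd_iff G_def by blast
    qed
  qed
qed

text \<open>The auxiliary polynomial has a zero of order \<open>M\<close> at every \<open>s\<close>
  that is counted, while its degree is at most \<open>p * (J + T)\<close>. As \<open>h\<close> is
  nonzero at such \<open>s\<close>, the factor \<open>h ^ l\<close> in front of the
  \<open>l\<close>-th derivative can be cancelled.\<close>

lemma stepanov_count:
  fixes p d P e T D J M :: nat and u :: "int poly"
  defines "h \<equiv> monom 1 e * u"
  assumes prime: "prime p" and p: "p = d * P + 1" and e: "e < d" "coprime e d"
    and u: "\<not> int p dvd coeff u 0" and h: "degree h \<le> T" and T: "T \<ge> 1"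
    and D: "D + d \<le> P" and M: "M \<le> p" and count: "M * (D + M * T + J) < d * J * D"
  shows "card {s\<in>{0..<int p}. [poly h s ^ P = 1] (mod int p)} * M \<le> p * (J + T)"
proof -
  obtain f :: "nat \<Rightarrow> nat \<Rightarrow> int poly" and i0 j0 where f: "\<And>i j l. l \<ge> D \<Longrightarrow> coeff (f i j) l = 0"
    and nz: "i0 < d" "j0 < J" "\<not> [:int p:] dvd f i0 j0"
    and van: "\<And>l. l < M \<Longrightarrow> [:int p:] dvd (\<Sum>i<d. \<Sum>j<J. stepanov_op h (i * P) l (f i j) * monom 1 j)"
    by (rule stepanov_auxiliary[OF prime h T count, of P]) blast
  define t where "t i j = f i j * monom 1 (p * j) * h ^ (i * P)" for i j
  define F where "F = (\<Sum>i<d. \<Sum>j<J. t i j)"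
  have Fnz: "\<not> [:int p:] dvd F"
    unfolding F_def t_def h_def by (rule stepanov_nonzero[where f = f, OF prime p D e u f nz])
  have Pp: "P > 0" using D e by simp
  have dP: "d * P \<le> p" using p by simp
  have "degree F \<le> p * (J + T)"
    unfolding F_def
  proof (intro degree_sum_le)
    fix i j assume i: "i \<in> {..<d}" and j: "j \<in> {..<J}"
    have "degree (f i j) \<le> D" by (rule degree_le) (use f in auto)
    moreover have "degree (monom (1::int) (p * j)) \<le> p * j" by (rule degree_monom_le)
    moreover have "degree (h ^ (i * P)) \<le> T * (d * P)"
    proof -
      have "degree (h ^ (i * P)) \<le> degree h * (i * P)" by (rule degree_power_le)
      also have "\<dots> \<le> T * (d * P)" using h i by (intro mult_mono) auto
      finally show ?thesis .
    qed
    moreover have "T * (d * P) \<le> T * p" using dP by simp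
    ultimately have "degree (t i j) \<le> D + p * j + T * p"
      unfolding t_def using degree_mult_le[of "f i j * monom 1 (p * j)" "h ^ (i * P)"]
        degree_mult_le[of "f i j" "monom 1 (p * j)"] by linarith
    also have "D \<le> p" using D dP e by (metis One_nat_def Suc_leI add_leD1 le_trans mult_le_mono1 nat_mult_1 neq0_conv not_less0)
    also have "p + p * j + T * p \<le> p * (J + T)"
    proof -
      have "p * (j + 1) \<le> p * J" using j by (intro mult_le_mono2) auto
      then show ?thesis by (simp add: algebra_simps)
    qed
    finally show "degree (t i j) \<le> p * (J + T)" by simp
  qed auto
  moreover have "card {s\<in>{0..<int p}. [poly h s ^ P = 1] (mod int p)} * M \<le> degree F"
  proof (rule card_multiple_roots_mod_prime[OF prime M Fnz])
    show "s = s'" if "s \<in> {s\<in>{0..<int p}. [poly h s ^ P = 1] (mod int p)}"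
      "s' \<in> {s\<in>{0..<int p}. [poly h s ^ P = 1] (mod int p)}" "int p dvd s - s'" for s s'
    proof -
      have "s mod int p = s' mod int p" using that(3) by (simp add: mod_eq_dvd_iff)
      then show ?thesis using that by simp
    qed
    fix s l assume s: "s \<in> {s\<in>{0..<int p}. [poly h s ^ P = 1] (mod int p)}" and l: "l < M"
    have hs: "[poly h s ^ P = 1] (mod int p)" using s by simp
    have cop: "\<not> int p dvd poly h s"
    proof
      assume "int p dvd poly h s"
      then have "int p dvd poly h s ^ P" using Pp by (simp add: dvd_power dvd_trans)
      then have "int p dvd 1" using hs cong_dvd_iff by blast
      then show False using prime by (simp add: prime_gt_1_nat)
    qed
    have hpow: "poly h s ^ l * poly ((pderiv ^^ l) F) s
        = (\<Sum>i<d. \<Sum>j<J. poly (h ^ l * (pderiv ^^ l) (t i j)) s)"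
      unfolding F_def by (simp add: higher_pderiv_sum poly_sum sum_distrib_left)
    also have "[\<dots> = (\<Sum>i<d. \<Sum>j<J. poly (stepanov_op h (i * P) l (f i j) * monom 1 j) s)] (mod int p)"
    proof (intro cong_sum)
      fix i j
      have "[:int p:] dvd pderiv (monom 1 (p * j))"
        by (auto simp: pderiv_monom const_poly_dvd_iff)
      then have "[poly (h ^ l * (pderiv ^^ l) (t i j)) s
        = poly (stepanov_op h (i * P) l (f i j) * monom 1 (p * j) * h ^ (i * P)) s] (mod int p)"
        unfolding t_def by (intro cong_poly_if_dvd stepanov_op_eq)
      also have "poly (stepanov_op h (i * P) l (f i j) * monom 1 (p * j) * h ^ (i * P)) s
        = poly (stepanov_op h (i * P) l (f i j)) s * (s ^ p) ^ j * (poly h s ^ P) ^ i"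
        by (simp add: poly_monom mult.commute[of i] flip: power_mult)
      also have "[\<dots> = poly (stepanov_op h (i * P) l (f i j)) s * s ^ j * 1 ^ i] (mod int p)"
        using hs by (intro cong_mult cong_pow fermat_int' prime) auto
      finally show "[poly (h ^ l * (pderiv ^^ l) (t i j)) s
        = poly (stepanov_op h (i * P) l (f i j) * monom 1 j) s] (mod int p)"
        by (simp add: poly_monom)
    qed
    also have "(\<Sum>i<d. \<Sum>j<J. poly (stepanov_op h (i * P) l (f i j) * monom 1 j) s)
        = poly (\<Sum>i<d. \<Sum>j<J. stepanov_op h (i * P) l (f i j) * monom 1 j) s"
      by (simp add: poly_sum)
    also have "[\<dots> = poly 0 s] (mod int p)"
      using van[OF l] by (intro cong_poly_if_dvd) simp
    finally have "int p dvd poly h s ^ l * poly ((pderiv ^^ l) F) s"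
      by (simp add: cong_iff_dvd_diff)
    then show "int p dvd poly ((pderiv ^^ l) F) s"
      using cop prime prime_dvd_power[of "int p" "poly h s" l] by (auto simp: prime_dvd_mult_iff)
  qed (auto intro: finite_subset[of _ "{0..<int p}"])
  ultimately show ?thesis by linarith
qed

text \<open>The \<open>s\<close> counted are those at which \<open>h\<close> is a nonzero
  \<open>d\<close>-th power modulo \<open>p\<close>; \<open>p / d\<close> is their expected number,
  and the rest is a weak form of Weil's bound. In \<open>large\<close>, the summand 144 gives
  \<open>sqrt p \<ge> 12\<close>, and together with \<open>2 * d\<^sup>2\<close> it gives
  \<open>d * D \<ge> p / 2\<close>.\<close>

lemma stepanov_bound:
  fixes p d P e T :: nat and u :: "int poly"
  defines "h \<equiv> monom 1 e * u"
  assumes prime: "prime p" and p: "p = d * P + 1" and e: "e < d" "coprime e d" and d: "d \<ge> 2"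
    and u: "\<not> int p dvd coeff u 0" and h: "degree h \<le> T" and T: "T \<ge> 1"
    and large: "p \<ge> 144 + 2 * d\<^sup>2"
  shows "real (card {s\<in>{0..<int p}. [poly h s ^ P = 1] (mod int p)}) \<le> p / d + 8 * T * sqrt p"
proof -
  define x where "x = sqrt (real p)"
  \<comment> \<open>Order \<open>M\<close> about \<open>sqrt p\<close> balances the error terms, and
    \<open>D\<close> is the largest width for which exponents stay distinct. The
    \<open>6 * T\<close> in \<open>J\<close> makes unknowns exceed conditions: beyond
    \<open>M * D\<close> there is a surplus of \<open>5 * d * D * T \<ge> 5 / 2 * p * T\<close>,
    against \<open>M * (M * T + J) \<le> 2 * p * T\<close>.\<close>
  define M where "M = nat \<lfloor>x\<rfloor>"
  define J where "J = M div d + 6 * T"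
  define D where "D = P - d"
  have x2: "x\<^sup>2 = real p" by (simp add: x_def)
  have x12: "x \<ge> 12" unfolding x_def using large by (intro real_le_rsqrt) simp
  have Mx: "real M \<le> x" "x < real M + 1" unfolding M_def using x12 by linarith+
  have xp: "x \<le> real p" using x12 x2 mult_right_mono[of 1 x x] by (simp add: power2_eq_square)
  have Mp: "M \<le> p" using Mx xp by linarith
  have dP: "real d * real P = real p - 1" using p by simp
  have d2: "real d * real d \<le> real p / 2 - 72"
  proof -
    have "real (144 + 2 * d\<^sup>2) \<le> real p" using large by (simp only: of_nat_le_iff)
    then show ?thesis by (simp add: power2_eq_square)
  qed
  have Pd: "d \<le> P"
  proof (rule ccontr)
    assume "\<not> d \<le> P"
    then have "d * P \<le> d * d" by simp
    then have "real d * real P \<le> real d * real d" by (metis of_nat_le_iff of_nat_mult)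
    then show False using dP d2 by linarith
  qed
  have "real d * real D = real p - 1 - real d * real d"
    unfolding D_def using Pd dP by (simp add: of_nat_diff algebra_simps)
  then have dD: "real d * real D \<ge> real p / 2" using d2 by linarith
  have "real (M div d) \<le> real M / real d" by (rule of_nat_div_le_of_nat)
  also have "\<dots> \<le> x / 2" using Mx d x12 by (intro frac_le) auto
  finally have J2: "real J \<le> x / 2 + 6 * T" unfolding J_def by simp
  have dJ: "real d * real J \<ge> real M + 5 * (real d * real T)"
  proof -
    have "M < d * (M div d) + d" using dividend_less_times_div[of d M] d by simp
    then have "real M < real d * real (M div d) + real d"
      by (metis of_nat_less_iff of_nat_add of_nat_mult)
    moreover have "real d * 1 \<le> real d * real T" using T by (intro mult_left_mono) auto
    ultimately show ?thesis unfolding J_def by (simp add: algebra_simps)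
  qed
  have count: "M * (D + M * T + J) < d * J * D"
  proof -
    have a: "real D * (real M + 5 * (real d * real T)) \<le> real D * (real d * real J)"
      using dJ by (intro mult_left_mono) auto
    have b: "5 * real T * (real d * real D) \<ge> 5 / 2 * (real p * real T)"
      using mult_left_mono[OF dD, of "5 * real T"] by (simp add: mult_ac)
    have c: "real M * (real M * real T + real J) \<le> x * (x * real T + (x / 2 + 6 * real T))"
      using Mx J2 x12 by (intro mult_mono add_mono) auto
    have e1: "x * (x * real T + (x / 2 + 6 * real T)) = real p * T + real p / 2 + 6 * (real T * x)"
      using x2 by (simp add: power2_eq_square algebra_simps)
    have e2: "real p \<le> real p * T" using T mult_left_mono[of 1 "real T" "real p"] by simp
    have "real T * (12 * x) \<le> real T * (x * x)" using x12 by (intro mult_left_mono mult_right_mono) auto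
    also have "\<dots> = real p * T" using x2 by (simp add: power2_eq_square)
    finally have e3: "12 * (real T * x) \<le> real p * T" by simp
    have pT: "real p * T > 0" using T large by simp
    have "real M * (real M * real T + real J) < 5 * real T * (real d * real D)"
      using b c[unfolded e1] e2 e3 pT by linarith
    then have "real (M * (D + M * T + J)) < real (d * J * D)"
      using a by (simp add: algebra_simps)
    then show ?thesis by (simp only: of_nat_less_iff)
  qed
  have DP: "D + d \<le> P" using Pd by (simp add: D_def)
  have "card {s\<in>{0..<int p}. [poly h s ^ P = 1] (mod int p)} * M \<le> p * (J + T)"
    unfolding h_def using stepanov_count[OF prime p e u h[unfolded h_def] T DP Mp count] .
  then have "real (card {s\<in>{0..<int p}. [poly h s ^ P = 1] (mod int p)} * M) \<le> real (p * (J + T))"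
    by (simp only: of_nat_le_iff)
  moreover have M0: "real M > 0" using Mx x12 by linarith
  ultimately have 1: "real (card {s\<in>{0..<int p}. [poly h s ^ P = 1] (mod int p)}) \<le> real p * (real J + real T) / real M"
    by (simp add: pos_le_divide_eq)
  have "real J + real T \<le> real M / real d + 7 * real T"
    using of_nat_div_le_of_nat[of M d, where 'a = real] by (simp add: J_def)
  then have 2: "real p * (real J + real T) / real M \<le> real p * (real M / real d + 7 * real T) / real M"
    using M0 by (intro divide_right_mono mult_left_mono) auto
  have 3: "real p * (real M / real d + 7 * real T) / real M = real p / real d + 7 * real T * (real p / real M)"
    using M0 d by (simp add: field_simps)
  have "11 * x \<le> 12 * real M" using Mx x12 by linarith
  then have "x * (11 * x) \<le> x * (12 * real M)" using x12 by (intro mult_left_mono) auto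
  then have "11 * real p \<le> 12 * x * real M" using x2 by (simp add: power2_eq_square mult_ac)
  then have "real p / real M \<le> 12 / 11 * x" using M0 by (simp add: pos_divide_le_eq)
  then have 4: "7 * real T * (real p / real M) \<le> 7 * real T * (12 / 11 * x)"
    by (intro mult_left_mono) auto
  have "0 \<le> real T * x" using x12 by simp
  then have 5: "7 * real T * (12 / 11 * x) \<le> 8 * (real T * x)" by (simp add: mult_ac)
  have 6: "8 * (real T * x) = 8 * real T * sqrt (real p)" by (simp add: x_def)
  show ?thesis using 1 2[unfolded 3] 4 5 6 by linarith
qed

section \<open>Residues of the columns and the larger sieve\<close>

lemma not_dvd_if_power_cong_1:
  assumes "prime p" "[y ^ j = 1] (mod int p)" "j > 0"
  shows "\<not> int p dvd y"
proof
  assume "int p dvd y"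
  then have "int p dvd y ^ j" using assms(3) by (meson dvd_power dvd_trans)
  then have "int p dvd 1" using assms(2) cong_dvd_iff by blast
  then show False using assms(1) by (simp add: prime_gt_1_nat)
qed

lemma card_power_roots_mod_prime:
  assumes "prime p" "d > 0"
  shows "card {s\<in>{0..<int p}. [s ^ d = 1] (mod int p)} \<le> d"
proof -
  define F where "F = monom (1::int) d - 1"
  have "card {s\<in>{0..<int p}. [s ^ d = 1] (mod int p)} * 1 \<le> degree F"
  proof (rule card_multiple_roots_mod_prime[OF assms(1)])
    show "1 \<le> p" using prime_gt_0_nat[OF assms(1)] by simp
    have "coeff F d = 1" using assms(2) by (simp add: F_def)
    then show "\<not> [:int p:] dvd F"
      using prime_gt_1_nat[OF assms(1)] by (auto simp: const_poly_dvd_iff intro!: exI[of _ d])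
    show "finite {s\<in>{0..<int p}. [s ^ d = 1] (mod int p)}"
      by (rule finite_subset[of _ "{0..<int p}"]) auto
    show "s = t" if "s \<in> {s\<in>{0..<int p}. [s ^ d = 1] (mod int p)}"
      "t \<in> {s\<in>{0..<int p}. [s ^ d = 1] (mod int p)}" "int p dvd s - t" for s t
    proof -
      have "s mod int p = t mod int p" using that(3) by (simp add: mod_eq_dvd_iff)
      then show ?thesis using that by simp
    qed
    show "int p dvd poly ((pderiv ^^ l) F) s"
      if "s \<in> {s\<in>{0..<int p}. [s ^ d = 1] (mod int p)}" "l < 1" for s l
      using that by (simp add: F_def poly_monom cong_iff_dvd_diff)
  qed
  also have "degree F \<le> d" unfolding F_def
    by (intro degree_diff_le) (auto simp: degree_monom_eq)
  finally show ?thesis by simp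
qed

lemma power_cong_exponent_mod:
  fixes y :: int
  assumes "[y ^ d = 1] (mod q)"
  shows "[y ^ (j mod d) = y ^ j] (mod q)"
proof -
  have "y ^ j = y ^ (d * (j div d) + j mod d)" by simp
  also have "\<dots> = (y ^ d) ^ (j div d) * y ^ (j mod d)" by (simp only: power_add power_mult)
  also have "[\<dots> = 1 ^ (j div d) * y ^ (j mod d)] (mod q)"
    by (intro cong_mult cong_pow assms cong_refl)
  finally show ?thesis by (simp add: cong_sym)
qed

text \<open>The map \<open>e \<mapsto> \<Prod>a\<in>A. y a ^ e a\<close> is a homomorphism from a group of order \<open>d ^ card A\<close>
  to the \<open>d\<close>-th roots of unity modulo \<open>p\<close>, so its kernel is large.\<close>
lemma card_kernel_of_exponents:
  fixes A :: "'a set" and y :: "'a \<Rightarrow> int"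
  assumes fin: "finite A" and p: "prime p" and d: "d > 0" and y: "\<And>a. a \<in> A \<Longrightarrow> [y a ^ d = 1] (mod int p)"
  shows "d ^ card A \<le> d * card {e\<in>A \<rightarrow>\<^sub>E {..<d}. [(\<Prod>a\<in>A. y a ^ e a) = 1] (mod int p)}"
proof -
  define E where "E = (A \<rightarrow>\<^sub>E {..<d})"
  define v where "v e = (\<Prod>a\<in>A. y a ^ e a) mod int p" for e
  define Ker where "Ker = {e\<in>E. [(\<Prod>a\<in>A. y a ^ e a) = 1] (mod int p)}"
  have finE: "finite E" using fin by (simp add: E_def finite_PiE)
  have finK: "finite Ker" using finE by (simp add: Ker_def)
  have pos: "int p > 0" using prime_gt_0_nat[OF p] by simp
  have "v ` E \<subseteq> {s\<in>{0..<int p}. [s ^ d = 1] (mod int p)}"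
  proof
    fix w assume "w \<in> v ` E"
    then obtain e where e: "w = v e" by auto
    have "[w ^ d = (\<Prod>a\<in>A. y a ^ e a) ^ d] (mod int p)"
      unfolding e v_def by (intro cong_pow) (simp add: Cong.cong_def)
    also have "(\<Prod>a\<in>A. y a ^ e a) ^ d = (\<Prod>a\<in>A. (y a ^ d) ^ e a)"
      by (simp add: prod_power_distrib mult.commute flip: power_mult)
    also have "[\<dots> = (\<Prod>a\<in>A. 1 ^ e a)] (mod int p)"
      by (intro cong_prod cong_pow y)
    finally show "w \<in> {s\<in>{0..<int p}. [s ^ d = 1] (mod int p)}"
      using pos by (simp add: e v_def)
  qed
  then have "card (v ` E) \<le> card {s\<in>{0..<int p}. [s ^ d = 1] (mod int p)}"
    by (intro card_mono) (auto intro: finite_subset[of _ "{0..<int p}"])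
  also have "\<dots> \<le> d" by (rule card_power_roots_mod_prime[OF p d])
  finally have vals: "card (v ` E) \<le> d" .
  have fibre: "card {e\<in>E. v e = w} \<le> card Ker" if w: "w \<in> v ` E" for w
  proof -
    obtain e' where e': "e' \<in> E" "w = v e'" using w by auto
    \<comment> \<open>Translation by \<open>- e'\<close> in the group of exponent vectors modulo
      \<open>d\<close>; it carries the fibre of \<open>e'\<close> into the kernel.\<close>
    define \<tau> where "\<tau> e = (\<lambda>a\<in>A. (e a + (d - e' a)) mod d)" for e :: "'a \<Rightarrow> nat"
    have "inj_on \<tau> {e\<in>E. v e = w}"
    proof (rule inj_onI)
      fix f g assume fg: "f \<in> {e\<in>E. v e = w}" "g \<in> {e\<in>E. v e = w}" "\<tau> f = \<tau> g"
      show "f = g"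
      proof (rule PiE_ext[of f A "\<lambda>_. {..<d}" g])
        fix a assume a: "a \<in> A"
        have "(f a + (d - e' a)) mod d = (g a + (d - e' a)) mod d"
          using fun_cong[OF fg(3), of a] a by (simp add: \<tau>_def)
        then have "[f a = g a] (mod d)"
          using cong_add_rcancel_nat[of "f a" "d - e' a" "g a" d] by (simp add: Cong.cong_def)
        moreover have "f a < d" "g a < d" using fg(1,2) a by (auto simp: E_def)
        ultimately show "f a = g a" by (simp add: Cong.cong_def)
      qed (use fg in \<open>auto simp: E_def\<close>)
    qed
    moreover have "\<tau> ` {e\<in>E. v e = w} \<subseteq> Ker"
    proof (rule image_subsetI)
      fix e assume e: "e \<in> {e\<in>E. v e = w}"
      let ?W = "\<Prod>a\<in>A. y a ^ e' a" and ?Z = "\<Prod>a\<in>A. y a ^ \<tau> e a"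
      have lt: "e' a \<le> d" if "a \<in> A" for a using e'(1) that by (force simp: E_def)
      have "[?Z * ?W = (\<Prod>a\<in>A. y a ^ (e a + (d - e' a)) * y a ^ e' a)] (mod int p)"
        unfolding prod.distrib
        by (intro cong_mult cong_prod cong_refl) (simp add: \<tau>_def power_cong_exponent_mod y)
      also have "(\<Prod>a\<in>A. y a ^ (e a + (d - e' a)) * y a ^ e' a) = (\<Prod>a\<in>A. y a ^ e a * y a ^ d)"
      proof (rule prod.cong)
        fix x assume "x \<in> A"
        then have "e x + (d - e' x) + e' x = e x + d" using lt[of x] by simp
        then show "y x ^ (e x + (d - e' x)) * y x ^ e' x = y x ^ e x * y x ^ d"
          by (simp only: power_add[symmetric])
      qed simp
      also have "[\<dots> = (\<Prod>a\<in>A. y a ^ e a * 1)] (mod int p)"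
        by (intro cong_prod cong_mult y cong_refl)
      also have "(\<Prod>a\<in>A. y a ^ e a * 1) = (\<Prod>a\<in>A. y a ^ e a)" by simp
      also have "[\<dots> = ?W] (mod int p)" using e e'(2) by (simp add: v_def Cong.cong_def)
      finally have "int p dvd ?Z * ?W - ?W" by (simp add: cong_iff_dvd_diff)
      then have "int p dvd (?Z - 1) * ?W" by (simp add: left_diff_distrib)
      moreover have "\<not> int p dvd ?W"
      proof
        assume "int p dvd ?W"
        then obtain a where "a \<in> A" "int p dvd y a ^ e' a" using p fin by (auto simp: prime_dvd_prod_iff)
        then have "int p dvd y a" using prime_dvd_power[of "int p"] p by auto
        then show False using not_dvd_if_power_cong_1[OF p y[OF \<open>a \<in> A\<close>] d] by simp
      qed
      ultimately have "int p dvd ?Z - 1" using p by (simp add: prime_dvd_mult_iff)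
      then have "[?Z = 1] (mod int p)" by (simp add: cong_iff_dvd_diff)
      moreover have "\<tau> e \<in> E" using d by (auto simp: E_def \<tau>_def)
      ultimately show "\<tau> e \<in> Ker" by (simp add: Ker_def)
    qed
    ultimately show ?thesis by (intro card_inj_on_le[OF _ _ finK])
  qed
  have "d ^ card A = card E" using fin by (simp add: E_def card_PiE)
  also have "\<dots> \<le> card (\<Union>w\<in>v ` E. {e\<in>E. v e = w})" using finE by (intro card_mono) auto
  also have "\<dots> \<le> (\<Sum>w\<in>v ` E. card {e\<in>E. v e = w})" using finE by (intro card_UN_le) auto
  also have "\<dots> \<le> (\<Sum>w\<in>v ` E. card Ker)" by (intro sum_mono fibre)
  also have "\<dots> \<le> d * card Ker" using vals by simp
  finally show ?thesis by (simp add: Ker_def E_def)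
qed

lemma card_residues_linear:
  assumes "prime p" "\<not> int p dvd a"
  shows "card {x\<in>{0..<int p}. int p dvd a * x + n} \<le> 1"
proof (rule card_le_Suc0_iff_eq[THEN iffD2, folded One_nat_def], goal_cases)
  case 1
  show ?case by (rule finite_subset[of _ "{0..<int p}"]) auto
next
  case 2
  have "x = y" if "x \<in> {x\<in>{0..<int p}. int p dvd a * x + n}" "y \<in> {x\<in>{0..<int p}. int p dvd a * x + n}" for x y
  proof -
    have "int p dvd (a * x + n) - (a * y + n)" using that by (intro dvd_diff) auto
    then have "int p dvd a * (x - y)" by (simp add: algebra_simps)
    then have "int p dvd x - y" using assms by (simp add: prime_dvd_mult_iff)
    then have "x mod int p = y mod int p" by (simp add: mod_eq_dvd_iff)
    then show ?thesis using that by simp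
  qed
  then show ?case by blast
qed

text \<open>Moving the root \<open>s\<close> of \<open>a0 * x + n\<close> modulo \<open>p\<close> to
  0 gives the product the shape \<open>t ^ e a0 * u\<close>, where \<open>u\<close> is a unit at 0
  because the other linear factors have different roots. As \<open>d\<close> is prime,
  \<open>e a0\<close> is coprime to \<open>d\<close>, so Stepanov's bound applies.\<close>

lemma exponent_pattern_bound:
  fixes p d P :: nat and A :: "int set" and n :: int
  assumes p: "prime p" "p = d * P + 1" and d: "prime d" and large: "p \<ge> 144 + 2 * d\<^sup>2"
    and A: "finite A" and nd: "\<not> int p dvd n" and ad: "\<And>a. a \<in> A \<Longrightarrow> \<not> int p dvd a"
    and dd: "\<And>a b. a \<in> A \<Longrightarrow> b \<in> A \<Longrightarrow> a \<noteq> b \<Longrightarrow> \<not> int p dvd a - b"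
    and e: "\<And>a. a \<in> A \<Longrightarrow> e a < d" and a0: "a0 \<in> A" "e a0 \<noteq> 0"
  shows "real (card {x\<in>{0..<int p}. [(\<Prod>a\<in>A. ((a * x + n) ^ P) ^ e a) = 1] (mod int p)})
    \<le> p / d + 8 * (card A * d) * sqrt p"
proof -
  have pint: "prime (int p)" using p(1) by simp
  have pos: "int p > 0" using prime_gt_0_nat[OF p(1)] by simp
  have "coprime a0 (int p)" using ad[OF a0(1)] pint by (metis coprime_commute prime_imp_coprime)
  then obtain b where b: "[a0 * b = 1] (mod int p)" using cong_solve_coprime_int by blast
  define s where "s = - n * b"
  have s: "int p dvd a0 * s + n"
  proof -
    have "[a0 * b * (- n) = 1 * (- n)] (mod int p)" using b by (intro cong_mult) auto
    then have "int p dvd a0 * b * (- n) - 1 * (- n)" by (simp only: cong_iff_dvd_diff)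
    moreover have "a0 * b * (- n) - 1 * (- n) = a0 * s + n" by (simp add: s_def)
    ultimately show ?thesis by (simp only:)
  qed
  define u where "u = smult (a0 ^ e a0) (\<Prod>a\<in>A-{a0}. [:a * s + n, a:] ^ e a)"
  define h where "h = monom 1 (e a0) * u"
  have "\<not> int p dvd coeff u 0"
  proof
    assume "int p dvd coeff u 0"
    then have "int p dvd a0 ^ e a0 * (\<Prod>a\<in>A-{a0}. (a * s + n) ^ e a)"
      by (simp add: u_def poly_0_coeff_0[symmetric] poly_prod)
    then have "int p dvd a0 ^ e a0 \<or> (\<exists>a\<in>A-{a0}. int p dvd (a * s + n) ^ e a)"
      using pint A by (simp add: prime_dvd_mult_iff prime_dvd_prod_iff)
    then consider "int p dvd a0" | a where "a \<in> A" "a \<noteq> a0" "int p dvd a * s + n"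
      using prime_dvd_power[OF pint] by blast
    then show False
    proof cases
      case 1
      then show ?thesis using ad a0 by simp
    next
      case 2
      have "int p dvd a0 * (a * s + n) - a * (a0 * s + n)" using 2 s by (intro dvd_diff dvd_mult)
      then have "int p dvd n * (a0 - a)" by (simp add: algebra_simps)
      then show ?thesis using pint nd dd[of a0 a] a0 2 by (auto simp: prime_dvd_mult_iff)
    qed
  qed
  moreover have "degree h \<le> card A * d"
  proof -
    have "degree (\<Prod>a\<in>A-{a0}. [:a * s + n, a:] ^ e a) \<le> (\<Sum>a\<in>A-{a0}. degree ([:a * s + n, a:] ^ e a))"
      using degree_prod_sum_le[of "A-{a0}" "\<lambda>a. [:a * s + n, a:] ^ e a"] A by (simp add: o_def)
    also have "\<dots> \<le> (\<Sum>a\<in>A-{a0}. e a)"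
    proof (rule sum_mono)
      fix a
      have "degree ([:a * s + n, a:] ^ e a) \<le> degree [:a * s + n, a:] * e a" by (rule degree_power_le)
      also have "\<dots> \<le> 1 * e a" by (intro mult_le_mono1) (simp add: degree_pCons_eq_if)
      finally show "degree ([:a * s + n, a:] ^ e a) \<le> e a" by simp
    qed
    finally have "degree u \<le> (\<Sum>a\<in>A-{a0}. e a)" unfolding u_def using degree_smult_le order_trans by blast
    then have "degree h \<le> e a0 + (\<Sum>a\<in>A-{a0}. e a)"
      unfolding h_def using degree_mult_le[of "monom 1 (e a0)" u] degree_monom_le[of "1::int" "e a0"] by linarith
    also have "\<dots> = (\<Sum>a\<in>A. e a)" using A a0 by (simp add: sum.remove)
    also have "\<dots> \<le> (\<Sum>a\<in>A. d)" using e by (intro sum_mono) (simp add: less_imp_le)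
    finally show ?thesis by simp
  qed
  moreover have "coprime (e a0) d"
    using d e[OF a0(1)] a0(2) by (metis coprime_commute prime_imp_coprime dvd_imp_le not_le gr0I)
  moreover have "card A * d \<ge> 1" using A a0 d by (auto simp: Suc_le_eq card_gt_0_iff prime_gt_0_nat)
  ultimately have 1: "real (card {t\<in>{0..<int p}. [poly h t ^ P = 1] (mod int p)}) \<le> p / d + 8 * (card A * d) * sqrt p"
    unfolding h_def using stepanov_bound[OF p, of "e a0" u "card A * d"] e[OF a0(1)] prime_ge_2_nat[OF d] large by simp
  have "card {x\<in>{0..<int p}. [(\<Prod>a\<in>A. ((a * x + n) ^ P) ^ e a) = 1] (mod int p)}
      \<le> card {t\<in>{0..<int p}. [poly h t ^ P = 1] (mod int p)}"
  proof (rule card_inj_on_le[where f = "\<lambda>x. (x - s) mod int p"])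
    show "inj_on (\<lambda>x. (x - s) mod int p) {x\<in>{0..<int p}. [(\<Prod>a\<in>A. ((a * x + n) ^ P) ^ e a) = 1] (mod int p)}"
    proof (rule inj_onI, clarify)
      fix x y assume xy: "x \<in> {0..<int p}" "y \<in> {0..<int p}" "(x - s) mod int p = (y - s) mod int p"
      then have "int p dvd x - y" by (simp add: mod_eq_dvd_iff)
      then have "x mod int p = y mod int p" by (simp add: mod_eq_dvd_iff)
      then show "x = y" using xy by simp
    qed
    show "finite {t\<in>{0..<int p}. [poly h t ^ P = 1] (mod int p)}"
      by (rule finite_subset[of _ "{0..<int p}"]) auto
    show "(\<lambda>x. (x - s) mod int p) ` {x\<in>{0..<int p}. [(\<Prod>a\<in>A. ((a * x + n) ^ P) ^ e a) = 1] (mod int p)}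
        \<subseteq> {t\<in>{0..<int p}. [poly h t ^ P = 1] (mod int p)}"
    proof (rule image_subsetI)
      fix x assume x: "x \<in> {x\<in>{0..<int p}. [(\<Prod>a\<in>A. ((a * x + n) ^ P) ^ e a) = 1] (mod int p)}"
      define t where "t = (x - s) mod int p"
      have t: "[t = x - s] (mod int p)" by (simp add: t_def Cong.cong_def)
      have lin: "[a * s + n + t * a = a * x + n] (mod int p)" for a
      proof -
        have "[a * s + n + t * a = a * s + n + (x - s) * a] (mod int p)" by (intro cong_add cong_mult t cong_refl)
        then show ?thesis by (simp add: algebra_simps)
      qed
      have "poly h t = (t * a0) ^ e a0 * (\<Prod>a\<in>A-{a0}. (a * s + n + t * a) ^ e a)"
        by (simp add: h_def u_def poly_monom poly_prod power_mult_distrib)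
      also have "[\<dots> = (a0 * x + n) ^ e a0 * (\<Prod>a\<in>A-{a0}. (a * x + n) ^ e a)] (mod int p)"
      proof (intro cong_mult cong_prod cong_pow lin)
        have "[0 + t * a0 = a0 * s + n + t * a0] (mod int p)"
          by (intro cong_add cong_refl) (use s in \<open>simp add: cong_sym_eq[of 0] cong_0_iff\<close>)
        then have "[t * a0 = a0 * s + n + t * a0] (mod int p)" by simp
        then show "[t * a0 = a0 * x + n] (mod int p)" using lin cong_trans by blast
      qed
      also have "(a0 * x + n) ^ e a0 * (\<Prod>a\<in>A-{a0}. (a * x + n) ^ e a) = (\<Prod>a\<in>A. (a * x + n) ^ e a)"
        using A a0(1) by (simp add: prod.remove)
      finally have "[poly h t ^ P = (\<Prod>a\<in>A. (a * x + n) ^ e a) ^ P] (mod int p)" by (rule cong_pow)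
      also have "(\<Prod>a\<in>A. (a * x + n) ^ e a) ^ P = (\<Prod>a\<in>A. ((a * x + n) ^ P) ^ e a)"
        by (simp add: prod_power_distrib mult.commute flip: power_mult)
      also have "[\<dots> = 1] (mod int p)" using x by simp
      finally show "(x - s) mod int p \<in> {t\<in>{0..<int p}. [poly h t ^ P = 1] (mod int p)}"
        using pos by (simp add: t_def)
    qed
  qed
  then show ?thesis using 1 by simp
qed

text \<open>The pairs \<open>(e, x)\<close> with product 1 are counted in two ways. A residue with
  the full pattern belongs to all \<open>d ^ card A\<close> vectors \<open>e\<close>, any other
  residue apart from the zeros to at least a \<open>d\<close>-th part of them, whereas each nonzero
  \<open>e\<close> has at most about \<open>p / d\<close> residues. The main terms
  \<open>p / d\<close> cancel; \<open>p / d ^ card A\<close> comes from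
  \<open>e = 0\<close>.\<close>

lemma card_residue_pattern:
  fixes p d P :: nat and A :: "int set" and n :: int
  assumes p: "prime p" "p = d * P + 1" and d: "prime d" and large: "p \<ge> 144 + 2 * d\<^sup>2"
    and A: "finite A" "A \<noteq> {}" and nd: "\<not> int p dvd n" and ad: "\<And>a. a \<in> A \<Longrightarrow> \<not> int p dvd a"
    and dd: "\<And>a b. a \<in> A \<Longrightarrow> b \<in> A \<Longrightarrow> a \<noteq> b \<Longrightarrow> \<not> int p dvd a - b"
  shows "real (card {x\<in>{0..<int p}. \<forall>a\<in>A. [(a * x + n) ^ P = 1] (mod int p)})
    \<le> 2 * p / d ^ card A + card A + 16 * d * card A * sqrt p"
proof -
  define X where "X = {0..<int p}"
  define E where "E = (A \<rightarrow>\<^sub>E {..<d})"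
  define m where "m = card A"
  define R where "R e x \<longleftrightarrow> [(\<Prod>a\<in>A. ((a * x + n) ^ P) ^ e a) = 1] (mod int p)" for e x
  define S where "S = {x\<in>X. \<forall>a\<in>A. [(a * x + n) ^ P = 1] (mod int p)}"
  define X' where "X' = {x\<in>X. \<forall>a\<in>A. \<not> int p dvd a * x + n}"
  define z where "z = (\<lambda>a\<in>A. 0 :: nat)"
  have d2: "d \<ge> 2" using prime_ge_2_nat[OF d] .
  have finX: "finite X" by (simp add: X_def)
  have cardX: "card X = p" by (simp add: X_def)
  have finE: "finite E" using A by (simp add: E_def finite_PiE)
  have cardE: "card E = d ^ m" using A by (simp add: E_def card_PiE m_def)
  have zE: "z \<in> E" using d2 by (auto simp: z_def E_def)
  have Ppos: "P > 0" using p large by (cases P) auto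
  have SX': "S \<subseteq> X'" unfolding S_def X'_def using not_dvd_if_power_cong_1[OF p(1) _ Ppos] by blast
  have X'X: "X' \<subseteq> X" by (auto simp: X'_def)
  have cardX': "p \<le> card X' + m"
  proof -
    have "X \<subseteq> X' \<union> (\<Union>a\<in>A. {x\<in>{0..<int p}. int p dvd a * x + n})" by (auto simp: X'_def X_def)
    then have "card X \<le> card (X' \<union> (\<Union>a\<in>A. {x\<in>{0..<int p}. int p dvd a * x + n}))"
      using A finX X'X by (intro card_mono) (auto intro: finite_subset[of _ "{0..<int p}"] finite_subset)
    also have "\<dots> \<le> card X' + card (\<Union>a\<in>A. {x\<in>{0..<int p}. int p dvd a * x + n})" by (rule card_Un_le)
    also have "card (\<Union>a\<in>A. {x\<in>{0..<int p}. int p dvd a * x + n}) \<le> (\<Sum>a\<in>A. card {x\<in>{0..<int p}. int p dvd a * x + n})"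
      using A by (intro card_UN_le)
    also have "\<dots> \<le> (\<Sum>a\<in>A. 1)" using ad by (intro sum_mono card_residues_linear p)
    finally show ?thesis using cardX by (simp add: m_def)
  qed
  have "(\<Sum>e\<in>E. card {x\<in>X. R e x}) = (\<Sum>e\<in>E. \<Sum>x\<in>X. if R e x then 1 else 0)"
    using finX by (intro sum.cong refl) (simp add: sum.If_cases Int_def)
  also have "\<dots> = (\<Sum>x\<in>X. \<Sum>e\<in>E. if R e x then 1 else 0)" by (rule sum.swap)
  also have "\<dots> = (\<Sum>x\<in>X. card {e\<in>E. R e x})"
    using finE by (intro sum.cong refl) (simp add: sum.If_cases Int_def)
  finally have swap: "(\<Sum>e\<in>E. card {x\<in>X. R e x}) = (\<Sum>x\<in>X. card {e\<in>E. R e x})" .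
  define Bd where "Bd = real p / d + 8 * (m * d) * sqrt p"
  have Bd0: "Bd \<ge> 0" by (simp add: Bd_def)
  have "real (\<Sum>e\<in>E. card {x\<in>X. R e x}) = real (card {x\<in>X. R z x}) + (\<Sum>e\<in>E-{z}. real (card {x\<in>X. R e x}))"
    using finE zE by (simp add: sum.remove)
  also have "\<dots> \<le> real p + (\<Sum>e\<in>E-{z}. Bd)"
  proof (intro add_mono sum_mono)
    have "card {x\<in>X. R z x} \<le> card X" using finX by (intro card_mono) auto
    then show "real (card {x\<in>X. R z x}) \<le> real p" using cardX by simp
    fix e assume e: "e \<in> E - {z}"
    have ed: "e a < d" if "a \<in> A" for a using e that by (auto simp: E_def)
    have "\<exists>a0\<in>A. e a0 \<noteq> 0"
    proof (rule ccontr)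
      assume "\<not> ?thesis"
      then have "e = z" using e zE by (intro PiE_ext[of e A "\<lambda>_. {..<d}" z]) (auto simp: E_def z_def)
      then show False using e by simp
    qed
    then obtain a0 where "a0 \<in> A" "e a0 \<noteq> 0" by blast
    then show "real (card {x\<in>X. R e x}) \<le> Bd"
      unfolding X_def R_def Bd_def m_def
      by (intro exponent_pattern_bound[OF p d large A(1) nd ad dd ed]) auto
  qed
  also have "\<dots> \<le> real p + real (card E) * Bd"
    using Bd0 finE by (simp add: mult_right_mono card_mono)
  finally have upper: "real (\<Sum>e\<in>E. card {x\<in>X. R e x}) \<le> real p + real d ^ m * Bd" by (simp add: cardE)
  have KS: "card {e\<in>E. R e x} = d ^ m" if x: "x \<in> S" for x
  proof -
    have "[(\<Prod>a\<in>A. ((a * x + n) ^ P) ^ e a) = (\<Prod>a\<in>A. 1 ^ e a)] (mod int p)" for e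
      using x by (intro cong_prod cong_pow) (auto simp: S_def)
    then have "R e x" for e by (simp add: R_def)
    then show ?thesis using cardE by simp
  qed
  have KX': "real d ^ m / d \<le> real (card {e\<in>E. R e x})" if x: "x \<in> X'" for x
  proof -
    have "d ^ card A \<le> d * card {e\<in>A \<rightarrow>\<^sub>E {..<d}. [(\<Prod>a\<in>A. ((a * x + n) ^ P) ^ e a) = 1] (mod int p)}"
    proof (rule card_kernel_of_exponents[OF A(1) p(1)])
      fix a assume a: "a \<in> A"
      have "p - 1 = P * d" using p(2) by simp
      then have "((a * x + n) ^ P) ^ d = (a * x + n) ^ (p - 1)" by (simp add: power_mult)
      then show "[((a * x + n) ^ P) ^ d = 1] (mod int p)"
        using fermat_int[OF p(1), of "a * x + n"] x a by (auto simp: X'_def)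
    qed (use d2 in auto)
    then have "real (d ^ m) \<le> real (d * card {e\<in>E. R e x})"
      unfolding m_def E_def R_def by (simp only: of_nat_le_iff)
    then show ?thesis using d2 by (simp add: pos_divide_le_eq mult.commute)
  qed
  have finX': "finite X'" using finX X'X by (rule finite_subset[rotated])
  have "real (card S) * real d ^ m + (real (card X') - real (card S)) * (real d ^ m / d)
      = (\<Sum>x\<in>S. real d ^ m) + (\<Sum>x\<in>X'-S. real d ^ m / d)"
    using SX' finX' by (simp add: card_Diff_subset finite_subset[OF SX'] card_mono of_nat_diff)
  also have "\<dots> \<le> (\<Sum>x\<in>S. real (card {e\<in>E. R e x})) + (\<Sum>x\<in>X'-S. real (card {e\<in>E. R e x}))"
    using KS KX' by (intro add_mono sum_mono) auto
  also have "\<dots> = (\<Sum>x\<in>X'. real (card {e\<in>E. R e x}))"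
    using sum.subset_diff[OF SX' finX', of "\<lambda>x. real (card {e\<in>E. R e x})"] by simp
  also have "\<dots> \<le> (\<Sum>x\<in>X. real (card {e\<in>E. R e x}))"
    using finX X'X by (intro sum_mono2) auto
  also have "\<dots> = real (\<Sum>e\<in>E. card {x\<in>X. R e x})" by (simp add: swap)
  finally have low: "real (card S) * real d ^ m + (real (card X') - real (card S)) * (real d ^ m / d)
      \<le> real p + real d ^ m * Bd" using upper by linarith
  define q where "q = real d ^ m"
  have q: "q > 0" using d2 by (simp add: q_def)
  define c where "c = real (card S)"
  have c0: "c \<ge> 0" by (simp add: c_def)
  have "(real p - m - c) * (q / d) \<le> (real (card X') - c) * (q / d)"
    using cardX' q by (intro mult_right_mono) auto
  then have "c * q + (real p - m - c) * (q / d) \<le> real p + q * Bd"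
    using low unfolding q_def c_def by linarith
  then have "(c * q + (real p - m - c) * (q / d)) / q \<le> (real p + q * Bd) / q"
    using q by (intro divide_right_mono) auto
  then have "c + (real p - m - c) / d \<le> real p / q + Bd"
    using q by (simp add: add_divide_distrib)
  then have "c - c / d \<le> real p / q + m / d + 8 * (m * d) * sqrt p"
    by (simp add: Bd_def diff_divide_distrib)
  moreover have "c / d \<le> c / 2" using c0 d2 by (intro divide_left_mono) auto
  moreover have "m / d \<le> real m / 2" using d2 by (intro divide_left_mono) auto
  ultimately have "c \<le> 2 * (real p / q) + m + 2 * (8 * (m * d) * sqrt p)" by linarith
  then show ?thesis by (simp add: c_def q_def S_def X_def m_def mult_ac)
qed

text \<open>If \<open>p\<close> does not divide \<open>y ^ k = a * b + n\<close>, then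
  \<open>(y ^ k) ^ P = (y ^ (p - 1)) ^ (k div d)\<close> is 1 modulo \<open>p\<close>. So the
  residue of \<open>b\<close> has the full pattern, except for at most \<open>card A\<close>
  residues where some value vanishes. The hypothesis \<open>m\<close> turns
  \<open>p / d ^ card A\<close> into at most \<open>sqrt p\<close>.\<close>

lemma card_residues_le:
  fixes p d k :: nat and A B :: "nat set" and n :: int
  assumes p: "prime p" "[p = 1] (mod d)" and d: "prime d" "d dvd k" and k: "k > 0" and large: "p \<ge> 144 + 2 * d\<^sup>2"
    and A: "finite A" "A \<noteq> {}" and nd: "\<not> int p dvd n" and ad: "\<And>a. a \<in> A \<Longrightarrow> \<not> p dvd a"
    and dd: "\<And>a b. a \<in> A \<Longrightarrow> b \<in> A \<Longrightarrow> a \<noteq> b \<Longrightarrow> \<not> int p dvd int a - int b"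
    and pow: "\<And>a b. a \<in> A \<Longrightarrow> b \<in> B \<Longrightarrow> \<exists>x::nat. int a * int b + n = int x ^ k"
    and m: "sqrt p \<le> d ^ card A"
  shows "real (card ((\<lambda>b. b mod p) ` B)) \<le> 20 * d * card A * sqrt p"
proof -
  have d2: "d \<ge> 2" using prime_ge_2_nat[OF d(1)] .
  have "d dvd p - 1" using p(2) prime_gt_0_nat[OF p(1)] cong_altdef_nat[of p 1 d]
    by (simp add: cong_sym cong_altdef_nat)
  then obtain P where P: "p - 1 = d * P" by (auto elim: dvdE)
  have pP: "p = d * P + 1" using P prime_gt_0_nat[OF p(1)] by simp
  define S where "S = {x\<in>{0..<int p}. \<forall>a\<in>int ` A. [(a * x + n) ^ P = 1] (mod int p)}"
  define Z where "Z a = {x\<in>{0..<int p}. int p dvd int a * x + n}" for a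
  have cA: "card (int ` A) = card A" by (simp add: card_image)
  have finS: "finite S" unfolding S_def by (rule finite_subset[of _ "{0..<int p}"]) auto
  have finZ: "finite (Z a)" for a unfolding Z_def by (rule finite_subset[of _ "{0..<int p}"]) auto
  have sub: "int ` ((\<lambda>b. b mod p) ` B) \<subseteq> S \<union> (\<Union>a\<in>A. Z a)"
  proof
    fix x assume "x \<in> int ` ((\<lambda>b. b mod p) ` B)"
    then obtain b where b: "b \<in> B" "x = int (b mod p)" by auto
    have x: "x \<in> {0..<int p}" using b prime_gt_0_nat[OF p(1)] by simp
    have xb: "[x = int b] (mod int p)" by (simp add: b(2) Cong.cong_def zmod_int)
    show "x \<in> S \<union> (\<Union>a\<in>A. Z a)"
    proof (cases "\<exists>a\<in>A. int p dvd int a * x + n")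
      case True
      then show ?thesis using x by (auto simp: Z_def)
    next
      case False
      have "[(int a * x + n) ^ P = 1] (mod int p)" if a: "a \<in> A" for a
      proof -
        obtain y where y: "int a * int b + n = int y ^ k" using pow[OF a b(1)] by blast
        have "[int a * x + n = int a * int b + n] (mod int p)" by (intro cong_add cong_mult xb cong_refl)
        then have 1: "[int a * x + n = int y ^ k] (mod int p)" by (simp add: y)
        have "\<not> int p dvd int y"
        proof
          assume "int p dvd int y"
          then have "int p dvd int y ^ k" using k by (meson dvd_power dvd_trans)
          then show False using 1 False a cong_dvd_iff by blast
        qed
        then have "[int y ^ (p - 1) = 1] (mod int p)" by (rule fermat_int[OF p(1)])
        then have "[(int y ^ (p - 1)) ^ (k div d) = 1 ^ (k div d)] (mod int p)" by (rule cong_pow)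
        moreover have "(int y ^ (p - 1)) ^ (k div d) = (int y ^ k) ^ P"
        proof -
          have "(p - 1) * (k div d) = k * P" using P d(2) by (auto elim!: dvdE)
          then show ?thesis by (simp flip: power_mult)
        qed
        ultimately have "[(int y ^ k) ^ P = 1] (mod int p)" by simp
        then show ?thesis using cong_pow[OF 1, of P] cong_trans by blast
      qed
      then show ?thesis using x by (auto simp: S_def)
    qed
  qed
  have "card ((\<lambda>b. b mod p) ` B) = card (int ` ((\<lambda>b. b mod p) ` B))" by (simp add: card_image)
  also have "\<dots> \<le> card (S \<union> (\<Union>a\<in>A. Z a))" using sub finS finZ A by (intro card_mono) auto
  also have "\<dots> \<le> card S + card (\<Union>a\<in>A. Z a)" by (rule card_Un_le)
  also have "card (\<Union>a\<in>A. Z a) \<le> (\<Sum>a\<in>A. card (Z a))" using A by (intro card_UN_le)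
  also have "(\<Sum>a\<in>A. card (Z a)) \<le> (\<Sum>a\<in>A. 1)"
    unfolding Z_def using ad by (intro sum_mono card_residues_linear p) auto
  finally have "card ((\<lambda>b. b mod p) ` B) \<le> card S + card A" by simp
  then have 1: "real (card ((\<lambda>b. b mod p) ` B)) \<le> real (card S) + card A" by linarith
  have 2: "real (card S) \<le> 2 * p / d ^ card A + card A + 16 * d * card A * sqrt p"
    using card_residue_pattern[OF p(1) pP d(1) large, of "int ` A" n] A nd ad dd
    unfolding S_def cA by force
  define x where "x = sqrt (real p)"
  have x1: "x \<ge> 1" using prime_gt_0_nat[OF p(1)] by (simp add: x_def)
  have x0: "x > 0" using x1 by simp
  have "real p / d ^ card A \<le> real p / x"
    using m x0 d2 unfolding x_def by (intro divide_left_mono mult_pos_pos) auto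
  also have "\<dots> = x" by (simp add: x_def real_div_sqrt)
  finally have 3: "2 * p / d ^ card A \<le> 2 * x" by simp
  have A1: "card A \<ge> 1" using A by (simp add: Suc_le_eq card_gt_0_iff)
  have mx: "real (card A) \<le> card A * x" using x1 mult_left_mono[of 1 x "real (card A)"] by simp
  have xm: "x \<le> card A * x" using x0 A1 mult_right_mono[of 1 "real (card A)" x] by simp
  have dmx: "2 * (card A * x) \<le> d * (card A * x)" using d2 x0 by (intro mult_right_mono) auto
  have "16 * d * card A * sqrt p = 16 * (d * (card A * x))" "20 * d * card A * sqrt p = 20 * (d * (card A * x))"
    by (simp_all add: x_def)
  then show ?thesis using 1 2 3 mx xm dmx by linarith
qed

section \<open>Gallagher's larger sieve\<close>

lemma sum_ln_primes_dividing_le: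
  fixes N :: nat
  assumes "finite Q" "\<And>p. p \<in> Q \<Longrightarrow> prime p \<and> p dvd N" "N > 0"
  shows "(\<Sum>p\<in>Q. ln (real p)) \<le> ln (real N)"
proof -
  have "\<Prod>Q dvd N" using assms(1,2)
  proof (induction Q rule: finite_induct)
    case (insert p Q)
    have "coprime p (\<Prod>Q)"
      using insert by (intro prod_coprime_right) (metis insertCI primes_coprime)
    then show ?case using insert by (simp add: divides_mult)
  qed simp
  then have "\<Prod>Q \<le> N" using assms(3) by (rule dvd_imp_le)
  moreover have "\<Prod>Q > 0" using assms(2) by (intro prod_pos) (auto simp: prime_gt_0_nat)
  ultimately have "ln (real (\<Prod>Q)) \<le> ln (real N)" using assms(3)
    by (subst ln_le_cancel_iff) (simp_all only: of_nat_0_less_iff of_nat_le_iff)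
  moreover have "ln (real (\<Prod>Q)) = (\<Sum>p\<in>Q. ln (real p))"
    unfolding of_nat_prod using assms(1,2) by (subst ln_prod) (auto simp: prime_gt_0_nat)
  ultimately show ?thesis by simp
qed

text \<open>Cauchy-Schwarz for the sizes of the residue classes that \<open>B\<close>
  occupies.\<close>

lemma card_congruent_pairs_ge:
  fixes B :: "nat set"
  assumes B: "finite B"
  shows "(real (card B))\<^sup>2 \<le> card ((\<lambda>b. b mod p) ` B) * real (card {(b, c)\<in>B \<times> B. b mod p = c mod p})"
proof -
  define R where "R = (\<lambda>b. b mod p) ` B"
  define F where "F r = {b\<in>B. b mod p = r}" for r
  have finR: "finite R" and finF: "finite (F r)" for r using B by (auto simp: R_def F_def)
  have "card B = card (\<Union>r\<in>R. F r)" by (rule arg_cong[of _ _ card]) (auto simp: R_def F_def)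
  also have "\<dots> = (\<Sum>r\<in>R. card (F r))"
    using finR finF by (intro card_UN_disjoint) (auto simp: F_def)
  finally have cB: "real (card B) = (\<Sum>r\<in>R. real (card (F r)))" by simp
  have "{(b, c)\<in>B \<times> B. b mod p = c mod p} = (\<Union>r\<in>R. F r \<times> F r)" by (auto simp: R_def F_def)
  moreover have "card (\<Union>r\<in>R. F r \<times> F r) = (\<Sum>r\<in>R. card (F r \<times> F r))"
    using finR finF B by (intro card_UN_disjoint) (auto simp: F_def)
  ultimately have cP: "real (card {(b, c)\<in>B \<times> B. b mod p = c mod p}) = (\<Sum>r\<in>R. (real (card (F r)))\<^sup>2)"
    by (simp add: card_cartesian_product power2_eq_square)
  have "(\<Sum>r\<in>R. real (card (F r)))\<^sup>2 \<le> card R * (\<Sum>r\<in>R. (real (card (F r)))\<^sup>2)"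
  proof -
    define s where "s = (\<Sum>r\<in>R. real (card (F r)))"
    define t where "t = (\<Sum>r\<in>R. (real (card (F r)))\<^sup>2)"
    have "0 \<le> (\<Sum>r\<in>R. (card R * real (card (F r)) - s)\<^sup>2)" by (intro sum_nonneg) auto
    also have "\<dots> = (\<Sum>r\<in>R. (real (card R))\<^sup>2 * (real (card (F r)))\<^sup>2 - 2 * card R * s * card (F r) + s\<^sup>2)"
      by (intro sum.cong refl) (simp add: power2_eq_square algebra_simps)
    also have "\<dots> = (real (card R))\<^sup>2 * t - 2 * card R * s * s + card R * s\<^sup>2"
      by (simp add: sum.distrib sum_subtractf sum_distrib_left[symmetric] s_def t_def)
    also have "\<dots> = card R * (card R * t - s\<^sup>2)" by (simp add: power2_eq_square algebra_simps)
    finally have "card R = 0 \<or> s\<^sup>2 \<le> card R * t" by (auto simp: zero_le_mult_iff)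
    moreover have "s = 0" if "card R = 0" using that finR by (simp add: s_def)
    ultimately show ?thesis unfolding s_def[symmetric] t_def[symmetric] by auto
  qed
  then show ?thesis unfolding cB cP R_def .
qed

text \<open>The coincidences \<open>b mod p = c mod p\<close> are counted with weight
  \<open>ln p\<close>. Each \<open>p\<close> has at least \<open>Z\<^sup>2 / V\<close> of them. A
  pair with \<open>b \<noteq> c\<close> has total weight at most \<open>ln X\<close>, as the product
  of its primes divides \<open>b - c\<close>; a pair with \<open>b = c\<close> has the whole weight
  \<open>\<Theta>\<close>. By \<open>large\<close>, the unequal pairs make up at most half of the
  left-hand side.\<close>

lemma larger_sieve:
  fixes B :: "nat set" and Q :: "nat set"
  assumes B: "finite B" "\<And>b. b \<in> B \<Longrightarrow> 0 < b \<and> b \<le> X" and X: "X \<ge> 2" and Q: "finite Q" "\<And>p. p \<in> Q \<Longrightarrow> prime p"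
    and V: "V > 0" "\<And>p. p \<in> Q \<Longrightarrow> real (card ((\<lambda>b. b mod p) ` B)) \<le> V"
    and large: "(\<Sum>p\<in>Q. ln (real p)) \<ge> 2 * V * ln (real X)"
  shows "real (card B) \<le> 2 * V"
proof (rule ccontr)
  assume "\<not> ?thesis"
  then have big: "real (card B) > 2 * V" by simp
  define \<Theta> where "\<Theta> = (\<Sum>p\<in>Q. ln (real p))"
  define Z where "Z = real (card B)"
  define N where "N p = real (card {(b, c)\<in>B \<times> B. b mod p = c mod p})" for p
  have lnX: "ln (real X) > 0" using X by simp
  have \<Theta>: "\<Theta> > 0" using large V(1) lnX unfolding \<Theta>_def by (smt (verit) mult_pos_pos)
  have lower: "Z\<^sup>2 / V \<le> N p" if "p \<in> Q" for p
  proof -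
    have "Z\<^sup>2 \<le> card ((\<lambda>b. b mod p) ` B) * N p" unfolding Z_def N_def by (rule card_congruent_pairs_ge[OF B(1)])
    also have "\<dots> \<le> V * N p" using V(2)[OF that] by (intro mult_right_mono) (auto simp: N_def)
    finally show ?thesis using V(1) by (simp add: pos_divide_le_eq mult.commute)
  qed
  have lnp: "ln (real p) \<ge> 0" if "p \<in> Q" for p using prime_ge_1_nat[OF Q(2)[OF that]] by simp
  have "\<Theta> * (Z\<^sup>2 / V) = (\<Sum>p\<in>Q. ln (real p) * (Z\<^sup>2 / V))" by (simp only: \<Theta>_def sum_distrib_right)
  also have "\<dots> \<le> (\<Sum>p\<in>Q. ln (real p) * N p)" using lower lnp by (intro sum_mono mult_left_mono) auto
  also have "\<dots> = (\<Sum>p\<in>Q. \<Sum>(b, c)\<in>B \<times> B. if b mod p = c mod p then ln (real p) else 0)"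
  proof (rule sum.cong)
    fix p
    have "{(b, c)\<in>B \<times> B. b mod p = c mod p} = {x\<in>B \<times> B. fst x mod p = snd x mod p}" by auto
    then have "ln (real p) * N p = (\<Sum>x\<in>{x\<in>B \<times> B. fst x mod p = snd x mod p}. ln (real p))"
      by (simp add: N_def)
    also have "\<dots> = (\<Sum>x\<in>B \<times> B. if fst x mod p = snd x mod p then ln (real p) else 0)"
      using B(1) by (intro sum.inter_filter) auto
    finally show "ln (real p) * N p = (\<Sum>(b, c)\<in>B \<times> B. if b mod p = c mod p then ln (real p) else 0)"
      by (simp add: case_prod_beta)
  qed simp
  also have "\<dots> = (\<Sum>(b, c)\<in>B \<times> B. \<Sum>p\<in>Q. if b mod p = c mod p then ln (real p) else 0)"
    unfolding case_prod_beta by (rule sum.swap)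
  also have "\<dots> \<le> (\<Sum>(b, c)\<in>B \<times> B. (if b = c then \<Theta> else 0) + ln (real X))"
  proof (rule sum_mono, clarify)
    fix b c assume bc: "b \<in> B" "c \<in> B"
    show "(\<Sum>p\<in>Q. if b mod p = c mod p then ln (real p) else 0) \<le> (if b = c then \<Theta> else 0) + ln (real X)"
    proof (cases "b = c")
      case True
      then show ?thesis using lnX by (simp add: \<Theta>_def)
    next
      case False
      define D where "D = nat \<bar>int b - int c\<bar>"
      have D: "D > 0" "D \<le> X" using False B(2)[OF bc(1)] B(2)[OF bc(2)] unfolding D_def by auto
      have "(\<Sum>p\<in>Q. if b mod p = c mod p then ln (real p) else 0) = (\<Sum>p\<in>{p\<in>Q. b mod p = c mod p}. ln (real p))"
        using Q(1) by (simp add: sum.inter_filter)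
      also have "\<dots> \<le> ln (real D)"
      proof (rule sum_ln_primes_dividing_le)
        fix p assume p: "p \<in> {p\<in>Q. b mod p = c mod p}"
        then have "int b mod int p = int c mod int p" by (simp flip: zmod_int)
        then have "int p dvd int b - int c" by (simp add: mod_eq_dvd_iff)
        then show "prime p \<and> p dvd D" using p Q(2) by (simp add: D_def flip: int_dvd_int_iff)
      qed (use Q D in auto)
      also have "\<dots> \<le> ln (real X)" using D by simp
      finally show ?thesis using False by simp
    qed
  qed
  also have "\<dots> = Z * \<Theta> + Z\<^sup>2 * ln (real X)"
  proof -
    have "(\<Sum>(b, c)\<in>B \<times> B. if b = c then \<Theta> else 0) = (\<Sum>b\<in>B. \<Sum>c\<in>B. if b = c then \<Theta> else 0)"
      by (simp add: sum.cartesian_product)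
    also have "\<dots> = Z * \<Theta>" using B(1) by (simp add: Z_def)
    finally show ?thesis
      by (simp add: case_prod_beta sum.distrib card_cartesian_product Z_def power2_eq_square)
  qed
  finally have main: "\<Theta> * (Z\<^sup>2 / V) \<le> Z * \<Theta> + Z\<^sup>2 * ln (real X)" .
  have Z0: "Z > 0" using big V(1) by (simp add: Z_def)
  have "ln (real X) \<le> \<Theta> / (2 * V)" using large V(1) by (simp add: \<Theta>_def pos_le_divide_eq mult_ac)
  then have "Z\<^sup>2 * ln (real X) \<le> Z\<^sup>2 * (\<Theta> / (2 * V))" by (intro mult_left_mono) auto
  then have "\<Theta> * (Z\<^sup>2 / V) \<le> Z * \<Theta> + Z\<^sup>2 * (\<Theta> / (2 * V))" using main by linarith
  then have "Z * \<Theta> * (Z / (2 * V)) \<le> Z * \<Theta> * 1" using V(1) by (simp add: power2_eq_square field_simps)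
  then have "Z / (2 * V) \<le> 1" using Z0 \<Theta> by (subst (asm) mult_le_cancel_left_pos) auto
  then show False using big V(1) by (simp add: Z_def)
qed

section \<open>Diagonal Pade approximants of a binomial power\<close>

text \<open>Only multiples of \<open>p\<close> count, so the multiplicity is \<open>q\<close> plus
  that in \<open>q!\<close> for \<open>q = n div p\<close>, and \<open>2 * q \<le> n\<close>. A
  bound linear in \<open>n\<close> is what powers of \<open>k\<close> can absorb.\<close>

lemma multiplicity_fact_le:
  fixes p n :: nat
  assumes p: "prime p"
  shows "multiplicity p (fact n) \<le> n"
proof (induction n rule: less_induct)
  case (less n)
  have p2: "p \<ge> 2" using prime_ge_2_nat[OF p] .
  have pe: "prime_elem p" using p by simp
  have mf: "multiplicity p (fact n) = (\<Sum>j=1..n. multiplicity p j)" for n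
    unfolding fact_prod of_nat_id by (subst prime_elem_multiplicity_prod_distrib[OF pe]) auto
  show ?case
  proof (cases "n = 0")
    case False
    define q where "q = n div p"
    have "(\<Sum>j=1..n. multiplicity p j) = (\<Sum>j\<in>{j\<in>{1..n}. p dvd j}. multiplicity p j)"
      by (rule sum.mono_neutral_right) (auto simp: not_dvd_imp_multiplicity_0)
    also have "\<dots> = (\<Sum>i=1..q. multiplicity p (p * i))"
      by (rule sum.reindex_bij_witness[of _ "\<lambda>i. p * i" "\<lambda>j. j div p"])
        (use p2 in \<open>auto simp: q_def div_le_mono Suc_le_eq less_eq_div_iff_mult_less_eq mult.commute dest!: dvd_imp_le intro: Nat.gr0I elim!: dvdE\<close>)
    also have "\<dots> = (\<Sum>i=1..q. Suc (multiplicity p i))"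
      by (intro sum.cong refl multiplicity_times_same) (use p in auto)
    also have "\<dots> = q + multiplicity p (fact q)" by (simp add: mf sum_Suc)
    also have "\<dots> \<le> q + q"
      using less[of q] False p2 by (simp add: q_def)
    also have "\<dots> \<le> n"
    proof -
      have "2 * q \<le> p * q" using p2 by simp
      also have "\<dots> \<le> n" by (simp add: q_def)
      finally show ?thesis by simp
    qed
    finally show ?thesis by (simp add: mf)
  qed simp
qed

text \<open>Integrality of \<open>k ^ (2 * m) * pochhammer (a / k) m / m!\<close>: the primes dividing \<open>k\<close> are
  absorbed by the power of \<open>k\<close>, and \<open>k\<close> is invertible modulo powers of the others.\<close>
lemma fact_dvd_arithmetic_progression:
  fixes a k m :: nat
  assumes k: "k > 0" and a: "a > 0"
  shows "fact m dvd k ^ m * (\<Prod>s<m. a + k * s)"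
proof (rule multiplicity_le_imp_dvd)
  have nz: "(\<Prod>s<m. a + k * s) \<noteq> 0" using a by simp
  fix p :: nat assume p: "prime p"
  define e where "e = multiplicity p (fact m :: nat)"
  have pe: "p ^ e dvd fact m" unfolding e_def by (rule multiplicity_dvd)
  have "p ^ e dvd k ^ m * (\<Prod>s<m. a + k * s)"
  proof (cases "p dvd k")
    case True
    have "p ^ e dvd p ^ m" unfolding e_def by (intro le_imp_power_dvd multiplicity_fact_le p)
    also have "\<dots> dvd k ^ m" using True by (rule dvd_power_same)
    finally show ?thesis by simp
  next
    case False
    then have "coprime k (p ^ e)" using p by (metis coprime_commute coprime_power_right_iff prime_imp_coprime)
    from cong_solve_coprime_nat[OF this] obtain k' where k': "[k * k' = 1] (mod p ^ e)" by auto
    have cop: "coprime (k' ^ m) (p ^ e)"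
      using k' by (metis coprime_mult_left_iff coprime_power_left_iff cong_imp_coprime cong_sym coprime_1_left)
    have "k' ^ m * (\<Prod>s<m. a + k * s) = (\<Prod>s<m. k' * a + (k * k') * s)"
    proof -
      have "(\<Prod>s<m. k' * a + (k * k') * s) = (\<Prod>s<m. k' * (a + k * s))"
        by (intro prod.cong) (auto simp: algebra_simps)
      then show ?thesis by (simp add: prod.distrib)
    qed
    also have "[\<dots> = (\<Prod>s<m. k' * a + 1 * s)] (mod p ^ e)"
      by (intro cong_prod cong_add cong_mult k' cong_refl)
    also have "(\<Prod>s<m. k' * a + 1 * s) = pochhammer (k' * a) m"
      by (simp add: pochhammer_prod atLeast0LessThan)
    finally have c: "[k' ^ m * (\<Prod>s<m. a + k * s) = pochhammer (k' * a) m] (mod p ^ e)" .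
    have "fact m dvd pochhammer (int (k' * a)) m" by (rule fact_dvd_pochhammer)
    then have "int (fact m) dvd int (pochhammer (k' * a) m)" by (simp only: pochhammer_of_nat of_nat_fact)
    then have "fact m dvd pochhammer (k' * a) m" by (simp only: int_dvd_int_iff)
    then have "p ^ e dvd pochhammer (k' * a) m" using pe dvd_trans by blast
    then have "p ^ e dvd k' ^ m * (\<Prod>s<m. a + k * s)" using c cong_dvd_iff by blast
    then have "p ^ e dvd (\<Prod>s<m. a + k * s)"
      using cop by (simp add: coprime_dvd_mult_right_iff coprime_commute)
    then show ?thesis by simp
  qed
  then show "multiplicity p (fact m) \<le> multiplicity p (k ^ m * (\<Prod>s<m. a + k * s))"
    using nz k p unfolding e_def[symmetric] by (intro multiplicity_geI) auto
qed simp

lemma pochhammer_scaled_integral: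
  fixes a k m :: nat
  assumes "k > 0" "a > 0"
  obtains N :: nat where "real k ^ (2 * m) * pochhammer (real a / real k) m / fact m = real N"
proof -
  obtain N where N: "k ^ m * (\<Prod>s<m. a + k * s) = fact m * N"
    using fact_dvd_arithmetic_progression[OF assms, of m] by (auto elim: dvdE)
  have "real k ^ m * pochhammer (real a / real k) m = (\<Prod>s<m. real k * (real a / real k + real s))"
    by (simp add: pochhammer_prod atLeast0LessThan prod.distrib)
  also have "\<dots> = real (\<Prod>s<m. a + k * s)"
    unfolding of_nat_prod using assms(1) by (intro prod.cong) (auto simp: algebra_simps)
  finally have "real k ^ (2 * m) * pochhammer (real a / real k) m = real (k ^ m * (\<Prod>s<m. a + k * s))"
    by (simp add: mult_2 power_add)
  also have "\<dots> = fact m * real N" unfolding N by simp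
  finally show ?thesis by (intro that[of N]) simp
qed

text \<open>This is the partial fraction decomposition of the right-hand side. Pascal's rule writes
  the sum for \<open>r + 1\<close> as the difference of the sums for \<open>r\<close> at
  \<open>x\<close> and at \<open>x + 1\<close>.\<close>

lemma alternating_binomial_reciprocal_sum:
  fixes x :: real
  assumes "\<And>j. j \<le> r \<Longrightarrow> x + real j \<noteq> 0"
  shows "(\<Sum>j\<le>r. (-1) ^ j * real (r choose j) / (x + real j)) = fact r / pochhammer x (Suc r)"
  using assms
proof (induction r arbitrary: x)
  case (Suc r)
  define S where "S r x = (\<Sum>j\<le>r. (-1) ^ j * real (r choose j) / (x + real j))" for r :: nat and x :: real
  have "S (Suc r) x = 1 / x + (\<Sum>j\<le>r. (-1) ^ Suc j * real (Suc r choose Suc j) / (x + real (Suc j)))"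
    unfolding S_def by (subst sum.atMost_Suc_shift) simp
  also have "(\<Sum>j\<le>r. (-1) ^ Suc j * real (Suc r choose Suc j) / (x + real (Suc j)))
      = (\<Sum>j\<le>r. (-1) ^ Suc j * real (r choose Suc j) / (x + real (Suc j))) - S r (x + 1)"
    unfolding S_def sum_subtractf[symmetric]
    by (intro sum.cong refl) (simp add: algebra_simps add_divide_distrib diff_divide_distrib)
  also have "1 / x + ((\<Sum>j\<le>r. (-1) ^ Suc j * real (r choose Suc j) / (x + real (Suc j))) - S r (x + 1))
      = (\<Sum>j\<le>Suc r. (-1) ^ j * real (r choose j) / (x + real j)) - S r (x + 1)"
    by (subst sum.atMost_Suc_shift) simp
  also have "(\<Sum>j\<le>Suc r. (-1) ^ j * real (r choose j) / (x + real j)) = S r x"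
    by (simp add: S_def binomial_eq_0)
  finally have "S (Suc r) x = S r x - S r (x + 1)" .
  also have "S r x = fact r / pochhammer x (Suc r)"
    unfolding S_def using Suc.prems by (intro Suc.IH) (simp add: le_SucI)
  also have "S r (x + 1) = fact r / pochhammer (x + 1) (Suc r)"
    unfolding S_def
  proof (rule Suc.IH)
    fix j assume "j \<le> r"
    then show "x + 1 + real j \<noteq> 0" using Suc.prems[of "Suc j"] by (simp add: algebra_simps)
  qed
  finally have eq: "S (Suc r) x = fact r / pochhammer x (Suc r) - fact r / pochhammer (x + 1) (Suc r)" .
  define q where "q = pochhammer x (Suc (Suc r))"
  have q1: "q = pochhammer x (Suc r) * (x + real (Suc r))" unfolding q_def by (rule pochhammer_Suc)
  have q2: "q = x * pochhammer (x + 1) (Suc r)" unfolding q_def by (rule pochhammer_rec)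
  have x0: "x \<noteq> 0" "x + real (Suc r) \<noteq> 0" using Suc.prems[of 0] Suc.prems[of "Suc r"] by auto
  have "q \<noteq> 0" unfolding q_def
    using Suc.prems by (auto simp: pochhammer_eq_0_iff) (metis add.commute le_Suc_eq less_Suc_eq_le add.right_inverse)
  have "fact r / pochhammer x (Suc r) = fact r * (x + real (Suc r)) / q"
    using x0 unfolding q1 by simp
  moreover have "fact r / pochhammer (x + 1) (Suc r) = fact r * x / q"
    using x0 unfolding q2 by simp
  ultimately have "S (Suc r) x = fact r * real (Suc r) / q"
    unfolding eq by (simp add: diff_divide_distrib[symmetric] algebra_simps)
  then show ?case unfolding S_def q_def by (simp add: algebra_simps)
qed simp

definition pade_coeff :: "real \<Rightarrow> nat \<Rightarrow> nat \<Rightarrow> real" where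
  "pade_coeff v r i = real (r choose i) * fact r / (pochhammer v (Suc i) * pochhammer (1 - v) (r - i))"

definition pade_denom :: "real \<Rightarrow> nat \<Rightarrow> real \<Rightarrow> real" where
  "pade_denom v r w = (\<Sum>i\<le>r. pade_coeff v r i * w ^ i)"

definition pade_numer :: "real \<Rightarrow> nat \<Rightarrow> real \<Rightarrow> real" where
  "pade_numer v r w = (\<Sum>i\<le>r. pade_coeff v r i * w ^ (r - i))"

text \<open>An explicit antiderivative in \<open>t\<close> of
  \<open>t ^ r * (z - t) ^ r * (1 + t) powr (v - r - 1)\<close>, whose integral from 0 to
  \<open>z\<close> is the Pade remainder. It arises from expanding \<open>t = (1 + t) - 1\<close>
  and \<open>z - t = (1 + z) - (1 + t)\<close> by the binomial theorem.\<close>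

definition pade_primitive :: "real \<Rightarrow> nat \<Rightarrow> real \<Rightarrow> real \<Rightarrow> real" where
  "pade_primitive v r z t = (\<Sum>i\<le>r. \<Sum>j\<le>r. (-1) ^ (r - i) * (-1) ^ j * real (r choose i) * real (r choose j)
     * (1 + z) ^ (r - j) * (1 + t) powr (v - real r + real i + real j) / (v - real r + real i + real j))"

text \<open>As \<open>v\<close> is not an integer, integrating the powers of \<open>1 + t\<close>
  never produces a logarithm.\<close>

lemma pade_exponent_nonzero:
  fixes v :: real
  assumes "0 < v" "v < 1"
  shows "v - real r + real i + real j \<noteq> 0"
proof
  assume "v - real r + real i + real j = 0"
  then have "v = of_int (int r - int i - int j)" by simp
  then obtain N :: int where N: "v = of_int N" by blast
  then have "0 < N" "N < 1" using assms by auto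
  then show False by simp
qed

lemma alternating_sum_pade_coeff:
  fixes v :: real
  assumes v: "0 < v" "v < 1" and i: "i \<le> r"
  shows "real (r choose i) * (\<Sum>j\<le>r. (-1) ^ j * real (r choose j) / (v - real r + real i + real j))
    = (-1) ^ (r - i) * pade_coeff v r i"
proof -
  define m where "m = r - i"
  have r: "Suc r = m + Suc i" using i by (simp add: m_def)
  have x: "v - real r + real i = v - real m" using i by (simp add: m_def of_nat_diff)
  have "pochhammer (v - real m) (Suc r) = pochhammer (v - real m) m * pochhammer v (Suc i)"
    unfolding r pochhammer_product' by simp
  also have "pochhammer (v - real m) m = (-1) ^ m * pochhammer (1 - v) m"
    using pochhammer_minus[of "real m - v" m] by (simp add: algebra_simps)
  finally have p: "pochhammer (v - real r + real i) (Suc r) = (-1) ^ m * (pochhammer v (Suc i) * pochhammer (1 - v) m)"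
    by (simp add: x)
  have "(\<Sum>j\<le>r. (-1) ^ j * real (r choose j) / (v - real r + real i + real j)) = fact r / pochhammer (v - real r + real i) (Suc r)"
    by (rule alternating_binomial_reciprocal_sum) (rule pade_exponent_nonzero[OF v])
  also have "\<dots> = (-1) ^ m * (fact r / (pochhammer v (Suc i) * pochhammer (1 - v) m))"
    unfolding p by (cases "even m") auto
  finally show ?thesis by (simp add: pade_coeff_def m_def)
qed

text \<open>At \<open>t = z\<close> the power of \<open>1 + z\<close> in a term depends on
  \<open>i\<close> only, at \<open>t = 0\<close> on \<open>j\<close> only. The sum over the other
  index is a partial fraction sum, and by symmetry both cases produce the same coefficients, once
  with \<open>w ^ i\<close> and once with \<open>w ^ (r - i)\<close>.\<close>

lemma pade_remainder_eq:
  fixes v z :: real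
  assumes v: "0 < v" "v < 1" and z: "z > 0"
  shows "(1 + z) powr v * pade_denom v r (1 + z) - pade_numer v r (1 + z)
    = pade_primitive v r z z - pade_primitive v r z 0"
proof -
  define a where "a i j = (-1) ^ j * real (r choose j) / (v - real r + real i + real j)" for i j
  have "pade_primitive v r z z = (\<Sum>i\<le>r. \<Sum>j\<le>r. (-1) ^ (r - i) * real (r choose i) * (1 + z) powr v * (1 + z) ^ i * a i j)"
    unfolding pade_primitive_def
  proof (intro sum.cong refl)
    fix i j assume ij: "i \<in> {..r}" "j \<in> {..r}"
    have "(1 + z) ^ (r - j) * (1 + z) powr (v - real r + real i + real j)
        = (1 + z) powr (real (r - j) + (v - real r + real i + real j))"
      unfolding powr_add using z by (simp add: powr_realpow)
    also have "real (r - j) + (v - real r + real i + real j) = v + real i" using ij by (simp add: of_nat_diff)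
    also have "(1 + z) powr (v + real i) = (1 + z) powr v * (1 + z) ^ i"
      unfolding powr_add using z by (simp add: powr_realpow)
    finally have e: "(1 + z) ^ (r - j) * (1 + z) powr (v - real r + real i + real j) = (1 + z) powr v * (1 + z) ^ i" .
    have "(-1) ^ (r - i) * (-1) ^ j * real (r choose i) * real (r choose j) * (1 + z) ^ (r - j)
          * (1 + z) powr (v - real r + real i + real j) / (v - real r + real i + real j)
        = (-1) ^ (r - i) * real (r choose i) * ((1 + z) ^ (r - j) * (1 + z) powr (v - real r + real i + real j)) * a i j"
      by (simp add: a_def mult_ac)
    then show "(-1) ^ (r - i) * (-1) ^ j * real (r choose i) * real (r choose j) * (1 + z) ^ (r - j)
          * (1 + z) powr (v - real r + real i + real j) / (v - real r + real i + real j)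
        = (-1) ^ (r - i) * real (r choose i) * (1 + z) powr v * (1 + z) ^ i * a i j"
      unfolding e by (simp add: mult_ac)
  qed
  also have "\<dots> = (\<Sum>i\<le>r. (-1) ^ (r - i) * (1 + z) powr v * (1 + z) ^ i * (real (r choose i) * (\<Sum>j\<le>r. a i j)))"
    by (simp add: sum_distrib_left mult_ac)
  also have "\<dots> = (\<Sum>i\<le>r. (1 + z) powr v * (pade_coeff v r i * (1 + z) ^ i))"
  proof (intro sum.cong refl)
    fix i assume "i \<in> {..r}"
    then have "real (r choose i) * (\<Sum>j\<le>r. a i j) = (-1) ^ (r - i) * pade_coeff v r i"
      unfolding a_def using alternating_sum_pade_coeff[OF v] by simp
    then show "(-1) ^ (r - i) * (1 + z) powr v * (1 + z) ^ i * (real (r choose i) * (\<Sum>j\<le>r. a i j))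
        = (1 + z) powr v * (pade_coeff v r i * (1 + z) ^ i)"
      by (cases "even (r - i)") auto
  qed
  finally have 1: "pade_primitive v r z z = (1 + z) powr v * pade_denom v r (1 + z)"
    by (simp add: pade_denom_def sum_distrib_left)
  have "pade_primitive v r z 0 = (\<Sum>i\<le>r. \<Sum>j\<le>r. (-1) ^ (r - i) * (-1) ^ j * real (r choose i) * real (r choose j)
     * (1 + z) ^ (r - j) / (v - real r + real i + real j))"
    unfolding pade_primitive_def by simp
  also have "\<dots> = (\<Sum>j\<le>r. \<Sum>i\<le>r. (-1) ^ (r - i) * (-1) ^ j * real (r choose i) * real (r choose j)
     * (1 + z) ^ (r - j) / (v - real r + real i + real j))" by (rule sum.swap)
  also have "\<dots> = (\<Sum>j\<le>r. (-1) ^ (r - j) * (1 + z) ^ (r - j) * (real (r choose j) * (\<Sum>i\<le>r. a j i)))"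
  proof (intro sum.cong refl)
    fix j assume j: "j \<in> {..r}"
    have "(-1) ^ (r - i) * (-1) ^ j * real (r choose i) * real (r choose j) * (1 + z) ^ (r - j) / (v - real r + real i + real j)
        = (-1) ^ (r - j) * (1 + z) ^ (r - j) * (real (r choose j) * a j i)" if "i \<le> r" for i
    proof -
      have "even (r - i + j) \<longleftrightarrow> even (r - j + i)" using that j by simp presburger
      then have "(-1::real) ^ (r - i) * (-1) ^ j = (-1) ^ (r - j) * (-1) ^ i"
        unfolding power_add[symmetric] by (simp add: minus_one_power_iff)
      then have "(-1) ^ (r - i) * (-1) ^ j * real (r choose i) * real (r choose j) * (1 + z) ^ (r - j) / (v - real r + real i + real j)
        = (-1) ^ (r - j) * (-1) ^ i * real (r choose i) * real (r choose j) * (1 + z) ^ (r - j) / (v - real r + real i + real j)"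
        by simp
      also have "\<dots> = (-1) ^ (r - j) * (1 + z) ^ (r - j) * (real (r choose j) * a j i)"
        unfolding a_def by (simp add: mult_ac)
      finally show ?thesis .
    qed
    then show "(\<Sum>i\<le>r. (-1) ^ (r - i) * (-1) ^ j * real (r choose i) * real (r choose j) * (1 + z) ^ (r - j) / (v - real r + real i + real j))
        = (-1) ^ (r - j) * (1 + z) ^ (r - j) * (real (r choose j) * (\<Sum>i\<le>r. a j i))"
      unfolding sum_distrib_left by (intro sum.cong refl) auto
  qed
  also have "\<dots> = pade_numer v r (1 + z)"
    unfolding pade_numer_def
  proof (intro sum.cong refl)
    fix j assume "j \<in> {..r}"
    then have "real (r choose j) * (\<Sum>i\<le>r. a j i) = (-1) ^ (r - j) * pade_coeff v r j"
      unfolding a_def using alternating_sum_pade_coeff[OF v] by simp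
    then show "(-1) ^ (r - j) * (1 + z) ^ (r - j) * (real (r choose j) * (\<Sum>i\<le>r. a j i)) = pade_coeff v r j * (1 + z) ^ (r - j)"
      by (cases "even (r - j)") auto
  qed
  finally show ?thesis using 1 by simp
qed

lemma pade_primitive_deriv:
  fixes v z t :: real
  assumes v: "0 < v" "v < 1" and t: "t \<ge> 0"
  shows "(pade_primitive v r z has_real_derivative t ^ r * (z - t) ^ r * (1 + t) powr (v - real r - 1)) (at t)"
proof -
  have "(pade_primitive v r z has_real_derivative
     (\<Sum>i\<le>r. \<Sum>j\<le>r. (-1) ^ (r - i) * (-1) ^ j * real (r choose i) * real (r choose j)
     * (1 + z) ^ (r - j) * (1 + t) powr (v - real r + real i + real j - 1))) (at t)"
    unfolding pade_primitive_def
  proof (intro DERIV_sum)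
    fix i j
    define q where "q = v - real r + real i + real j"
    define C where "C = (-1) ^ (r - i) * (-1) ^ j * real (r choose i) * real (r choose j) * (1 + z) ^ (r - j)"
    have q: "q \<noteq> 0" unfolding q_def by (rule pade_exponent_nonzero[OF v])
    have "((\<lambda>t. (1 + t) powr q) has_real_derivative q * (1 + t) powr (q - 1) * 1) (at t)"
      using t by (intro DERIV_chain2[OF has_real_derivative_powr]) (auto intro!: derivative_eq_intros)
    then have "((\<lambda>t. C * (1 + t) powr q / q) has_real_derivative C * (q * (1 + t) powr (q - 1) * 1) / q) (at t)"
      by (intro DERIV_cdivide DERIV_cmult)
    moreover have "C * (q * (1 + t) powr (q - 1) * 1) / q = C * (1 + t) powr (q - 1)" using q by simp
    ultimately have "((\<lambda>t. C * (1 + t) powr q / q) has_real_derivative C * (1 + t) powr (q - 1)) (at t)" by simp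
    then show "((\<lambda>t. (-1) ^ (r - i) * (-1) ^ j * real (r choose i) * real (r choose j)
     * (1 + z) ^ (r - j) * (1 + t) powr (v - real r + real i + real j) / (v - real r + real i + real j)) has_real_derivative
       (-1) ^ (r - i) * (-1) ^ j * real (r choose i) * real (r choose j)
     * (1 + z) ^ (r - j) * (1 + t) powr (v - real r + real i + real j - 1)) (at t)"
      unfolding C_def q_def .
  qed
  also have "(\<Sum>i\<le>r. \<Sum>j\<le>r. (-1) ^ (r - i) * (-1) ^ j * real (r choose i) * real (r choose j)
     * (1 + z) ^ (r - j) * (1 + t) powr (v - real r + real i + real j - 1))
    = (\<Sum>i\<le>r. \<Sum>j\<le>r. (1 + t) powr (v - real r - 1) * ((real (r choose i) * (1 + t) ^ i * (-1) ^ (r - i))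
       * (real (r choose j) * (- (1 + t)) ^ j * (1 + z) ^ (r - j))))"
  proof (intro sum.cong refl)
    fix i j
    have "(1 + t) powr (v - real r + real i + real j - 1) = (1 + t) powr ((v - real r - 1) + real (i + j))"
      by (simp add: algebra_simps)
    also have "\<dots> = (1 + t) powr (v - real r - 1) * ((1 + t) ^ i * (1 + t) ^ j)"
    proof -
      have "(1 + t) powr real (i + j) = (1 + t) ^ (i + j)" using t by (intro powr_realpow) auto
      then show ?thesis unfolding powr_add[of _ _ "real (i + j)"] by (simp only: power_add)
    qed
    finally have e: "(1 + t) powr (v - real r + real i + real j - 1) = \<dots>" .
    have e2: "(- (1 + t)) ^ j = (-1) ^ j * (1 + t) ^ j" by (rule power_minus)
    show "(-1) ^ (r - i) * (-1) ^ j * real (r choose i) * real (r choose j)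
     * (1 + z) ^ (r - j) * (1 + t) powr (v - real r + real i + real j - 1)
    = (1 + t) powr (v - real r - 1) * ((real (r choose i) * (1 + t) ^ i * (-1) ^ (r - i))
       * (real (r choose j) * (- (1 + t)) ^ j * (1 + z) ^ (r - j)))"
      unfolding e e2 by (simp add: mult_ac)
  qed
  also have "\<dots> = (1 + t) powr (v - real r - 1) * ((\<Sum>i\<le>r. real (r choose i) * (1 + t) ^ i * (-1) ^ (r - i))
       * (\<Sum>j\<le>r. real (r choose j) * (- (1 + t)) ^ j * (1 + z) ^ (r - j)))"
    unfolding sum_product by (simp only: sum_distrib_left)
  also have "(\<Sum>i\<le>r. real (r choose i) * (1 + t) ^ i * (-1) ^ (r - i)) = t ^ r"
    using binomial_ring[of "1 + t" "-1" r] by simp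
  also have "(\<Sum>j\<le>r. real (r choose j) * (- (1 + t)) ^ j * (1 + z) ^ (r - j)) = (z - t) ^ r"
    using binomial_ring[of "- (1 + t)" "1 + z" r] by simp
  finally show ?thesis by (simp add: mult_ac)
qed

lemma pade_remainder_bounds:
  fixes v z :: real
  assumes v: "0 < v" "v < 1" and z: "z > 0"
  shows "0 < pade_primitive v r z z - pade_primitive v r z 0"
    and "pade_primitive v r z z - pade_primitive v r z 0 \<le> z ^ (2 * r + 1)"
proof -
  obtain x where x: "0 < x" "x < z"
    "pade_primitive v r z z - pade_primitive v r z 0 = (z - 0) * (x ^ r * (z - x) ^ r * (1 + x) powr (v - real r - 1))"
    using MVT2[of 0 z "pade_primitive v r z" "\<lambda>t. t ^ r * (z - t) ^ r * (1 + t) powr (v - real r - 1)"]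
      pade_primitive_deriv[OF v] z by (metis less_eq_real_def)
  show "0 < pade_primitive v r z z - pade_primitive v r z 0"
    unfolding x(3) using x(1,2) z by simp
  have "(1 + x) powr (v - real r - 1) \<le> (1 + x) powr 0" using x v by (intro powr_mono) auto
  then have "(1 + x) powr (v - real r - 1) \<le> 1" using x by simp
  then have "(z - 0) * (x ^ r * (z - x) ^ r * (1 + x) powr (v - real r - 1)) \<le> z * (z ^ r * z ^ r * 1)"
    using x z by (intro mult_mono power_mono) auto
  also have "\<dots> = z ^ (2 * r + 1)" by (simp add: mult_2 power_add)
  finally show "pade_primitive v r z z - pade_primitive v r z 0 \<le> z ^ (2 * r + 1)" unfolding x(3) .
qed

text \<open>The derivative for \<open>Suc r\<close> is the one for \<open>r\<close> times
  \<open>t * (z - t) / (1 + t)\<close>, a factor below 1. The mean value theorem is applied to the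
  difference of the primitives, so that both derivatives are taken at the same point.\<close>

lemma pade_remainder_decreasing:
  fixes v z :: real
  assumes v: "0 < v" "v < 1" and z: "z > 0" "z \<le> 1"
  shows "pade_primitive v (Suc r) z z - pade_primitive v (Suc r) z 0
    < pade_primitive v r z z - pade_primitive v r z 0"
proof -
  define D where "D r t = t ^ r * (z - t) ^ r * (1 + t) powr (v - real r - 1)" for r t
  have "((\<lambda>t. pade_primitive v r z t - pade_primitive v (Suc r) z t) has_real_derivative D r t - D (Suc r) t) (at t)"
    if "0 \<le> t" for t unfolding D_def using that by (intro DERIV_diff pade_primitive_deriv[OF v]) auto
  then obtain x where x: "0 < x" "x < z"
    "(pade_primitive v r z z - pade_primitive v (Suc r) z z) - (pade_primitive v r z 0 - pade_primitive v (Suc r) z 0)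
      = (z - 0) * (D r x - D (Suc r) x)"
    using MVT2[of 0 z "\<lambda>t. pade_primitive v r z t - pade_primitive v (Suc r) z t" "\<lambda>t. D r t - D (Suc r) t"] z by auto
  have "(1 + x) powr (v - real (Suc r) - 1) = (1 + x) powr (v - real r - 1) * (1 + x) powr (- 1)"
    unfolding powr_add[symmetric] by (simp add: algebra_simps)
  also have "(1 + x) powr (- 1) = 1 / (1 + x)" using x by (simp add: powr_minus_divide)
  finally have "D (Suc r) x = D r x * (x * (z - x) / (1 + x))" by (simp add: D_def)
  moreover have lt: "x * (z - x) / (1 + x) < 1"
  proof -
    have "x * (z - x) \<le> 1 * 1" using x z by (intro mult_mono) auto
    then show ?thesis using x by simp
  qed
  moreover have "D r x > 0" using x by (simp add: D_def)
  then have "D r x * (x * (z - x) / (1 + x)) < D r x * 1" by (intro mult_strict_left_mono lt)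
  ultimately have "D (Suc r) x < D r x" by simp
  then have "0 < (z - 0) * (D r x - D (Suc r) x)" using z by simp
  then show ?thesis using x(3) by linarith
qed

section \<open>Monotonicity, integrality and size of the Pade coefficients\<close>

lemma pade_coeff_pos:
  assumes "0 < v" "v < 1" "i \<le> r"
  shows "pade_coeff v r i > 0"
  using assms by (auto simp: pade_coeff_def intro!: divide_pos_pos mult_pos_pos pochhammer_pos)

lemma pade_coeff_Suc_ge:
  assumes v: "0 < v" "v < 1" and i: "i \<le> r"
  shows "pade_coeff v r i \<le> pade_coeff v (Suc r) i"
proof -
  define b where "b = pochhammer v (Suc i) * pochhammer (1 - v) (r - i)"
  define y where "y = 1 - v + real (r - i)"
  have b: "b > 0" unfolding b_def using v by (intro mult_pos_pos pochhammer_pos) auto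
  have y: "0 < y" "y \<le> real (Suc r)" unfolding y_def using v i by (auto simp: of_nat_diff)
  have "pochhammer v (Suc i) * pochhammer (1 - v) (Suc r - i) = b * y"
    using i by (simp add: b_def y_def Suc_diff_le pochhammer_Suc)
  then have e: "pade_coeff v (Suc r) i = real (Suc r choose i) * fact (Suc r) / (b * y)" by (simp add: pade_coeff_def)
  have "real (r choose i) * fact r / b \<le> real (Suc r choose i) * fact r / b"
    using b by (intro divide_right_mono mult_right_mono) (auto simp: binomial_mono intro: binomial_right_mono)
  also have "\<dots> = real (Suc r choose i) * (fact r * y) / (b * y)" using y by simp
  also have "\<dots> \<le> real (Suc r choose i) * (fact r * real (Suc r)) / (b * y)"
    using y b by (intro divide_right_mono mult_left_mono) auto
  also have "\<dots> = pade_coeff v (Suc r) i" unfolding e by (simp add: mult_ac)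
  finally show ?thesis by (simp add: pade_coeff_def b_def)
qed

lemma pade_denom_Suc_ge:
  assumes v: "0 < v" "v < 1" and w: "w > 0"
  shows "0 < pade_denom v r w" and "pade_denom v r w \<le> pade_denom v (Suc r) w"
proof -
  show "0 < pade_denom v r w"
    unfolding pade_denom_def using w pade_coeff_pos[OF v] by (intro sum_pos) auto
  have "pade_denom v r w \<le> (\<Sum>i\<le>r. pade_coeff v (Suc r) i * w ^ i)"
    unfolding pade_denom_def using w by (intro sum_mono mult_right_mono pade_coeff_Suc_ge[OF v]) auto
  also have "\<dots> \<le> (\<Sum>i\<le>Suc r. pade_coeff v (Suc r) i * w ^ i)"
    using w pade_coeff_pos[OF v, of "Suc r" "Suc r"] by simp
  finally show "pade_denom v r w \<le> pade_denom v (Suc r) w" unfolding pade_denom_def .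
qed

text \<open>A common denominator of the coefficients: its product with the \<open>i\<close>-th one
  splits into two factors of the form \<open>k ^ (2 * m) * pochhammer (a / k) m / fact m\<close>,
  with \<open>m = r - i\<close> and \<open>m = i\<close>, each an integer.\<close>

definition pade_scale :: "nat \<Rightarrow> nat \<Rightarrow> real" where
  "pade_scale k r = real k ^ (2 * r) * pochhammer (1 / real k) (Suc r) * pochhammer (1 - 1 / real k) r / (fact r)\<^sup>2"

lemma pade_scale_pos: "k \<ge> 2 \<Longrightarrow> pade_scale k r > 0"
  by (auto simp: pade_scale_def intro!: divide_pos_pos mult_pos_pos pochhammer_pos)

lemma pade_scaled_integral:
  assumes k: "k \<ge> 2" and i: "i \<le> r"
  shows "\<exists>N::nat. pade_scale k r * pade_coeff (1 / real k) r i = real N"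
proof -
  define v where "v = 1 / real k"
  have v: "0 < v" "v < 1" using k by (auto simp: v_def)
  define A where "A = pochhammer v (Suc i)"
  define B where "B = pochhammer (1 - v) (r - i)"
  define A' where "A' = pochhammer (v + real (Suc i)) (r - i)"
  define B' where "B' = pochhammer (1 - v + real (r - i)) i"
  have AB: "A > 0" "B > 0" unfolding A_def B_def using v by (auto intro!: pochhammer_pos)
  have "pochhammer v (Suc r) = A * A'"
    using pochhammer_product'[of v "Suc i" "r - i"] i by (simp add: A_def A'_def)
  moreover have "pochhammer (1 - v) r = B * B'"
    using pochhammer_product'[of "1 - v" "r - i" i] i by (simp add: B_def B'_def)
  moreover have "real (r choose i) = fact r / (fact i * fact (r - i))"
    by (rule binomial_fact[OF i])
  ultimately have "pade_scale k r * pade_coeff v r i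
      = real k ^ (2 * r) * (A * A') * (B * B') / (fact r)\<^sup>2 * (fact r / (fact i * fact (r - i)) * fact r / (A * B))"
    unfolding pade_scale_def pade_coeff_def v_def[symmetric] A_def[symmetric] B_def[symmetric] by simp
  also have "\<dots> = real k ^ (2 * r) * A' * B' / (fact i * fact (r - i))"
    using AB by (simp add: power2_eq_square)
  also have "2 * r = 2 * (r - i) + 2 * i" using i by simp
  also have "real k ^ (2 * (r - i) + 2 * i) = real k ^ (2 * (r - i)) * real k ^ (2 * i)" by (rule power_add)
  finally have e: "pade_scale k r * pade_coeff v r i
      = (real k ^ (2 * (r - i)) * A' / fact (r - i)) * (real k ^ (2 * i) * B' / fact i)" by (simp add: mult_ac)
  have a1: "v + real (Suc i) = real (1 + k * Suc i) / real k" using k by (simp add: v_def field_simps)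
  have a2: "1 - v + real (r - i) = real (k - 1 + k * (r - i)) / real k" using k by (simp add: v_def field_simps of_nat_diff)
  obtain N1 where "real k ^ (2 * (r - i)) * A' / fact (r - i) = real N1"
    unfolding A'_def a1 using pochhammer_scaled_integral[of k "1 + k * Suc i" "r - i"] k by auto
  moreover obtain N2 where "real k ^ (2 * i) * B' / fact i = real N2"
    unfolding B'_def a2 using pochhammer_scaled_integral[of k "k - 1 + k * (r - i)" i] k by auto
  ultimately show ?thesis unfolding e[unfolded v_def] by (metis of_nat_mult)
qed

lemma pade_scale_le:
  assumes k: "k \<ge> 2"
  shows "pade_scale k r \<le> real k ^ (2 * r) * real (Suc r)"
proof -
  define v where "v = 1 / real k"
  have v: "0 < v" "v < 1" using k by (auto simp: v_def)
  have "pochhammer v (Suc r) \<le> fact (Suc r)"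
    unfolding pochhammer_fact pochhammer_prod using v by (intro prod_mono) auto
  moreover have "pochhammer (1 - v) r \<le> fact r"
    unfolding pochhammer_fact pochhammer_prod using v by (intro prod_mono) auto
  ultimately have "pade_scale k r \<le> real k ^ (2 * r) * fact (Suc r) * fact r / (fact r)\<^sup>2"
    unfolding pade_scale_def v_def[symmetric] using v
    by (intro divide_right_mono mult_mono) (auto intro!: mult_nonneg_nonneg pochhammer_nonneg)
  also have "\<dots> = real k ^ (2 * r) * real (Suc r)" by (simp add: power2_eq_square)
  finally show ?thesis .
qed

lemma pade_coeff_le:
  assumes k: "k \<ge> 2" and i: "i \<le> r"
  shows "pade_coeff (1 / real k) r i \<le> real k * 8 ^ r"
proof -
  define v where "v = 1 / real k"
  have v: "0 < v" "v \<le> 1 / 2" using k by (auto simp: v_def field_simps)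
  have "fact i * v \<le> pochhammer v (Suc i)"
  proof -
    have "fact i \<le> pochhammer (v + 1) i"
      unfolding pochhammer_fact pochhammer_prod using v by (intro prod_mono) auto
    then show ?thesis unfolding pochhammer_rec using v by (simp add: mult.commute)
  qed
  moreover have "fact (r - i) / 2 ^ (r - i) \<le> pochhammer (1 - v) (r - i)"
  proof -
    have "fact m / 2 ^ m \<le> pochhammer (1 - v) m" for m
    proof -
      have "fact m / 2 ^ m = (\<Prod>s=0..<m. (1 + real s) / 2)"
        unfolding pochhammer_fact pochhammer_prod by (simp add: prod_dividef)
      also have "\<dots> \<le> (\<Prod>s=0..<m. 1 - v + real s)"
        using v by (intro prod_mono) auto
      finally show ?thesis unfolding pochhammer_prod .
    qed
    then show ?thesis .
  qed
  ultimately have den: "fact i * v * (fact (r - i) / 2 ^ (r - i)) \<le> pochhammer v (Suc i) * pochhammer (1 - v) (r - i)"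
    using v by (intro mult_mono) (auto intro!: pochhammer_nonneg)
  have "pade_coeff v r i \<le> real (r choose i) * fact r / (fact i * v * (fact (r - i) / 2 ^ (r - i)))"
    unfolding pade_coeff_def using v
    by (intro divide_left_mono den mult_pos_pos pochhammer_pos divide_pos_pos) auto
  also have "\<dots> = real (r choose i) * (fact r / (fact i * fact (r - i))) * (1 / v) * 2 ^ (r - i)"
    using v by simp
  also have "\<dots> = real (r choose i) * real (r choose i) * real k * 2 ^ (r - i)"
    by (simp add: binomial_fact[OF i, where 'a = real, symmetric] v_def)
  also have "\<dots> \<le> 2 ^ r * 2 ^ r * real k * 2 ^ r"
  proof -
    have "real (r choose i) \<le> 2 ^ r" using binomial_le_pow2[of r i] by (metis of_nat_le_iff of_nat_numeral of_nat_power)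
    moreover have "(2::real) ^ (r - i) \<le> 2 ^ r" by (intro power_increasing) auto
    ultimately show ?thesis by (intro mult_mono) auto
  qed
  also have "\<dots> = real k * (2 * 2 * 2) ^ r" by (simp only: power_mult_distrib) (simp add: mult_ac)
  finally show ?thesis by (simp add: v_def)
qed

text \<open>Origin of \<open>32 * k ^ 3\<close>: for each unit of \<open>r\<close> the scale
  contributes \<open>k ^ 2\<close>, the coefficients 8, two factors \<open>Suc r \<le> 2 ^ r\<close>
  contribute 4, and the single \<open>k\<close> is at most \<open>k ^ r\<close>.\<close>

lemma pade_scaled_sum_le:
  assumes k: "k \<ge> 2" and r: "r \<ge> 1"
  shows "pade_scale k r * (\<Sum>i\<le>r. pade_coeff (1 / real k) r i) \<le> real (32 * k ^ 3) ^ r"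
proof -
  have "(\<Sum>i\<le>r. pade_coeff (1 / real k) r i) \<le> (\<Sum>i\<le>r. real k * 8 ^ r)"
    by (intro sum_mono pade_coeff_le k) auto
  also have "\<dots> = real (Suc r) * (real k * 8 ^ r)" by simp
  finally have "pade_scale k r * (\<Sum>i\<le>r. pade_coeff (1 / real k) r i)
      \<le> (real k ^ (2 * r) * real (Suc r)) * (real (Suc r) * (real k * 8 ^ r))"
    using pade_scale_le[OF k, of r] k
    by (intro mult_mono) (auto intro!: sum_nonneg less_imp_le[OF pade_coeff_pos])
  also have "\<dots> = real k ^ (2 * r) * 8 ^ r * (real (Suc r) * real (Suc r)) * real k" by (simp add: mult_ac)
  also have "\<dots> \<le> real k ^ (2 * r) * 8 ^ r * (2 ^ r * 2 ^ r) * real k ^ r"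
  proof -
    have "Suc r \<le> 2 ^ r" by (simp add: Suc_leI less_exp)
    then have "real (Suc r) \<le> 2 ^ r" by (metis of_nat_le_iff of_nat_numeral of_nat_power)
    moreover have "real k ^ 1 \<le> real k ^ r" using k r by (intro power_increasing) auto
    ultimately show ?thesis by (intro mult_mono) auto
  qed
  also have "\<dots> = real (32 * k ^ 3) ^ r"
  proof -
    have "real (32 * k ^ 3) ^ r = (8 * (2 * 2) * (real k ^ 2 * real k)) ^ r" by (simp add: power3_eq_cube power2_eq_square)
    also have "\<dots> = 8 ^ r * (2 ^ r * 2 ^ r) * (real k ^ (2 * r) * real k ^ r)"
      by (simp only: power_mult_distrib power_mult)
    finally show ?thesis by (simp add: mult_ac)
  qed
  finally show ?thesis .
qed

section \<open>Large solutions of the Thue equation\<close>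

lemma sorted_list_of_subset:
  fixes A :: "nat set"
  assumes "infinite A \<or> L \<le> card A"
  obtains xs where "length xs = L" "set xs \<subseteq> A" "sorted_wrt (<) xs"
proof -
  obtain X where X: "X \<subseteq> A" "finite X" "card X = L"
    using assms
  proof
    assume "infinite A"
    from infinite_arbitrarily_large[OF this, of L] show ?thesis using that by blast
  next
    assume "L \<le> card A"
    then show ?thesis by (rule obtain_subset_with_card_n) (use that in blast)
  qed
  show ?thesis by (rule that[of "sorted_list_of_set X"]) (use X in \<open>auto simp: strict_sorted_iff\<close>)
qed

text \<open>Growth with exponent 3/2, iterated \<open>i\<close> times and cleared of
  denominators.\<close>

lemma sorted_chain_growth:
  fixes xs :: "nat list"
  assumes "\<And>i. Suc i < length xs \<Longrightarrow> (xs ! i) ^ 3 \<le> (xs ! Suc i)\<^sup>2"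
  shows "i < length xs \<Longrightarrow> (xs ! 0) ^ (3 ^ i) \<le> (xs ! i) ^ (2 ^ i)"
proof (induction i)
  case (Suc i)
  have "(xs ! 0) ^ (3 ^ Suc i) = ((xs ! 0) ^ (3 ^ i)) ^ 3" by (simp add: mult.commute flip: power_mult)
  also have "\<dots> \<le> ((xs ! i) ^ (2 ^ i)) ^ 3" using Suc by (intro power_mono) auto
  also have "\<dots> = ((xs ! i) ^ 3) ^ (2 ^ i)" by (simp add: mult.commute flip: power_mult)
  also have "\<dots> \<le> ((xs ! Suc i)\<^sup>2) ^ (2 ^ i)" using assms[OF Suc.prems] by (intro power_mono) auto
  also have "\<dots> = (xs ! Suc i) ^ (2 ^ Suc i)" by (simp flip: power_mult)
  finally show ?case .
qed simp

text \<open>With the positive \<open>h\<close> on a fixed side, one equation serves both signs of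
  \<open>n\<close>: the two coefficients change places. The single height \<open>H\<close> carries
  all dependence on the coefficients.\<close>

locale thue_equation =
  fixes k c d h H :: nat
  assumes k: "k \<ge> 3" and pos: "c > 0" "d > 0" "h > 0"
    and H: "c \<le> H" "d * (1 + h) \<le> H" "d + h \<le> H"
begin

definition sol :: "nat \<Rightarrow> nat \<Rightarrow> bool" where
  "sol u v \<longleftrightarrow> u > 0 \<and> v > 0 \<and> c * u ^ k = d * v ^ k + h"

text \<open>Combines the height with the growth constant of the approximants; a solution counts as
  large when \<open>v \<ge> G ^ 8\<close>.\<close>

definition G :: nat where "G = H * (32 * k ^ 3)"

definition \<theta> :: real where "\<theta> = root k (real c / real d)"

lemma theta_pow: "\<theta> ^ k = real c / real d" and theta_pos: "\<theta> > 0"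
  unfolding \<theta>_def using k pos by (auto intro!: real_root_pow_pos2)

lemma H_ge: "H \<ge> 1" "h \<le> H" "d \<le> H"
  using H pos by auto

lemma G_ge: "G \<ge> 2" "H \<le> G" "32 * k ^ 3 \<le> G"
proof -
  have K: "32 * k ^ 3 \<ge> 2" using k by (auto simp: power3_eq_cube)
  show "H \<le> G" "32 * k ^ 3 \<le> G" using H_ge(1) K by (simp_all add: G_def)
  then show "G \<ge> 2" using K by linarith
qed

lemma sol_le:
  assumes "sol u v"
  shows "u \<le> H * v" and "c * u ^ k \<le> H * v ^ k"
proof -
  have e: "c * u ^ k = d * v ^ k + h" and v: "v > 0" using assms by (auto simp: sol_def)
  have vk: "1 \<le> v ^ k" using v by simp
  have "c * u ^ k \<le> d * v ^ k + h * v ^ k" using e vk by simp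
  also have "\<dots> = (d + h) * v ^ k" by (simp add: algebra_simps)
  also have "\<dots> \<le> H * v ^ k" using H(3) by (intro mult_le_mono1)
  finally show 1: "c * u ^ k \<le> H * v ^ k" .
  have "u ^ k \<le> c * u ^ k" using pos by simp
  also have "\<dots> \<le> H * v ^ k" by (rule 1)
  also have "\<dots> \<le> H ^ k * v ^ k" using H_ge(1) k self_le_power[of H k] by (intro mult_le_mono1) auto
  also have "\<dots> = (H * v) ^ k" by (simp add: power_mult_distrib)
  finally show "u \<le> H * v" using k by (simp add: power_mono_iff)
qed

lemma theta_approx:
  assumes "sol u v"
  shows "0 < \<theta> * u - v" and "\<theta> * u - v \<le> real h / real v ^ (k - 1)"
proof -
  have e: "c * u ^ k = d * v ^ k + h" and v: "v > 0" using assms by (auto simp: sol_def)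
  define X where "X = \<theta> * u"
  have X0: "X \<ge> 0" using theta_pos by (simp add: X_def)
  have "real (c * u ^ k) = real (d * v ^ k + h)" unfolding e ..
  then have Xk: "X ^ k = real v ^ k + real h / real d"
    unfolding X_def power_mult_distrib theta_pow using pos by (simp add: field_simps)
  then have "real v ^ k < X ^ k" using pos by simp
  then have Xv: "real v < X" using X0 by (rule power_less_imp_less_base)
  then show "0 < \<theta> * u - v" by (simp add: X_def)
  have kS: "k = Suc (k - 1)" using k by simp
  have "(X - v) * real v ^ (k - 1) = X * real v ^ (k - 1) - real v ^ k"
    by (subst (3) kS) (simp add: algebra_simps)
  also have "X * real v ^ (k - 1) \<le> X * X ^ (k - 1)" using X0 Xv by (intro mult_left_mono power_mono) auto
  also have "X * X ^ (k - 1) = X ^ k" by (subst (2) kS) simp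
  finally have "(X - v) * real v ^ (k - 1) \<le> real h / real d" using Xk by simp
  also have "\<dots> \<le> real h / 1" using pos by (intro divide_left_mono) auto
  finally show "\<theta> * u - v \<le> real h / real v ^ (k - 1)" using v by (simp add: X_def pos_le_divide_eq)
qed

lemma sol_cross_less:
  assumes "sol u v" "sol u' v'" "v < v'"
  shows "u' * v < u * v'"
proof -
  have e: "c * u ^ k = d * v ^ k + h" "c * u' ^ k = d * v' ^ k + h" using assms by (auto simp: sol_def)
  have "v ^ k < v' ^ k" using assms(3) k by (intro power_strict_mono) auto
  then have "h * v ^ k < h * v' ^ k" using pos by simp
  moreover have "c * (u' * v) ^ k = (c * u' ^ k) * v ^ k" "c * (u * v') ^ k = (c * u ^ k) * v' ^ k"
    by (simp_all add: power_mult_distrib)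
  ultimately have "c * (u' * v) ^ k < c * (u * v') ^ k" unfolding e by (simp add: algebra_simps)
  then have "(u' * v) ^ k < (u * v') ^ k" by simp
  then show ?thesis by (rule power_less_imp_less_base) simp
qed

text \<open>Distinct solutions give distinct fractions, so
  \<open>1 \<le> u * v' - u' * v \<le> u' * (\<theta> * u - v)\<close>, and \<open>v / u\<close> is
  so close to \<open>\<theta>\<close> that \<open>v ^ (k - 1) \<le> u' * h \<le> H ^ 2 * v'\<close>.
  From \<open>k \<ge> 3\<close> follows \<open>v ^ 2 \<le> H ^ 2 * v'\<close>; after squaring,
  \<open>v\<close> pays for \<open>H ^ 4\<close>.\<close>

lemma sol_gap:
  assumes s: "sol u v" "sol u' v'" "v < v'" and v: "H ^ 4 \<le> v"
  shows "v ^ 3 \<le> v'\<^sup>2"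
proof -
  have v0: "v > 0" using s by (simp add: sol_def)
  have "u' * v + 1 \<le> u * v'" using sol_cross_less[OF s] by simp
  then have "real (u' * v + 1) \<le> real (u * v')" by (simp only: of_nat_le_iff)
  then have "1 \<le> real u' * (\<theta> * u - v) - real u * (\<theta> * u' - v')" by (simp add: algebra_simps)
  also have "\<dots> \<le> real u' * (\<theta> * u - v)" using theta_approx(1)[OF s(2)] by simp
  also have "\<dots> \<le> real u' * (real h / real v ^ (k - 1))" using theta_approx(2)[OF s(1)] by (intro mult_left_mono) auto
  finally have "real v ^ (k - 1) \<le> real u' * real h" using v0 by (simp add: field_simps)
  then have "v ^ (k - 1) \<le> u' * h" by (metis of_nat_le_iff of_nat_mult of_nat_power)
  moreover have "v ^ 2 \<le> v ^ (k - 1)" using v0 k by (intro power_increasing) auto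
  moreover have "u' * h \<le> (H * v') * H" using sol_le(1)[OF s(2)] H_ge by (intro mult_le_mono) auto
  ultimately have "v ^ 2 \<le> H ^ 2 * v'" by (simp add: power2_eq_square mult_ac)
  then have "(v ^ 2) ^ 2 \<le> (H ^ 2 * v') ^ 2" by (rule power_mono) simp
  also have "\<dots> = H ^ 4 * v' ^ 2" by (simp add: power_mult_distrib flip: power_mult)
  also have "\<dots> \<le> v * v' ^ 2" using v by (intro mult_le_mono1)
  finally have "v * v ^ 3 \<le> v * v' ^ 2" by (simp add: power_numeral_reduce power2_eq_square mult_ac)
  then show ?thesis using v0 by simp
qed

text \<open>Error of the approximant to \<open>(1 + z) powr (1 / k)\<close> after division by its
  denominator. Its strict decrease in \<open>r\<close> takes the place of the usual determinant
  showing that consecutive approximants differ.\<close>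

definition quality :: "nat \<Rightarrow> real \<Rightarrow> real" where
  "quality r z = (pade_primitive (1 / k) r z z - pade_primitive (1 / k) r z 0) / pade_denom (1 / k) r (1 + z)"

lemma k_exponent: "0 < 1 / real k" "1 / real k < 1"
  using k by auto

lemma quality_decreasing:
  assumes z: "0 < z" "z \<le> 1"
  shows "quality (Suc r) z < quality r z"
proof -
  define P where "P r = pade_primitive (1 / k) r z z - pade_primitive (1 / k) r z 0" for r
  define Q where "Q r = pade_denom (1 / k) r (1 + z)" for r
  have P: "0 < P r" "P (Suc r) < P r"
    unfolding P_def using pade_remainder_bounds(1)[OF k_exponent z(1)] pade_remainder_decreasing[OF k_exponent z] by auto
  have Q: "0 < Q r" "Q r \<le> Q (Suc r)"
    unfolding Q_def using pade_denom_Suc_ge[OF k_exponent, of "1 + z"] z by auto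
  have "P (Suc r) / Q (Suc r) \<le> P (Suc r) / Q r"
    using P Q pade_remainder_bounds(1)[OF k_exponent z(1), of "Suc r"] unfolding P_def[symmetric]
    by (intro divide_left_mono mult_pos_pos) auto
  also have "\<dots> < P r / Q r" using P Q by (intro divide_strict_right_mono)
  finally show ?thesis by (simp add: quality_def P_def Q_def)
qed

text \<open>The approximant is evaluated at \<open>1 + z = c * u ^ k / (d * v ^ k)\<close>, whose
  \<open>k\<close>-th root is \<open>\<theta> * u / v\<close>. Multiplication by
  \<open>pade_scale k r * (d * v ^ k) ^ r\<close> makes numerator and denominator integers.\<close>

lemma pade_approximation:
  assumes s: "sol u v" and r: "r \<ge> 1" and v: "H \<le> v"
  defines "z \<equiv> real h / (real d * real v ^ k)"
  shows "\<exists>(p::nat) (q::nat). q > 0 \<and> \<theta> * q - p = q * (v / u) * quality r z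
     \<and> 0 < \<theta> * q - p \<and> real q \<le> u * (real c * real u ^ k) ^ r * real (32 * k ^ 3) ^ r
     \<and> \<theta> * q - p \<le> v * real (32 * k ^ 3) ^ r * real h ^ (2 * r + 1) / real v ^ (k * (r + 1))"
proof -
  have e: "c * u ^ k = d * v ^ k + h" and uv: "u > 0" "v > 0" using s by (auto simp: sol_def)
  define \<nu> where "\<nu> = 1 / real k"
  define a where "a = real c * real u ^ k"
  define b where "b = real d * real v ^ k"
  define l where "l = pade_scale k r"
  define C where "C i = pade_coeff \<nu> r i" for i
  have \<nu>: "0 < \<nu>" "\<nu> < 1" using k_exponent by (auto simp: \<nu>_def)
  have k2: "k \<ge> 2" using k by simp
  have l: "l > 0" unfolding l_def by (rule pade_scale_pos[OF k2])
  have C: "C i > 0" if "i \<le> r" for i unfolding C_def using pade_coeff_pos[OF \<nu> that] .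
  have b0: "b > 0" using pos uv by (simp add: b_def)
  have ab: "a = b + h" using e unfolding a_def b_def by (metis of_nat_add of_nat_mult of_nat_power)
  have z0: "z > 0" using pos uv by (simp add: z_def)
  have W: "1 + z = a / b" using b0 unfolding ab z_def b_def[symmetric] by (simp add: field_simps)
  have "1 * real v ^ k \<le> real d * real v ^ k" using pos by (intro mult_right_mono) auto
  then have bv: "real v ^ k \<le> b" by (simp add: b_def)
  have "\<forall>i\<in>{..r}. \<exists>N::nat. l * C i = real N"
    unfolding l_def C_def \<nu>_def using pade_scaled_integral[OF k2] by auto
  then obtain N :: "nat \<Rightarrow> nat" where N: "\<And>i. i \<le> r \<Longrightarrow> l * C i = real (N i)" by (metis atMost_iff)
  define q where "q = u * (\<Sum>i\<le>r. N i * (c * u ^ k) ^ i * (d * v ^ k) ^ (r - i))"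
  define p where "p = v * (\<Sum>i\<le>r. N i * (c * u ^ k) ^ (r - i) * (d * v ^ k) ^ i)"
  have q: "real q = u * (l * b ^ r * pade_denom \<nu> r (1 + z))"
  proof -
    have "real q = u * (\<Sum>i\<le>r. real (N i) * a ^ i * b ^ (r - i))" by (simp add: q_def a_def b_def)
    also have "(\<Sum>i\<le>r. real (N i) * a ^ i * b ^ (r - i)) = (\<Sum>i\<le>r. l * b ^ r * (C i * (a / b) ^ i))"
    proof (intro sum.cong refl)
      fix i assume i: "i \<in> {..r}"
      then have "b ^ r = b ^ (r - i) * b ^ i" by (simp flip: power_add)
      then show "real (N i) * a ^ i * b ^ (r - i) = l * b ^ r * (C i * (a / b) ^ i)"
        using N[of i, symmetric] i b0 by (simp add: power_divide)
    qed
    finally show ?thesis by (simp add: pade_denom_def W C_def sum_distrib_left)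
  qed
  have p: "real p = v * (l * b ^ r * pade_numer \<nu> r (1 + z))"
  proof -
    have "real p = v * (\<Sum>i\<le>r. real (N i) * a ^ (r - i) * b ^ i)" by (simp add: p_def a_def b_def)
    also have "(\<Sum>i\<le>r. real (N i) * a ^ (r - i) * b ^ i) = (\<Sum>i\<le>r. l * b ^ r * (C i * (a / b) ^ (r - i)))"
    proof (intro sum.cong refl)
      fix i assume i: "i \<in> {..r}"
      then have "b ^ r = b ^ (r - i) * b ^ i" by (simp flip: power_add)
      then show "real (N i) * a ^ (r - i) * b ^ i = l * b ^ r * (C i * (a / b) ^ (r - i))"
        using N[of i, symmetric] i b0 by (simp add: power_divide)
    qed
    finally show ?thesis by (simp add: pade_numer_def W C_def sum_distrib_left)
  qed
  define \<Phi> where "\<Phi> = pade_primitive \<nu> r z z - pade_primitive \<nu> r z 0"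
  have \<Phi>: "0 < \<Phi>" "\<Phi> \<le> z ^ (2 * r + 1)" unfolding \<Phi>_def using pade_remainder_bounds[OF \<nu> z0] by auto
  have \<theta>u: "\<theta> * u = v * (1 + z) powr \<nu>"
  proof (rule power_eq_imp_eq_base[of _ k])
    have "((1 + z) powr \<nu>) ^ k = (1 + z) powr (\<nu> * k)"
      using z0 by (simp add: powr_powr[symmetric] powr_realpow)
    also have "\<dots> = a / b" using k z0 b0 ab by (simp add: \<nu>_def W)
    finally show "(\<theta> * u) ^ k = (v * (1 + z) powr \<nu>) ^ k"
      unfolding power_mult_distrib theta_pow using pos uv by (simp add: a_def b_def)
  qed (use theta_pos k in auto)
  have Q0: "pade_denom \<nu> r (1 + z) > 0" using pade_denom_Suc_ge(1)[OF \<nu>] z0 by simp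
  have diff: "\<theta> * q - p = v * (l * b ^ r * \<Phi>)"
  proof -
    have "\<theta> * q - p = (\<theta> * u) * (l * b ^ r * pade_denom \<nu> r (1 + z)) - v * (l * b ^ r * pade_numer \<nu> r (1 + z))"
      unfolding q p by simp
    also have "\<dots> = v * (l * b ^ r * ((1 + z) powr \<nu> * pade_denom \<nu> r (1 + z) - pade_numer \<nu> r (1 + z)))"
      unfolding \<theta>u by (simp add: algebra_simps)
    finally show ?thesis unfolding pade_remainder_eq[OF \<nu> z0] \<Phi>_def .
  qed
  have 1: "q > 0"
  proof -
    have "real q > 0" unfolding q using uv l b0 Q0 by simp
    then show ?thesis by simp
  qed
  have 2: "\<theta> * q - p = q * (v / u) * quality r z"
    unfolding diff quality_def \<nu>_def[symmetric] \<Phi>_def[symmetric] unfolding q using Q0 uv by simp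
  have 3: "0 < \<theta> * q - p" unfolding diff using uv l b0 \<Phi> by simp
  have 4: "real q \<le> u * (real c * real u ^ k) ^ r * real (32 * k ^ 3) ^ r"
  proof -
    have "b ^ r * pade_denom \<nu> r (1 + z) = (\<Sum>i\<le>r. C i * (a ^ i * b ^ (r - i)))"
      unfolding pade_denom_def W sum_distrib_left C_def
    proof (intro sum.cong refl)
      fix i assume i: "i \<in> {..r}"
      then have "b ^ r = b ^ (r - i) * b ^ i" by (simp flip: power_add)
      then show "b ^ r * (pade_coeff \<nu> r i * (a / b) ^ i) = pade_coeff \<nu> r i * (a ^ i * b ^ (r - i))"
        using b0 by (simp add: power_divide)
    qed
    also have "\<dots> \<le> (\<Sum>i\<le>r. C i * a ^ r)"
    proof (intro sum_mono mult_left_mono)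
      fix i assume i: "i \<in> {..r}"
      have "a ^ i * b ^ (r - i) \<le> a ^ i * a ^ (r - i)" using ab b0 by (intro mult_left_mono power_mono) auto
      also have "\<dots> = a ^ r" using i by (simp flip: power_add)
      finally show "a ^ i * b ^ (r - i) \<le> a ^ r" .
      show "0 \<le> C i" using C[of i] i by simp
    qed
    finally have "l * (b ^ r * pade_denom \<nu> r (1 + z)) \<le> l * ((\<Sum>i\<le>r. C i) * a ^ r)"
      using l by (simp add: sum_distrib_right)
    also have "\<dots> = a ^ r * (l * (\<Sum>i\<le>r. C i))" by (simp add: mult_ac)
    also have "\<dots> \<le> a ^ r * real (32 * k ^ 3) ^ r"
      unfolding l_def C_def \<nu>_def using ab b0 by (intro mult_left_mono pade_scaled_sum_le k2 r) auto
    finally show ?thesis unfolding q a_def[symmetric] by (simp add: mult.assoc mult_left_mono)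
  qed
  have 5: "\<theta> * q - p \<le> v * real (32 * k ^ 3) ^ r * real h ^ (2 * r + 1) / real v ^ (k * (r + 1))"
  proof -
    have lK: "l \<le> real (32 * k ^ 3) ^ r"
    proof -
      have "l \<le> real k ^ (2 * r) * real (Suc r)" unfolding l_def by (rule pade_scale_le[OF k2])
      also have "Suc r \<le> 2 ^ r" by (simp add: Suc_leI less_exp)
      then have "real (Suc r) \<le> 2 ^ r" by (metis of_nat_le_iff of_nat_numeral of_nat_power)
      then have "real k ^ (2 * r) * real (Suc r) \<le> real k ^ (2 * r) * 2 ^ r" by (intro mult_left_mono) auto
      also have "\<dots> = (2 * real k ^ 2) ^ r" by (metis power_mult_distrib power_mult mult.commute)
      also have "\<dots> \<le> real (32 * k ^ 3) ^ r"
      proof (rule power_mono)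
        have "real k ^ 2 \<le> real k ^ 3" using k by (intro power_increasing) auto
        then show "2 * real k ^ 2 \<le> real (32 * k ^ 3)"
          unfolding of_nat_mult of_nat_power of_nat_numeral using zero_le_power[of "real k" 3] by linarith
      qed simp
      finally show ?thesis .
    qed
    have "b ^ r * \<Phi> \<le> b ^ r * z ^ (2 * r + 1)" using \<Phi> b0 by (intro mult_left_mono) auto
    also have "z = h / b" by (simp add: z_def b_def)
    also have "b ^ r * (h / b) ^ (2 * r + 1) = real h ^ (2 * r + 1) / b ^ (r + 1)"
    proof -
      have "b ^ (2 * r + 1) = b ^ r * b ^ (r + 1)"
        unfolding power_add[symmetric] by (rule arg_cong[of _ _ "power b"]) simp
      then show ?thesis using b0 by (simp add: power_divide)
    qed
    also have "\<dots> \<le> real h ^ (2 * r + 1) / (real v ^ k) ^ (r + 1)"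
      using bv uv b0 by (intro divide_left_mono power_mono mult_pos_pos zero_less_power) auto
    finally have bp: "b ^ r * \<Phi> \<le> real h ^ (2 * r + 1) / real v ^ (k * (r + 1))"
      by (simp only: power_mult)
    have "l * (b ^ r * \<Phi>) \<le> real (32 * k ^ 3) ^ r * (real h ^ (2 * r + 1) / real v ^ (k * (r + 1)))"
      by (intro mult_mono lK bp) (use b0 \<Phi> in auto)
    then have "v * (l * (b ^ r * \<Phi>)) \<le> v * (real (32 * k ^ 3) ^ r * (real h ^ (2 * r + 1) / real v ^ (k * (r + 1))))"
      by (intro mult_left_mono) auto
    then show ?thesis unfolding diff by (simp add: mult_ac)
  qed
  show ?thesis using 1 2 3 4 5 by blast
qed

text \<open>The approximants of orders \<open>r\<close> and \<open>r + 1\<close> would both have to equal the fraction obtained from \<open>u'\<close> and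
  \<open>v'\<close>, but their relative errors differ.\<close>
lemma no_sol_in_window:
  assumes s: "sol u v" "sol u' v'" and v: "G ^ 8 \<le> v" and r: "r \<ge> 8"
    and v': "v ^ (2 * r) \<le> v'" "v' < v ^ (2 * r + 2)"
  shows False
proof -
  have uv: "u > 0" "v > 0" "u' > 0" "v' > 0" using s by (auto simp: sol_def)
  define z where "z = real h / (real d * real v ^ k)"
  have G1: "G \<ge> 1" using G_ge by simp
  have Gv: "G \<le> v" using v self_le_power[of G 8] G1 by linarith
  have Hv: "H \<le> v" using Gv G_ge by simp
  have v2: "v \<ge> 2" using Gv G_ge by simp
  have z: "0 < z" "z \<le> 1"
  proof -
    show "0 < z" using pos uv by (simp add: z_def)
    have "h * 1 \<le> v * 1" using Hv H_ge by simp
    also have "\<dots> \<le> v ^ k * d" using pos uv k by (intro mult_le_mono self_le_power) auto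
    finally have "h \<le> d * v ^ k" by (simp add: mult.commute)
    then have "real h \<le> real d * real v ^ k" by (metis of_nat_le_iff of_nat_mult of_nat_power)
    then show "z \<le> 1" unfolding z_def using pos uv by (simp add: pos_divide_le_eq)
  qed
  have key: "\<exists>(p::nat) (q::nat). q > 0 \<and> \<theta> * q - p = q * (v / u) * quality \<rho> z \<and> p * u' = q * v'"
    if \<rho>: "\<rho> = r \<or> \<rho> = Suc r" for \<rho>
  proof -
    have \<rho>1: "\<rho> \<ge> 1" using \<rho> r by auto
    define K where "K = 32 * k ^ 3"
    have GHK: "G = H * K" by (simp add: G_def K_def)
    from pade_approximation[OF s(1) \<rho>1 Hv, folded z_def K_def]
    obtain p q :: nat where PQ: "q > 0 \<and> \<theta> * q - p = q * (v / u) * quality \<rho> z \<and> 0 < \<theta> * q - p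
        \<and> real q \<le> u * (real c * real u ^ k) ^ \<rho> * real K ^ \<rho>
        \<and> \<theta> * q - p \<le> v * real K ^ \<rho> * real h ^ (2 * \<rho> + 1) / real v ^ (k * (\<rho> + 1))"
      by (elim exE)
    from PQ have pq: "q > 0" "\<theta> * q - p = q * (v / u) * quality \<rho> z" "0 < \<theta> * q - p"
      and qle: "real q \<le> u * (real c * real u ^ k) ^ \<rho> * real K ^ \<rho>"
      and dle: "\<theta> * q - p \<le> v * real K ^ \<rho> * real h ^ (2 * \<rho> + 1) / real v ^ (k * (\<rho> + 1))"
      by blast+
    \<comment> \<open>Raising to the 8th power makes \<open>G ^ 8 \<le> v\<close> applicable. The
      lower end of the window enters here and leads to \<open>q * (\<theta> * u' - v') < 1\<close>;
      \<open>r \<ge> 8\<close> gives room in the exponents.\<close>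
    have ex1: "G ^ (\<rho> + 2) * v ^ (1 + k * \<rho>) < v' ^ (k - 1)"
    proof -
      have "(G ^ (\<rho> + 2) * v ^ (1 + k * \<rho>)) ^ 8 = (G ^ 8) ^ (\<rho> + 2) * v ^ (8 * (1 + k * \<rho>))"
        by (simp only: power_mult_distrib power_mult[symmetric] mult.commute)
      also have "\<dots> \<le> v ^ (\<rho> + 2) * v ^ (8 * (1 + k * \<rho>))" using v by (intro mult_le_mono1 power_mono) auto
      also have "\<dots> = v ^ (\<rho> + 2 + 8 * (1 + k * \<rho>))" by (simp only: power_add)
      also have "\<dots> < v ^ (2 * r * (k - 1) * 8)"
      proof (rule power_strict_increasing)
        obtain k' where k': "k = k' + 3" using k by (metis add.commute le_Suc_ex)
        obtain r' where r': "r = r' + 8" using r by (metis add.commute le_Suc_ex)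
        show "\<rho> + 2 + 8 * (1 + k * \<rho>) < 2 * r * (k - 1) * 8"
          using \<rho> unfolding k' r' by (auto simp: algebra_simps)
      qed (use v2 in simp)
      also have "\<dots> = ((v ^ (2 * r)) ^ (k - 1)) ^ 8" by (simp only: power_mult)
      also have "\<dots> \<le> (v' ^ (k - 1)) ^ 8" using v'(1) by (intro power_mono) auto
      finally show ?thesis by (rule power_less_imp_less_base) simp
    qed
    have t1: "real q * (\<theta> * u' - v') < 1"
    proof -
      have "u * (c * u ^ k) ^ \<rho> * K ^ \<rho> * h \<le> (H * v) * (H * v ^ k) ^ \<rho> * K ^ \<rho> * H"
        using power_mono[OF sol_le(2)[OF s(1)] le0, of \<rho>] sol_le(1)[OF s(1)] H_ge(2)
        by (intro mult_le_mono) auto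
      also have "\<dots> = (H ^ (\<rho> + 2) * K ^ \<rho>) * v ^ (1 + k * \<rho>)"
        by (simp add: power_mult_distrib power_add power2_eq_square mult_ac flip: power_mult)
      also have "\<dots> \<le> G ^ (\<rho> + 2) * v ^ (1 + k * \<rho>)"
      proof -
        have "K ^ \<rho> \<le> K ^ (\<rho> + 2)" using k by (intro power_increasing) (auto simp: K_def)
        then have "H ^ (\<rho> + 2) * K ^ \<rho> \<le> G ^ (\<rho> + 2)" unfolding GHK power_mult_distrib by simp
        then show ?thesis by simp
      qed
      finally have "u * (c * u ^ k) ^ \<rho> * K ^ \<rho> * h < v' ^ (k - 1)" using ex1 by linarith
      then have lt: "real u * (real c * real u ^ k) ^ \<rho> * real K ^ \<rho> * real h < real v' ^ (k - 1)"
        by (metis of_nat_less_iff of_nat_mult of_nat_power)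
      have "real q * (\<theta> * u' - v') \<le> (real u * (real c * real u ^ k) ^ \<rho> * real K ^ \<rho>) * (real h / real v' ^ (k - 1))"
        using theta_approx[OF s(2)] qle by (intro mult_mono) auto
      also have "\<dots> < 1" using lt uv by simp
      finally show ?thesis .
    qed
    \<comment> \<open>The upper end of the window enters here and leads to
      \<open>u' * (\<theta> * q - p) < 1\<close>.\<close>
    have ex2: "G ^ (2 * \<rho> + 2) * v' * v < v ^ (k * (\<rho> + 1))"
    proof -
      have "G ^ (2 * \<rho> + 2) * v' * v \<le> G ^ (2 * \<rho> + 2) * v ^ (2 * r + 2) * v" using v'(2) by simp
      also have "\<dots> = G ^ (2 * \<rho> + 2) * v ^ (2 * r + 3)" by (simp add: power_add power3_eq_cube power2_eq_square mult_ac)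
      also have "\<dots> < v ^ (k * (\<rho> + 1))"
      proof -
        have "(G ^ (2 * \<rho> + 2) * v ^ (2 * r + 3)) ^ 8 = (G ^ 8) ^ (2 * \<rho> + 2) * v ^ (8 * (2 * r + 3))"
          by (simp add: power_mult_distrib mult.commute flip: power_mult)
        also have "\<dots> \<le> v ^ (2 * \<rho> + 2) * v ^ (8 * (2 * r + 3))" using v by (intro mult_le_mono1 power_mono) auto
        also have "\<dots> = v ^ (2 * \<rho> + 2 + 8 * (2 * r + 3))" by (simp only: power_add)
        also have "\<dots> < v ^ (k * (\<rho> + 1) * 8)"
        proof (rule power_strict_increasing)
          have "3 * (\<rho> + 1) * 8 \<le> k * (\<rho> + 1) * 8" using k by (intro mult_le_mono1)
          moreover have "2 * \<rho> + 2 + 8 * (2 * r + 3) < 3 * (\<rho> + 1) * 8" using \<rho> r by auto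
          ultimately show "2 * \<rho> + 2 + 8 * (2 * r + 3) < k * (\<rho> + 1) * 8" by (rule less_le_trans[rotated])
        qed (use v2 in simp)
        also have "\<dots> = (v ^ (k * (\<rho> + 1))) ^ 8" by (simp only: power_mult)
        finally show ?thesis by (rule power_less_imp_less_base) simp
      qed
      finally show ?thesis .
    qed
    have t2: "real u' * (\<theta> * q - p) < 1"
    proof -
      have "u' * (v * K ^ \<rho> * h ^ (2 * \<rho> + 1)) \<le> (H * v') * (v * K ^ \<rho> * H ^ (2 * \<rho> + 1))"
        using sol_le[OF s(2)] H_ge by (intro mult_le_mono power_mono) auto
      also have "\<dots> = (H ^ (2 * \<rho> + 2) * K ^ \<rho>) * v' * v" by (simp add: mult_ac)
      also have "\<dots> \<le> G ^ (2 * \<rho> + 2) * v' * v"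
      proof -
        have "K ^ \<rho> \<le> K ^ (2 * \<rho> + 2)" using k by (intro power_increasing) (auto simp: K_def)
        then have "H ^ (2 * \<rho> + 2) * K ^ \<rho> \<le> G ^ (2 * \<rho> + 2)" unfolding GHK power_mult_distrib by simp
        then show ?thesis by simp
      qed
      finally have "u' * (v * K ^ \<rho> * h ^ (2 * \<rho> + 1)) < v ^ (k * (\<rho> + 1))" using ex2 by linarith
      then have lt: "real u' * (real v * real K ^ \<rho> * real h ^ (2 * \<rho> + 1)) < real v ^ (k * (\<rho> + 1))"
        by (metis of_nat_less_iff of_nat_mult of_nat_power)
      have "real u' * (\<theta> * q - p) \<le> real u' * (v * real K ^ \<rho> * real h ^ (2 * \<rho> + 1) / real v ^ (k * (\<rho> + 1)))"
        using dle by (intro mult_left_mono) auto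
      also have "\<dots> < 1" using lt uv by simp
      finally show ?thesis .
    qed
    \<comment> \<open>Both products on the right lie strictly between 0 and 1, so the integer on the
      left is 0.\<close>
    have eq: "real p * real u' - real q * real v' = real q * (\<theta> * u' - v') - real u' * (\<theta> * q - p)"
      by (simp add: algebra_simps)
    have "0 < real q * (\<theta> * u' - v')" "0 < real u' * (\<theta> * q - p)"
      using pq(1,3) theta_approx(1)[OF s(2)] uv by simp_all
    then have "\<bar>real p * real u' - real q * real v'\<bar> < 1" unfolding eq using t1 t2 by linarith
    then have "\<bar>real_of_int (int (p * u') - int (q * v'))\<bar> < 1" by simp
    then have "int (p * u') = int (q * v')" by linarith
    then have "p * u' = q * v'" by (simp only: of_nat_eq_iff)
    then show ?thesis using pq by blast
  qed
  have ratio: "quality \<rho> z = (\<theta> - v' / u') * u / v" if rr: "\<rho> = r \<or> \<rho> = Suc r" for \<rho>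
  proof -
    obtain p q :: nat where pq: "q > 0" "\<theta> * q - p = q * (v / u) * quality \<rho> z" "p * u' = q * v'"
      using key[OF rr] by blast
    have "real p = real q * (v' / u')"
      using arg_cong[OF pq(3), of real] uv by (simp add: field_simps)
    then have "real q * (\<theta> - v' / u') = real q * ((v / u) * quality \<rho> z)"
      using pq(2) by (simp add: algebra_simps)
    then have "\<theta> - v' / u' = (v / u) * quality \<rho> z"
      using pq(1) by (subst (asm) mult_left_cancel) auto
    then show ?thesis using uv by simp
  qed
  show False using ratio[of r] ratio[of "Suc r"] quality_decreasing[OF z, of r] by simp
qed

text \<open>The windows from \<open>v ^ (2 * r)\<close> to \<open>v ^ (2 * r + 2)\<close> with
  \<open>r \<ge> 8\<close> cover everything from \<open>v ^ 16\<close> on.\<close>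

lemma sol_less_power:
  assumes s: "sol u v" "sol u' v'" and v: "G ^ 8 \<le> v"
  shows "v' < v ^ 16"
proof (rule ccontr)
  assume "\<not> ?thesis"
  then have ge: "v ^ 16 \<le> v'" by simp
  have v2: "v \<ge> 2" using v self_le_power[of G 8] G_ge by linarith
  define r where "r = (LEAST r. v' < v ^ (2 * r + 2))"
  have ex: "\<exists>r. v' < v ^ (2 * r + 2)"
  proof
    have "v' < v ^ v'" using v2 by (intro power_gt_expt) auto
    also have "\<dots> \<le> v ^ (2 * v' + 2)" using v2 by (intro power_increasing) auto
    finally show "v' < v ^ (2 * v' + 2)" .
  qed
  have up: "v' < v ^ (2 * r + 2)" unfolding r_def by (rule LeastI_ex[OF ex])
  have r8: "r \<ge> 8"
  proof (rule ccontr)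
    assume "\<not> ?thesis"
    then have "v ^ (2 * r + 2) \<le> v ^ 16" using v2 by (intro power_increasing) auto
    then show False using up ge by linarith
  qed
  have "\<not> v' < v ^ (2 * (r - 1) + 2)" unfolding r_def by (rule not_less_Least) (use r8 in \<open>simp add: r_def\<close>)
  moreover have "2 * (r - 1) + 2 = 2 * r" using r8 by simp
  ultimately have "v ^ (2 * r) \<le> v'" by (metis not_less)
  then show False using no_sol_in_window[OF s v r8 _ up] by blast
qed

text \<open>By the gap principle, eight solutions would satisfy
  \<open>v\<^sub>0 ^ (3 ^ 7) \<le> v\<^sub>7 ^ (2 ^ 7)\<close>. But
  \<open>v\<^sub>7 < v\<^sub>0 ^ 16\<close>, and \<open>16 * 2 ^ 7 = 2048\<close> is less than
  \<open>3 ^ 7 = 2187\<close>; six steps would not suffice.\<close>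

lemma card_large_solutions:
  "finite {v. \<exists>u. sol u v \<and> G ^ 8 \<le> v} \<and> card {v. \<exists>u. sol u v \<and> G ^ 8 \<le> v} \<le> 7"
proof (rule ccontr)
  let ?V = "{v. \<exists>u. sol u v \<and> G ^ 8 \<le> v}"
  assume "\<not> ?thesis"
  then have "infinite ?V \<or> 8 \<le> card ?V" by auto
  then obtain xs where xs: "length xs = 8" "set xs \<subseteq> ?V" "sorted_wrt (<) xs"
    by (rule sorted_list_of_subset)
  have inV: "\<exists>u. sol u (xs ! i)" "G ^ 8 \<le> xs ! i" if "i < 8" for i
    using that xs(1) nth_mem[of i xs] subsetD[OF xs(2), of "xs ! i"] by auto
  have H4: "H ^ 4 \<le> G ^ 8"
  proof -
    have "H ^ 4 \<le> G ^ 4" using G_ge by (intro power_mono) auto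
    also have "\<dots> \<le> G ^ 8" using G_ge by (intro power_increasing) auto
    finally show ?thesis .
  qed
  have "(xs ! 0) ^ (3 ^ 7) \<le> (xs ! 7) ^ (2 ^ 7)"
  proof (rule sorted_chain_growth)
    fix i assume i: "Suc i < length xs"
    then have "xs ! i < xs ! Suc i" by (intro sorted_wrt_nth_less[OF xs(3)]) auto
    moreover obtain u u' where "sol u (xs ! i)" "sol u' (xs ! Suc i)" using inV i xs(1) by force
    moreover have "H ^ 4 \<le> xs ! i" using H4 inV(2)[of i] i xs(1) by linarith
    ultimately show "(xs ! i) ^ 3 \<le> (xs ! Suc i)\<^sup>2" by (intro sol_gap)
  qed (simp add: xs)
  also have "(xs ! 7) ^ (2 ^ 7) \<le> ((xs ! 0) ^ 16) ^ (2 ^ 7)"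
    using sol_less_power inV[of 0] inV[of 7] by (intro power_mono) (auto intro: less_imp_le)
  also have "\<dots> = (xs ! 0) ^ 2048" by (simp flip: power_mult)
  also have "\<dots> < (xs ! 0) ^ (3 ^ 7)"
  proof (rule power_strict_increasing)
    show "1 < xs ! 0" using inV(2)[of 0] self_le_power[of G 8] G_ge by simp
  qed simp
  finally show False by simp
qed

end

section \<open>Reduction to elements of polynomial size\<close>

text \<open>With \<open>W = a2 * N\<close> and \<open>H = 2 * (a2 * a2 * N)\<close>, the assumption
  \<open>64 * k ^ 3 \<le> N\<close> gives \<open>H * (32 * k ^ 3) \<le> W ^ 2\<close>, so
  \<open>V b \<ge> W ^ 16\<close> is large for the Thue equation. For
  \<open>b \<ge> W ^ (16 * k + 1)\<close> the powers are at least \<open>W ^ (16 * k)\<close>; the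
  extra factor \<open>W\<close> pays for subtracting \<open>N\<close> when \<open>n < 0\<close>.
  Different \<open>b\<close> give different solutions.\<close>

lemma few_large_elements:
  fixes k N a1 a2 :: nat and n :: int and B :: "nat set"
  assumes k: "k \<ge> 3" and N: "N = nat \<bar>n\<bar>" "64 * k ^ 3 \<le> N" and a: "0 < a1" "a1 < a2"
    and p1: "\<And>b. b \<in> B \<Longrightarrow> perfect_power k (int a1 * int b + n)"
    and p2: "\<And>b. b \<in> B \<Longrightarrow> perfect_power k (int a2 * int b + n)"
  shows "finite {b\<in>B. (a2 * N) ^ (16 * k + 1) \<le> b} \<and> card {b\<in>B. (a2 * N) ^ (16 * k + 1) \<le> b} \<le> 7"
proof -
  define H where "H = 2 * (a2 * a2 * N)"
  define h where "h = N * (a2 - a1)"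
  define W where "W = a2 * N"
  have N2: "N \<ge> 2" using N(2) k by (auto simp: power3_eq_cube intro: order_trans[rotated])
  have a2: "a2 \<ge> 2" using a by simp
  have W2: "W \<ge> 2" using N2 a2 by (simp add: W_def order_trans[OF N2])
  have hpos: "h > 0" using a N2 by (simp add: h_def)
  have hle: "1 + h \<le> N * a2"
  proof -
    have "N * a2 = N * (a2 - a1) + N * a1" using a by (simp flip: distrib_left)
    moreover have "1 \<le> N * a1" using a N2 by (simp add: Suc_le_eq)
    ultimately show ?thesis by (simp add: h_def)
  qed
  have sq: "a2 \<le> a2 * a2 * N"
  proof -
    have "a2 * 1 \<le> a2 * (a2 * N)" using a2 N2 by (intro mult_le_mono2) (simp add: Suc_le_eq)
    then show ?thesis by (simp add: mult.assoc)
  qed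
  have sq2: "N * a2 \<le> a2 * a2 * N"
  proof -
    have "1 * (N * a2) \<le> a2 * (N * a2)" using a2 by (intro mult_le_mono1) simp
    then show ?thesis by (simp add: mult_ac)
  qed
  have H1: "a \<le> H" if "a \<le> a2" for a using that sq unfolding H_def by linarith
  have H2: "a * (1 + h) \<le> H" if "a \<le> a2" for a
  proof -
    have "a * (1 + h) \<le> a2 * (N * a2)" using that hle by (intro mult_le_mono)
    then show ?thesis by (simp add: H_def mult_ac)
  qed
  have H3: "a + h \<le> H" if "a \<le> a2" for a using that sq hle sq2 unfolding H_def by linarith
  have GW: "(H * (32 * k ^ 3)) ^ 8 \<le> W ^ 16"
  proof -
    have "H * (32 * k ^ 3) = a2 * a2 * N * (64 * k ^ 3)" by (simp add: H_def)
    also have "\<dots> \<le> a2 * a2 * N * N" using N(2) by (intro mult_le_mono2)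
    also have "\<dots> = W ^ 2" by (simp add: W_def power2_eq_square)
    finally have "(H * (32 * k ^ 3)) ^ 8 \<le> (W ^ 2) ^ 8" by (rule power_mono) simp
    then show ?thesis by (simp flip: power_mult)
  qed
  have "\<forall>b\<in>B. \<exists>x. x > 0 \<and> int a1 * int b + n = int x ^ k" using p1 by (auto simp: perfect_power_def)
  then obtain X where X: "\<And>b. b \<in> B \<Longrightarrow> X b > 0" "\<And>b. b \<in> B \<Longrightarrow> int a1 * int b + n = int (X b) ^ k" by metis
  have "\<forall>b\<in>B. \<exists>x. x > 0 \<and> int a2 * int b + n = int x ^ k" using p2 by (auto simp: perfect_power_def)
  then obtain Y where Y: "\<And>b. b \<in> B \<Longrightarrow> Y b > 0" "\<And>b. b \<in> B \<Longrightarrow> int a2 * int b + n = int (Y b) ^ k" by metis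
  define L where "L = {b\<in>B. W ^ (16 * k + 1) \<le> b}"
  have Wb: "W ^ (16 * k) \<le> b" "W ^ (16 * k) + N \<le> b" if "b \<in> L" for b
  proof -
    have Wb0: "W ^ (16 * k + 1) \<le> b" using that unfolding L_def by blast
    have "W ^ (16 * k) \<le> W ^ (16 * k + 1)" using W2 by (intro power_increasing) auto
    then show "W ^ (16 * k) \<le> b" using Wb0 by (rule le_trans)
    have "N \<le> W ^ (16 * k)"
    proof -
      have "N \<le> W" using a2 by (simp add: W_def)
      also have "\<dots> \<le> W ^ (16 * k)" using k W2 by (intro self_le_power) auto
      finally show ?thesis .
    qed
    moreover have "2 * W ^ (16 * k) \<le> W ^ (16 * k + 1)" using W2 by simp
    ultimately show "W ^ (16 * k) + N \<le> b" using Wb0 by linarith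
  qed
  have finish: "finite L \<and> card L \<le> 7"
    if T: "thue_equation k c d h H" and inj: "inj_on V L"
      and V: "\<And>b. b \<in> L \<Longrightarrow> thue_equation.sol k c d h (U b) (V b)" "\<And>b. b \<in> L \<Longrightarrow> W ^ (16 * k) \<le> (V b) ^ k"
    for c d U V
  proof -
    interpret thue_equation k c d h H by (rule T)
    have "V ` L \<subseteq> {v. \<exists>u. sol u v \<and> G ^ 8 \<le> v}"
    proof (rule image_subsetI)
      fix b assume b: "b \<in> L"
      have "(W ^ 16) ^ k \<le> (V b) ^ k" using V(2)[OF b] by (simp add: power_mult)
      then have "W ^ 16 \<le> V b" using k by (simp add: power_mono_iff)
      then have "G ^ 8 \<le> V b" using GW by (simp add: G_def)
      then show "V b \<in> {v. \<exists>u. sol u v \<and> G ^ 8 \<le> v}" using V(1)[OF b] by blast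
    qed
    then show ?thesis using card_large_solutions inj
      by (meson card_inj_on_le inj_on_finite le_trans)
  qed
  have "finite L \<and> card L \<le> 7"
  proof (cases "n > 0")
    case True
    then have nN: "n = int N" using N by simp
    have T: "thue_equation k a2 a1 h H"
      by unfold_locales (use k a hpos H1 H2 H3 in auto)
    have y: "a2 * b + N = Y b ^ k" and x: "a1 * b + N = X b ^ k" if "b \<in> L" for b
      using X(2)[of b] Y(2)[of b] that unfolding nN L_def by (simp_all flip: of_nat_mult of_nat_add of_nat_power add: of_nat_eq_iff)
    show ?thesis
    proof (rule finish[OF T, of Y X])
      show "inj_on Y L"
      proof (rule inj_onI)
        fix b c assume bc: "b \<in> L" "c \<in> L" "Y b = Y c"
        then have "a2 * b + N = a2 * c + N" by (simp add: y)
        then show "b = c" using a by simp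
      qed
      fix b assume b: "b \<in> L"
      have "a2 * X b ^ k = a1 * Y b ^ k + h"
      proof -
        have "N * a2 = N * (a2 - a1) + N * a1" using a by (simp flip: distrib_left)
        then show ?thesis unfolding x[OF b, symmetric] y[OF b, symmetric] h_def by (simp add: algebra_simps)
      qed
      then show "thue_equation.sol k a2 a1 h (X b) (Y b)"
        using X(1)[of b] Y(1)[of b] b by (simp add: thue_equation.sol_def[OF T] L_def)
      have "b \<le> a2 * b + N" using a by (simp add: trans_le_add1)
      then show "W ^ (16 * k) \<le> Y b ^ k" using Wb(1)[OF b] y[OF b] by linarith
    qed
  next
    case False
    then have nN: "n = - int N" using N by simp
    have T: "thue_equation k a1 a2 h H"
      by unfold_locales (use k a hpos H1 H2 H3 in auto)
    have y: "a2 * b = Y b ^ k + N" and x: "a1 * b = X b ^ k + N" if "b \<in> L" for b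
    proof -
      have "int (a2 * b) = int (Y b ^ k + N)" "int (a1 * b) = int (X b ^ k + N)"
        using X(2)[of b] Y(2)[of b] that unfolding nN L_def by simp_all
      then show "a2 * b = Y b ^ k + N" "a1 * b = X b ^ k + N" by (simp_all only: of_nat_eq_iff)
    qed
    show ?thesis
    proof (rule finish[OF T, of X Y])
      show "inj_on X L"
      proof (rule inj_onI)
        fix b c assume bc: "b \<in> L" "c \<in> L" "X b = X c"
        then have "a1 * b = a1 * c" by (simp add: x)
        then show "b = c" using a by simp
      qed
      fix b assume b: "b \<in> L"
      have "a1 * Y b ^ k + a1 * N = a1 * (a2 * b)" unfolding y[OF b] by (simp add: algebra_simps)
      moreover have "a2 * X b ^ k + a2 * N = a2 * (a1 * b)" unfolding x[OF b] by (simp add: algebra_simps)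
      moreover have "N * a2 = N * (a2 - a1) + N * a1" using a by (simp flip: distrib_left)
      ultimately have "a1 * Y b ^ k = a2 * X b ^ k + h" unfolding h_def by (simp add: mult_ac)
      then show "thue_equation.sol k a1 a2 h (Y b) (X b)"
        using X(1)[of b] Y(1)[of b] b by (simp add: thue_equation.sol_def[OF T] L_def)
      have "b \<le> a1 * b" using a by simp
      then show "W ^ (16 * k) \<le> X b ^ k" using Wb(2)[OF b] x[OF b] by linarith
    qed
  qed
  then show ?thesis by (simp add: L_def W_def)
qed

lemma diff_powers_ge:
  fixes X Y :: nat
  assumes "Y < X" "k \<ge> 1"
  shows "X ^ (k - 1) + Y ^ k \<le> X ^ k"
proof -
  obtain j where j: "k = Suc j" using assms(2) by (cases k) auto
  have "Y * Y ^ j \<le> Y * X ^ j" using assms(1) by (intro mult_le_mono2 power_mono) auto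
  moreover have "Y * X ^ j + X ^ j \<le> X * X ^ j"
    using mult_le_mono1[of "Y + 1" X "X ^ j"] assms(1) by simp
  ultimately show ?thesis unfolding j diff_Suc_1 power_Suc by linarith
qed

text \<open>The powers \<open>X ^ k\<close> and \<open>Y ^ k\<close> of the two diagonal products
  differ by the nonzero number \<open>n * (a2 - a1) * (b2 - b1)\<close>, so
  \<open>X ^ (k - 1) \<le> N * t\<close>, while \<open>s * t \<le> 4 * X ^ k\<close>. Hence
  \<open>s ^ (k - 1) \<le> (4 * N) ^ k * t\<close>. Its sixth power and
  \<open>(4 * N) ^ 6 \<le> s\<close> give \<open>s ^ (5 * k - 6) \<le> t ^ 6\<close>, and
  \<open>5 * k - 6 \<ge> 9\<close>.\<close>

lemma product_gap:
  fixes k N a1 a2 b1 b2 :: nat and n :: int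
  assumes k: "k \<ge> 3" and N: "N = nat \<bar>n\<bar>" "N > 0" and a: "a1 < a2" and b: "b1 < b2"
    and pp: "\<And>a b. a \<in> {a1, a2} \<Longrightarrow> b \<in> {b1, b2} \<Longrightarrow> perfect_power k (int a * int b + n)"
    and large: "(4 * N) ^ 6 \<le> a1 * b1"
  shows "(a1 * b1) ^ 3 \<le> (a2 * b2)\<^sup>2"
proof -
  obtain x11 x12 x21 x22 :: nat where x: "int a1 * int b1 + n = int x11 ^ k" "int a1 * int b2 + n = int x12 ^ k"
    "int a2 * int b1 + n = int x21 ^ k" "int a2 * int b2 + n = int x22 ^ k"
    using pp[of a1 b1] pp[of a1 b2] pp[of a2 b1] pp[of a2 b2] by (auto simp: perfect_power_def)
  define s where "s = a1 * b1"
  define t where "t = a2 * b2"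
  define X where "X = x11 * x22"
  define Y where "Y = x12 * x21"
  have Xk: "int X ^ k = (int a1 * int b1 + n) * (int a2 * int b2 + n)" by (simp add: X_def power_mult_distrib x)
  have Yk: "int Y ^ k = (int a1 * int b2 + n) * (int a2 * int b1 + n)" by (simp add: Y_def power_mult_distrib x)
  have diff: "int X ^ k - int Y ^ k = n * ((int a2 - int a1) * (int b2 - int b1))"
    unfolding Xk Yk by (simp add: algebra_simps)
  have pos: "(int a2 - int a1) * (int b2 - int b1) > 0" using a b by simp
  have le: "(int a2 - int a1) * (int b2 - int b1) \<le> int t"
    unfolding t_def of_nat_mult using a b by (intro mult_mono) auto
  have n0: "n \<noteq> 0" using N by auto
  have Xle: "X ^ (k - 1) \<le> N * t"
  proof -
    have absn: "\<bar>int X ^ k - int Y ^ k\<bar> \<le> int N * int t"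
      unfolding diff abs_mult using pos le N(1) by (intro mult_mono) auto
    have "X \<noteq> Y" using diff n0 pos by auto
    then consider "Y < X" | "X < Y" by linarith
    then have "int X ^ (k - 1) \<le> \<bar>int X ^ k - int Y ^ k\<bar>"
    proof cases
      case 1
      have "int (X ^ (k - 1) + Y ^ k) \<le> int (X ^ k)" using diff_powers_ge[OF 1, of k] k by (simp only: of_nat_le_iff)
      then show ?thesis by simp
    next
      case 2
      have "int (Y ^ (k - 1) + X ^ k) \<le> int (Y ^ k)" using diff_powers_ge[OF 2, of k] k by (simp only: of_nat_le_iff)
      moreover have "int X ^ (k - 1) \<le> int Y ^ (k - 1)" using 2 by (intro power_mono) auto
      ultimately show ?thesis by simp
    qed
    then have "int (X ^ (k - 1)) \<le> int (N * t)" using absn by simp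
    then show ?thesis by (simp only: of_nat_le_iff)
  qed
  have sN: "4 * N \<le> s" using large self_le_power[of "4 * N" 6] N(2) by (simp add: s_def)
  have st: "s \<le> t" unfolding s_def t_def using a b by (intro mult_le_mono) auto
  have nN: "n \<ge> - int N" "int N \<ge> 0" using N by simp_all
  have sN': "4 * int N \<le> int s" "4 * int N \<le> int t" using sN st by linarith+
  have e: "int a1 * int b1 = int s" "int a2 * int b2 = int t" by (simp_all add: s_def t_def)
  have p1: "int s \<le> 2 * (int a1 * int b1 + n)" unfolding e using nN sN' by presburger
  have p2: "int t \<le> 2 * (int a2 * int b2 + n)" unfolding e using nN sN' by presburger
  have "int s * int t \<le> (2 * (int a1 * int b1 + n)) * (2 * (int a2 * int b2 + n))"
    using p1 p2 by (intro mult_mono) auto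
  also have "\<dots> = 4 * int X ^ k" unfolding Xk by (simp add: algebra_simps)
  finally have "int (s * t) \<le> int (4 * X ^ k)" by simp
  then have stX: "s * t \<le> 4 * X ^ k" by (simp only: of_nat_le_iff)
  have "(s * t) ^ (k - 1) \<le> (4 * X ^ k) ^ (k - 1)" using stX by (rule power_mono) simp
  also have "\<dots> = 4 ^ (k - 1) * (X ^ (k - 1)) ^ k" by (simp add: power_mult_distrib mult.commute flip: power_mult)
  also have "\<dots> \<le> 4 ^ k * (N * t) ^ k" using Xle by (intro mult_le_mono power_mono power_increasing) auto
  also have "\<dots> = (4 * N) ^ k * t * t ^ (k - 1)"
    using k by (cases k) (auto simp: power_mult_distrib)
  finally have "s ^ (k - 1) * t ^ (k - 1) \<le> (4 * N) ^ k * t * t ^ (k - 1)" by (simp add: power_mult_distrib)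
  moreover have "t ^ (k - 1) > 0" using sN st N(2) by simp
  ultimately have "s ^ (k - 1) \<le> (4 * N) ^ k * t" using mult_le_cancel2 by blast
  then have "(s ^ (k - 1)) ^ 6 \<le> ((4 * N) ^ k * t) ^ 6" by (rule power_mono) simp
  also have "\<dots> = ((4 * N) ^ 6) ^ k * t ^ 6" by (metis power_mult_distrib power_mult mult.commute)
  also have "\<dots> \<le> s ^ k * t ^ 6" using large by (intro mult_le_mono1 power_mono) (auto simp: s_def)
  finally have "s ^ ((k - 1) * 6) \<le> s ^ k * t ^ 6" by (simp add: power_mult)
  moreover have "(k - 1) * 6 = k + (5 * k - 6)" using k by simp
  ultimately have "s ^ k * s ^ (5 * k - 6) \<le> s ^ k * t ^ 6" by (simp add: power_add)
  moreover have s0: "s > 0" using sN N(2) by simp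
  ultimately have "s ^ (5 * k - 6) \<le> t ^ 6" by simp
  moreover have "s ^ 9 \<le> s ^ (5 * k - 6)" using s0 k by (intro power_increasing) auto
  ultimately have "(s ^ 3) ^ 3 \<le> (t ^ 2) ^ 3" by (simp flip: power_mult)
  then have "s ^ 3 \<le> t ^ 2" by (meson le0 not_le power_strict_mono zero_less_numeral)
  then show ?thesis by (simp add: s_def t_def)
qed

text \<open>If both sets are long, then comparing the growth of the products \<open>a\<^sub>i * b\<^sub>i\<close> with the bound for
  \<open>a\<^sub>i\<close> in terms of \<open>b\<^sub>2\<close> (and vice versa) shows that \<open>a\<^sub>2\<close> and \<open>b\<^sub>2\<close> are small.\<close>
lemma reduction_to_small_elements:
  fixes k :: nat
  assumes k: "k \<ge> 3"
  shows "\<exists>M C. \<forall>n A B. 64 * k ^ 3 \<le> nat \<bar>n\<bar> \<longrightarrow> bipartite_diophantine k n A B \<longrightarrow>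
    (finite A \<and> card A \<le> M) \<or> (finite B \<and> card B \<le> M) \<or>
    (finite {a\<in>A. nat \<bar>n\<bar> ^ C \<le> a} \<and> card {a\<in>A. nat \<bar>n\<bar> ^ C \<le> a} \<le> 7 \<and>
     finite {b\<in>B. nat \<bar>n\<bar> ^ C \<le> b} \<and> card {b\<in>B. nat \<bar>n\<bar> ^ C \<le> b} \<le> 7)"
proof -
  define E where "E = 16 * k + 1"
  define j where "j = 4 * E"
  \<comment> \<open>Bernoulli's inequality gives \<open>(3 / 2) ^ j \<ge> 1 + j / 2\<close>, which
    suggests \<open>j = 4 * E\<close>.\<close>
  have growth: "2 * E * 2 ^ j \<le> 3 ^ j"
  proof -
    have "1 + real j * (1 / 2) \<le> (1 + 1 / 2) ^ j" by (rule Bernoulli_inequality) simp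
    then have "real (2 * E) \<le> (3 / 2) ^ j" by (simp add: j_def)
    then have "real (2 * E) * 2 ^ j \<le> 3 ^ j" by (simp add: power_divide pos_le_divide_eq)
    then have "real (2 * E * 2 ^ j) \<le> real (3 ^ j)" by simp
    then show ?thesis by (simp only: of_nat_le_iff)
  qed
  show ?thesis
  proof (rule exI[of _ "j + 8"], rule exI[of _ "13 * E"], intro allI impI)
    fix n :: int and A B :: "nat set"
    define N where "N = nat \<bar>n\<bar>"
    assume n: "64 * k ^ 3 \<le> nat \<bar>n\<bar>" and BD: "bipartite_diophantine k n A B"
    have N: "N = nat \<bar>n\<bar>" "64 * k ^ 3 \<le> N" using n by (simp_all add: N_def)
    have k3: "k ^ 3 \<ge> 1" using k by simp
    have N4: "N \<ge> 4" using N(2) k3 by linarith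
    have pos: "a > 0" if "a \<in> A" for a using BD that by (auto simp: bipartite_diophantine_def)
    have posb: "b > 0" if "b \<in> B" for b using BD that by (auto simp: bipartite_diophantine_def)
    have pp: "perfect_power k (int a * int b + n)" "perfect_power k (int b * int a + n)" if "a \<in> A" "b \<in> B" for a b
      using BD that by (auto simp: bipartite_diophantine_def mult.commute)
    show "(finite A \<and> card A \<le> j + 8) \<or> (finite B \<and> card B \<le> j + 8) \<or>
      (finite {a\<in>A. nat \<bar>n\<bar> ^ (13 * E) \<le> a} \<and> card {a\<in>A. nat \<bar>n\<bar> ^ (13 * E) \<le> a} \<le> 7 \<and>
       finite {b\<in>B. nat \<bar>n\<bar> ^ (13 * E) \<le> b} \<and> card {b\<in>B. nat \<bar>n\<bar> ^ (13 * E) \<le> b} \<le> 7)"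
    proof (cases "(finite A \<and> card A \<le> j + 8) \<or> (finite B \<and> card B \<le> j + 8)")
      case True
      then show ?thesis by blast
    next
      case False
      then have "infinite A \<or> j + 9 \<le> card A" "infinite B \<or> j + 9 \<le> card B" by auto
      then obtain as bs where as: "length as = j + 9" "set as \<subseteq> A" "sorted_wrt (<) as"
        and bs: "length bs = j + 9" "set bs \<subseteq> B" "sorted_wrt (<) bs"
        by (metis sorted_list_of_subset)
      have asA: "as ! i \<in> A" and bsB: "bs ! i \<in> B" if "i < j + 9" for i
        using as bs that by (auto simp: nth_mem subset_iff)
      have as_less: "as ! i < as ! i'" if "i < i'" "i' < j + 9" for i i'
        using sorted_wrt_nth_less[OF as(3) that(1)] that(2) as(1) by simp
      have bs_less: "bs ! i < bs ! i'" if "i < i'" "i' < j + 9" for i i'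
        using sorted_wrt_nth_less[OF bs(3) that(1)] that(2) bs(1) by simp
      define a2 where "a2 = as ! 1"
      define b2 where "b2 = bs ! 1"
      have fewB: "finite {b\<in>B. (a2 * N) ^ E \<le> b} \<and> card {b\<in>B. (a2 * N) ^ E \<le> b} \<le> 7"
        unfolding E_def a2_def
        by (rule few_large_elements[OF k N, of "as ! 0"]) (use pos asA as_less pp in auto)
      have fewA: "finite {a\<in>A. (b2 * N) ^ E \<le> a} \<and> card {a\<in>A. (b2 * N) ^ E \<le> a} \<le> 7"
        unfolding E_def b2_def
        by (rule few_large_elements[OF k N, of "bs ! 0"]) (use posb bsB bs_less pp in auto)
      \<comment> \<open>The indices \<open>Suc j\<close> to \<open>j + 8\<close> belong to eight
        elements, too many for a threshold that at most seven reach.\<close>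
      have small_index: "xs ! Suc j < T"
        if xs: "length xs = j + 9" "set xs \<subseteq> Z" "sorted_wrt (<) xs"
          and few: "finite {z\<in>Z. T \<le> z} \<and> card {z\<in>Z. T \<le> z} \<le> 7" for xs Z and T :: nat
      proof (rule ccontr)
        assume "\<not> ?thesis"
        then have T: "T \<le> xs ! Suc j" by simp
        have "(\<lambda>i. xs ! i) ` {Suc j..<j + 9} \<subseteq> {z\<in>Z. T \<le> z}"
        proof (rule image_subsetI)
          fix i assume i: "i \<in> {Suc j..<j + 9}"
          have "xs ! Suc j \<le> xs ! i"
            using sorted_wrt_nth_less[OF xs(3), of "Suc j" i] xs(1) i by (cases "i = Suc j") auto
          then show "xs ! i \<in> {z\<in>Z. T \<le> z}" using T xs i by (auto simp: subset_iff)
        qed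
        then have "card ((\<lambda>i. xs ! i) ` {Suc j..<j + 9}) \<le> 7" using few card_mono le_trans by blast
        moreover have "inj_on (\<lambda>i. xs ! i) {Suc j..<j + 9}"
          using xs by (intro inj_on_nth) (auto simp: strict_sorted_iff)
        then have "card ((\<lambda>i. xs ! i) ` {Suc j..<j + 9}) = 8" by (simp add: card_image)
        ultimately show False by simp
      qed
      have aj: "as ! Suc j < (b2 * N) ^ E" by (rule small_index[OF as fewA])
      have bj: "bs ! Suc j < (a2 * N) ^ E" by (rule small_index[OF bs fewB])
      \<comment> \<open>Otherwise the products grow with exponent 3/2 for \<open>j\<close> steps,
        while \<open>aj\<close> and \<open>bj\<close> keep the last product below
        \<open>(a2 * b2) ^ (2 * E)\<close>, contradicting \<open>growth\<close>. The chain starts at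
        index 1 because both thresholds are expressed by \<open>a2\<close> and
        \<open>b2\<close>.\<close>
      have small: "a2 * b2 < (4 * N) ^ 6"
      proof (rule ccontr)
        assume "\<not> ?thesis"
        then have large: "(4 * N) ^ 6 \<le> a2 * b2" by simp
        define xs where "xs = map (\<lambda>i. as ! Suc i * bs ! Suc i) [0..<Suc j]"
        have xsi: "xs ! i = as ! Suc i * bs ! Suc i" if "i < Suc j" for i
          unfolding xs_def using that by (subst nth_map) (auto simp del: upt_Suc)
        have len: "length xs = Suc j" by (simp add: xs_def)
        have "xs ! 0 ^ (3 ^ j) \<le> xs ! j ^ (2 ^ j)"
        proof (rule sorted_chain_growth)
          fix i assume i: "Suc i < length xs"
          then have i': "Suc i < Suc j" by (simp add: len)
          have "a2 * b2 \<le> as ! Suc i * bs ! Suc i"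
            unfolding a2_def b2_def
          proof (rule mult_le_mono)
            show "as ! 1 \<le> as ! Suc i" using as_less[of 1 "Suc i"] i' by (cases i) auto
            show "bs ! 1 \<le> bs ! Suc i" using bs_less[of 1 "Suc i"] i' by (cases i) auto
          qed
          then have "(4 * N) ^ 6 \<le> as ! Suc i * bs ! Suc i" using large by simp
          then have "(as ! Suc i * bs ! Suc i) ^ 3 \<le> (as ! Suc (Suc i) * bs ! Suc (Suc i))\<^sup>2"
            using N4 i' by (intro product_gap[OF k N(1)] as_less bs_less) (auto intro!: pp(1) asA bsB)
          then show "(xs ! i) ^ 3 \<le> (xs ! Suc i)\<^sup>2" using i' by (simp add: xsi)
        qed (simp add: len)
        then have "(a2 * b2) ^ (3 ^ j) \<le> (as ! Suc j * bs ! Suc j) ^ (2 ^ j)"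
          by (simp add: xsi a2_def b2_def)
        also have "\<dots> < ((a2 * b2) ^ (2 * E)) ^ (2 ^ j)"
        proof (rule power_strict_mono)
          have "as ! Suc j * bs ! Suc j < (b2 * N) ^ E * (a2 * N) ^ E"
            using aj bj by (intro mult_strict_mono') auto
          also have "\<dots> = ((a2 * b2) * (N * N)) ^ E" by (simp add: power_mult_distrib mult_ac)
          also have "\<dots> \<le> ((a2 * b2) * (a2 * b2)) ^ E"
          proof (intro power_mono mult_le_mono2)
            have "N * N \<le> (4 * N) ^ 2" by (simp add: power2_eq_square)
            also have "\<dots> \<le> (4 * N) ^ 6" using N4 by (intro power_increasing) auto
            finally show "N * N \<le> a2 * b2" using large by simp
          qed simp
          also have "\<dots> = (a2 * b2) ^ (2 * E)" by (simp add: power_mult power2_eq_square)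
          finally show "as ! Suc j * bs ! Suc j < (a2 * b2) ^ (2 * E)" .
        qed auto
        also have "\<dots> = (a2 * b2) ^ (2 * E * 2 ^ j)" by (simp add: power_mult)
        also have "\<dots> \<le> (a2 * b2) ^ (3 ^ j)"
        proof (rule power_increasing[OF growth])
          have "1 \<le> (4 * N) ^ 6" using N4 by simp
          then show "1 \<le> a2 * b2" using large by linarith
        qed
        finally show False by simp
      qed
      \<comment> \<open>The 13 comes from \<open>(4 * N) ^ 6 * N \<le> (N * N) ^ 6 * N\<close>, as
        \<open>N \<ge> 4\<close>.\<close>
      have bound: "(x * N) ^ E \<le> N ^ (13 * E)" if "x \<le> a2 * b2" for x
      proof -
        have "x * N \<le> (4 * N) ^ 6 * N" using that small by (intro mult_le_mono1) simp
        also have "\<dots> \<le> (N * N) ^ 6 * N" using N4 by (intro mult_le_mono1 power_mono) auto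
        also have "\<dots> = N ^ 13" by (simp add: power_mult_distrib power_numeral_reduce flip: power_add)
        finally have "(x * N) ^ E \<le> (N ^ 13) ^ E" by (rule power_mono) simp
        then show ?thesis by (simp add: power_mult)
      qed
      have "a2 > 0" "b2 > 0" unfolding a2_def b2_def using pos posb asA bsB by auto
      then have "a2 \<le> a2 * b2" "b2 \<le> a2 * b2" by auto
      then have sub: "{a\<in>A. N ^ (13 * E) \<le> a} \<subseteq> {a\<in>A. (b2 * N) ^ E \<le> a}"
        "{b\<in>B. N ^ (13 * E) \<le> b} \<subseteq> {b\<in>B. (a2 * N) ^ E \<le> b}"
        using bound order_trans by blast+
      show ?thesis
        using fewA fewB sub unfolding N_def[symmetric]
        by (meson card_mono finite_subset le_trans)
    qed
  qed
qed

section \<open>The sieve bound for small elements\<close>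

lemma prod_le_const_power:
  fixes f :: "'a \<Rightarrow> nat"
  assumes "\<And>x. x \<in> S \<Longrightarrow> f x \<le> X"
  shows "prod f S \<le> X ^ card S"
proof -
  have "prod f S \<le> (\<Prod>x\<in>S. X)" using assms by (intro prod_mono) auto
  then show ?thesis by simp
qed

text \<open>The sieve moduli are the primes \<open>p \<equiv> 1 (mod d)\<close> up to about \<open>(ln |n| * ln ln |n|)\<^sup>2\<close>, and
  \<open>5 * ln ln |n|\<close> elements of \<open>A\<close> suffice to confine \<open>B\<close> to few classes modulo each of them.\<close>
lemma sieve_small_elements:
  fixes k C :: nat
  assumes k: "k \<ge> 3"
  shows "\<exists>R N0. R > 0 \<and> (\<forall>n A B. N0 \<le> nat \<bar>n\<bar> \<longrightarrow> bipartite_diophantine k n A B \<longrightarrow>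
    real (card {a\<in>A. a < nat \<bar>n\<bar> ^ C}) \<ge> 5 * ln (ln (real (nat \<bar>n\<bar>))) \<longrightarrow>
    real (card {b\<in>B. b < nat \<bar>n\<bar> ^ C}) \<le> R * ln (real (nat \<bar>n\<bar>)) * (ln (ln (real (nat \<bar>n\<bar>))))\<^sup>2)"
proof -
  obtain d where d: "prime d" "d dvd k" using prime_factor_nat[of k] k by auto
  have d2: "d \<ge> 2" using prime_ge_2_nat[OF d(1)] .
  obtain c x0 where c: "c > 0"
    and theta: "\<And>x. x \<ge> x0 \<Longrightarrow> c * real x \<le> (\<Sum>p\<in>{p\<in>{1..x}. prime p \<and> [p = 1] (mod d)}. ln (real p))"
    using theta_one_mod_lower[OF d(1)] by blast
  define p0 where "p0 = 144 + 2 * d\<^sup>2"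
  \<comment> \<open>Bounds the weight of the primes too small for Stepanov's bound.\<close>
  define \<kappa> where "\<kappa> = (\<Sum>p\<in>{1..<p0}. ln (real p))"
  \<comment> \<open>Makes \<open>40 * d * (C + 1) * (5 * \<mu> * lg)\<close> equal to
    \<open>c / 2 * y\<close> below. The larger sieve thus needs half of \<open>c * x\<close>, and
    the other half is left for the excluded primes.\<close>
  define r where "r = 400 * real d * real (C + 1) / c"
  have r0: "r > 0" using c d2 by (simp add: r_def)
  have "\<forall>\<^sub>F N in sequentially. ln (ln (real N)) \<ge> 1" by real_asymp
  moreover have "\<forall>\<^sub>F N in sequentially. 2 * r * ln (ln (real N)) \<le> ln (real N)" using r0 by real_asymp
  moreover have "\<forall>\<^sub>F N in sequentially. (r * ln (real N) * ln (ln (real N)))\<^sup>2 \<ge> max 1 (real x0)"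
  proof -
    have "filterlim (\<lambda>N. (r * ln (real N) * ln (ln (real N)))\<^sup>2) at_top sequentially" using r0 by real_asymp
    then show ?thesis by (simp only: filterlim_at_top)
  qed
  moreover have "\<forall>\<^sub>F N in sequentially. 75 * (ln (ln (real N)))\<^sup>2 * (real (C + 1) * ln (real N)) + \<kappa>
      \<le> c / 2 * (r * ln (real N) * ln (ln (real N)))\<^sup>2"
    using r0 c by real_asymp
  ultimately have "\<forall>\<^sub>F N in sequentially. ln (ln (real N)) \<ge> 1 \<and> 2 * r * ln (ln (real N)) \<le> ln (real N)
      \<and> (r * ln (real N) * ln (ln (real N)))\<^sup>2 \<ge> max 1 (real x0)
      \<and> 75 * (ln (ln (real N)))\<^sup>2 * (real (C + 1) * ln (real N)) + \<kappa> \<le> c / 2 * (r * ln (real N) * ln (ln (real N)))\<^sup>2"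
    by eventually_elim simp
  then obtain N1 where N1: "\<And>N. N \<ge> N1 \<Longrightarrow> ln (ln (real N)) \<ge> 1 \<and> 2 * r * ln (ln (real N)) \<le> ln (real N)
      \<and> (r * ln (real N) * ln (ln (real N)))\<^sup>2 \<ge> max 1 (real x0)
      \<and> 75 * (ln (ln (real N)))\<^sup>2 * (real (C + 1) * ln (real N)) + \<kappa> \<le> c / 2 * (r * ln (real N) * ln (ln (real N)))\<^sup>2"
    by (auto simp: eventually_sequentially)
  show ?thesis
  proof (rule exI[of _ "400 * real d * r"], rule exI[of _ "max N1 2"], intro conjI allI impI)
    show "400 * real d * r > 0" using r0 d2 by simp
    fix n :: int and A B :: "nat set"
    define N where "N = nat \<bar>n\<bar>"
    define lg where "lg = ln (real N)"
    define \<mu> where "\<mu> = ln lg"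
    define A' where "A' = {a\<in>A. a < N ^ C}"
    define B' where "B' = {b\<in>B. b < N ^ C}"
    assume n: "max N1 2 \<le> nat \<bar>n\<bar>" and BD: "bipartite_diophantine k n A B"
      and many: "5 * ln (ln (real (nat \<bar>n\<bar>))) \<le> real (card {a\<in>A. a < nat \<bar>n\<bar> ^ C})"
    have N2: "N \<ge> 2" "N \<ge> N1" using n by (simp_all add: N_def)
    have \<mu>: "\<mu> \<ge> 1" and lgr: "2 * r * \<mu> \<le> lg" and big: "(r * lg * \<mu>)\<^sup>2 \<ge> max 1 (real x0)"
      and main: "75 * \<mu>\<^sup>2 * (real (C + 1) * lg) + \<kappa> \<le> c / 2 * (r * lg * \<mu>)\<^sup>2"
      using N1[OF N2(2)] by (simp_all add: lg_def \<mu>_def)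
    have lg1: "lg \<ge> 1" and lgpos: "lg > 0"
    proof -
      show "lg > 0" using N2 by (simp add: lg_def)
      then have "exp 1 \<le> lg" using \<mu> by (simp add: \<mu>_def ln_ge_iff)
      then show "lg \<ge> 1" using exp_ge_add_one_self[of 1] by linarith
    qed
    \<comment> \<open>As \<open>ln 2 \<ge> 1 / 2\<close>, the factor 4 gives
      \<open>2 ^ m \<ge> exp (2 * \<mu>) = lg * lg\<close>, which is at least
      \<open>2 * y \<ge> sqrt x\<close>. Rounding up stays within \<open>5 * \<mu>\<close> because
      \<open>\<mu> \<ge> 1\<close>.\<close>
    define m where "m = nat \<lceil>4 * \<mu>\<rceil>"
    have m: "4 * \<mu> \<le> real m" "real m \<le> 5 * \<mu>" unfolding m_def using \<mu> by linarith+
    have m1: "m \<ge> 1" using m \<mu> by (cases m) auto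
    have posA: "a > 0" if "a \<in> A" for a using BD that by (auto simp: bipartite_diophantine_def)
    have posB: "b > 0" if "b \<in> B" for b using BD that by (auto simp: bipartite_diophantine_def)
    have "5 * \<mu> \<le> real (card A')" using many by (simp add: A'_def N_def \<mu>_def lg_def)
    then have "m \<le> card A'" using m(2) by linarith
    then obtain S where S: "S \<subseteq> A'" "card S = m" "finite S" by (rule obtain_subset_with_card_n)
    have S0: "S \<noteq> {}" using S m1 by auto
    \<comment> \<open>The exponent \<open>C + 1\<close> makes \<open>X\<close> a bound for
      \<open>N\<close> too, so that it bounds every factor of \<open>D\<close>.\<close>
    define X where "X = N ^ (C + 1)"
    have CX: "N ^ C \<le> X" unfolding X_def using N2 by (intro power_increasing) auto
    have NX: "N \<le> X" using N2 by (simp add: X_def)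
    have X2: "X \<ge> 2" using NX N2 by simp
    have lnX: "ln (real X) = real (C + 1) * lg" unfolding X_def of_nat_power using N2 by (subst ln_realpow) (simp_all add: lg_def)
    have SX: "0 < a" "a \<le> X" if "a \<in> S" for a using that S CX posA by (auto simp: A'_def)
    define F where "F = {q\<in>S \<times> S. fst q \<noteq> snd q}"
    \<comment> \<open>Apart from the small primes, every prime to be excluded divides this one
      integer. It is at most \<open>X ^ (1 + m + m * m)\<close>, so these primes have weight of
      order \<open>\<mu>\<^sup>2 * lg\<close>, against \<open>x\<close> of order
      \<open>(lg * \<mu>)\<^sup>2\<close>.\<close>
    define D where "D = N * \<Prod>S * (\<Prod>q\<in>F. nat \<bar>int (fst q) - int (snd q)\<bar>)"
    have finF: "finite F" using S by (simp add: F_def)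
    have cF: "card F \<le> m * m"
    proof -
      have "card F \<le> card (S \<times> S)" unfolding F_def using S by (intro card_mono) auto
      then show ?thesis using S by (simp add: card_cartesian_product)
    qed
    have D0: "D > 0" unfolding D_def
    proof (intro mult_pos_pos prod_pos)
      show "N > 0" using N2 by simp
    qed (auto simp: F_def SX)
    have "D \<le> X * X ^ m * X ^ (m * m)"
      unfolding D_def
    proof (intro mult_le_mono NX)
      show "\<Prod>S \<le> X ^ m" using prod_le_const_power[of S "\<lambda>a. a" X] SX S by simp
      have "(\<Prod>q\<in>F. nat \<bar>int (fst q) - int (snd q)\<bar>) \<le> X ^ card F"
      proof (rule prod_le_const_power)
        fix q assume "q \<in> F"
        then have "fst q \<in> S" "snd q \<in> S" by (auto simp: F_def)
        then show "nat \<bar>int (fst q) - int (snd q)\<bar> \<le> X" using SX[of "fst q"] SX[of "snd q"] by simp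
      qed
      also have "\<dots> \<le> X ^ (m * m)" using cF X2 by (intro power_increasing) auto
      finally show "(\<Prod>q\<in>F. nat \<bar>int (fst q) - int (snd q)\<bar>) \<le> X ^ (m * m)" .
    qed
    also have "\<dots> = X ^ (1 + m + m * m)" by (simp add: power_add)
    also have "\<dots> \<le> X ^ (3 * (m * m))"
    proof (rule power_increasing)
      have "m \<le> m * m" using m1 by simp
      then show "1 + m + m * m \<le> 3 * (m * m)" using m1 by linarith
    qed (use X2 in simp)
    finally have "real D \<le> real X ^ (3 * (m * m))" by (metis of_nat_le_iff of_nat_power)
    then have "ln (real D) \<le> ln (real X ^ (3 * (m * m)))" using D0 X2 by (subst ln_le_cancel_iff) auto
    also have "\<dots> = 3 * (real m * real m) * (real (C + 1) * lg)" using X2 by (simp add: ln_realpow lnX)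
    also have "\<dots> \<le> 3 * (5 * \<mu> * (5 * \<mu>)) * (real (C + 1) * lg)"
      using m(2) \<mu> lgpos by (intro mult_right_mono mult_left_mono mult_mono) auto
    finally have lnD: "ln (real D) \<le> 75 * \<mu>\<^sup>2 * (real (C + 1) * lg)" by (simp add: power2_eq_square)
    define y where "y = r * lg * \<mu>"
    have y0: "y > 0" unfolding y_def using r0 lgpos \<mu> by simp
    define x where "x = nat \<lceil>y\<^sup>2\<rceil>"
    have x: "y\<^sup>2 \<le> real x" "real x \<le> y\<^sup>2 + 1" unfolding x_def using zero_le_power2[of y] by linarith+
    have y2: "y\<^sup>2 \<ge> 1" "y\<^sup>2 \<ge> real x0" using big by (simp_all add: y_def)
    have xx0: "x \<ge> x0" using x(1) y2(2) by linarith
    have sx1: "y \<le> sqrt (real x)" using x(1) by (rule real_le_rsqrt)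
    have sx2: "sqrt (real x) \<le> 2 * y"
    proof (rule real_le_lsqrt)
      have "y\<^sup>2 + 1 \<le> (2 * y)\<^sup>2" using y2(1) by (simp add: power_mult_distrib)
      then show "real x \<le> (2 * y)\<^sup>2" using x(2) by linarith
    qed (use y0 in auto)
    define PS where "PS = {p\<in>{1..x}. prime p \<and> [p = 1] (mod d)}"
    define Q where "Q = {p\<in>PS. \<not> p dvd D \<and> p0 \<le> p}"
    have finPS: "finite PS" by (simp add: PS_def)
    have lnp: "ln (real p) \<ge> 0" if "p \<in> PS" for p using that by (simp add: PS_def)
    have "c * real x \<le> (\<Sum>p\<in>PS. ln (real p))" unfolding PS_def by (rule theta[OF xx0])
    also have "\<dots> \<le> (\<Sum>p\<in>PS. (if \<not> p dvd D \<and> p0 \<le> p then ln (real p) else 0)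
        + ((if p dvd D then ln (real p) else 0) + (if p < p0 then ln (real p) else 0)))"
      using lnp by (intro sum_mono) auto
    also have "\<dots> = (\<Sum>p\<in>Q. ln (real p)) + ((\<Sum>p\<in>{p\<in>PS. p dvd D}. ln (real p)) + (\<Sum>p\<in>{p\<in>PS. p < p0}. ln (real p)))"
      unfolding Q_def by (simp only: sum.distrib sum.inter_filter[OF finPS])
    also have "(\<Sum>p\<in>{p\<in>PS. p dvd D}. ln (real p)) \<le> ln (real D)"
      by (rule sum_ln_primes_dividing_le) (use finPS D0 in \<open>auto simp: PS_def\<close>)
    also have "(\<Sum>p\<in>{p\<in>PS. p < p0}. ln (real p)) \<le> \<kappa>"
      unfolding \<kappa>_def by (rule sum_mono2) (auto simp: PS_def)
    finally have "c * real x \<le> (\<Sum>p\<in>Q. ln (real p)) + (75 * \<mu>\<^sup>2 * (real (C + 1) * lg) + \<kappa>)" using lnD by linarith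
    moreover have "75 * \<mu>\<^sup>2 * (real (C + 1) * lg) + \<kappa> \<le> c / 2 * real x"
    proof -
      have "c / 2 * y\<^sup>2 \<le> c / 2 * real x" using x(1) c by (intro mult_left_mono) auto
      then show ?thesis using main by (simp add: y_def)
    qed
    ultimately have \<Theta>: "c / 2 * real x \<le> (\<Sum>p\<in>Q. ln (real p))" by linarith
    define V where "V = 20 * real d * real m * sqrt (real x)"
    have sx0: "sqrt (real x) > 0" using sx1 y0 by linarith
    have V0: "V > 0" unfolding V_def using d2 m1 sx0 by (intro mult_pos_pos) auto
    have "real (card B') \<le> 2 * V"
    proof (rule larger_sieve)
      show "finite B'" by (simp add: B'_def)
      show "0 < b \<and> b \<le> X" if "b \<in> B'" for b using that posB CX by (auto simp: B'_def)
      show "X \<ge> 2" by (rule X2)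
      show "finite Q" using finPS by (simp add: Q_def)
      show "prime p" if "p \<in> Q" for p using that by (simp add: Q_def PS_def)
      show "V > 0" by (rule V0)
      show "2 * V * ln (real X) \<le> (\<Sum>p\<in>Q. ln (real p))"
      proof -
        have "2 * V * ln (real X) = 40 * real d * real (C + 1) * (real m * lg) * sqrt (real x)" by (simp add: V_def lnX)
        also have "\<dots> \<le> 40 * real d * real (C + 1) * (5 * \<mu> * lg) * sqrt (real x)"
          using m(2) lgpos by (intro mult_right_mono mult_left_mono) auto
        also have "\<dots> = c / 2 * y * sqrt (real x)" using c by (simp add: y_def r_def)
        also have "\<dots> \<le> c / 2 * sqrt (real x) * sqrt (real x)"
          using sx1 c by (intro mult_right_mono mult_left_mono) auto
        also have "\<dots> = c / 2 * real x" by (simp add: mult.assoc)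
        finally show ?thesis using \<Theta> by linarith
      qed
      fix p assume p: "p \<in> Q"
      have pp: "prime p" "[p = 1] (mod d)" "p \<le> x" "\<not> p dvd D" "144 + 2 * d\<^sup>2 \<le> p"
        using p by (auto simp: Q_def PS_def p0_def)
      have spx: "sqrt (real p) \<le> sqrt (real x)" using pp(3) by simp
      have "real (card ((\<lambda>b. b mod p) ` B')) \<le> 20 * d * card S * sqrt p"
      proof (rule card_residues_le[OF pp(1,2) d _ pp(5) S(3) S0])
        show "k > 0" using k by simp
        show "\<not> int p dvd n"
        proof
          assume "int p dvd n"
          then have "p dvd N" unfolding N_def by (simp flip: int_dvd_int_iff)
          then show False using pp(4) by (simp add: D_def)
        qed
        show "\<not> p dvd a" if "a \<in> S" for a
          using that pp(4) S(3) dvd_prodI[of S a "\<lambda>a. a"] unfolding D_def by (meson dvd_mult dvd_mult2 dvd_trans)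
        show "\<not> int p dvd int a - int b" if ab: "a \<in> S" "b \<in> S" "a \<noteq> b" for a b
        proof
          assume "int p dvd int a - int b"
          then have "p dvd nat \<bar>int a - int b\<bar>" by (simp flip: int_dvd_int_iff)
          moreover have "nat \<bar>int a - int b\<bar> dvd (\<Prod>q\<in>F. nat \<bar>int (fst q) - int (snd q)\<bar>)"
            using dvd_prodI[OF finF, of "(a, b)" "\<lambda>q. nat \<bar>int (fst q) - int (snd q)\<bar>"] ab by (simp add: F_def)
          ultimately show False using pp(4) unfolding D_def by (meson dvd_mult dvd_trans)
        qed
        show "\<exists>z::nat. int a * int b + n = int z ^ k" if "a \<in> S" "b \<in> B'" for a b
          using BD that S(1) by (force simp: bipartite_diophantine_def perfect_power_def A'_def B'_def)
        show "sqrt (real p) \<le> real (d ^ card S)"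
        proof -
          have "2 * y = (2 * r * \<mu>) * lg" by (simp add: y_def)
          also have "\<dots> \<le> lg * lg" using lgr lgpos by (intro mult_right_mono) auto
          also have "\<dots> = exp \<mu> * exp \<mu>" unfolding \<mu>_def using lgpos by (simp only: exp_ln)
          also have "\<dots> = exp (2 * \<mu>)" by (simp only: mult_2 exp_add)
          also have "\<dots> \<le> exp (real m * ln 2)"
          proof -
            have "(1::real) / 2 \<le> ln 2" using ln_one_minus_pos_upper_bound[of "1/2::real"] by (simp add: ln_div)
            then have "4 * \<mu> * (1 / 2) \<le> real m * ln 2" using m \<mu> by (intro mult_mono) auto
            then show ?thesis by simp
          qed
          also have "\<dots> = 2 ^ m" by (simp add: exp_of_nat_mult)
          also have "\<dots> \<le> real d ^ m" using d2 by (intro power_mono) auto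
          finally have "sqrt (real p) \<le> real d ^ m" using order_trans[OF spx sx2] by linarith
          then show ?thesis using S(2) by simp
        qed
      qed
      also have "\<dots> \<le> V"
        unfolding V_def S(2) using spx by (simp add: mult_left_mono)
      finally show "real (card ((\<lambda>b. b mod p) ` B')) \<le> V" .
    qed
    also have "2 * V = 40 * real d * real m * sqrt (real x)" by (simp add: V_def)
    also have "\<dots> \<le> 40 * real d * (5 * \<mu>) * (2 * y)"
      using m(2) sx2 \<mu> by (intro mult_mono mult_left_mono) auto
    also have "\<dots> = 400 * real d * r * lg * \<mu>\<^sup>2" by (simp add: y_def power2_eq_square)
    finally show "real (card {b\<in>B. b < nat \<bar>n\<bar> ^ C}) \<le> 400 * real d * r * ln (real (nat \<bar>n\<bar>)) * (ln (ln (real (nat \<bar>n\<bar>))))\<^sup>2"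
      by (simp add: B'_def N_def \<mu>_def lg_def)
  qed
qed

lemma card_split_le:
  fixes A :: "nat set"
  assumes "finite {a\<in>A. T \<le> a}" "card {a\<in>A. T \<le> a} \<le> 7"
  shows "finite A" and "card A \<le> card {a\<in>A. a < T} + 7"
proof -
  have e: "A = {a\<in>A. a < T} \<union> {a\<in>A. T \<le> a}" by auto
  have "finite {a\<in>A. a < T}" by simp
  then show "finite A" using assms(1) e by (metis finite_UnI)
  have "card A \<le> card {a\<in>A. a < T} + card {a\<in>A. T \<le> a}" by (subst e) (rule card_Un_le)
  then show "card A \<le> card {a\<in>A. a < T} + 7" using assms(2) by linarith
qed

theorem theorem2p6:
  fixes k :: nat
  assumes "k \<ge> 3"
  shows "\<exists>C1 C2 :: real. \<exists>N :: int. \<forall>n :: int. \<bar>n\<bar> \<ge> N \<longrightarrow>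
    (\<forall>A B :: nat set. bipartite_diophantine k n A B \<longrightarrow>
      (finite A \<and> real (card A) \<le> C1 * ln (ln (real_of_int \<bar>n\<bar>))) \<or>
      (finite B \<and> real (card B) \<le>
         C2 * ln (real_of_int \<bar>n\<bar>) * (ln (ln (real_of_int \<bar>n\<bar>)))\<^sup>2))"
proof -
  obtain M C where red: "\<And>n A B. 64 * k ^ 3 \<le> nat \<bar>n\<bar> \<Longrightarrow> bipartite_diophantine k n A B \<Longrightarrow>
    (finite A \<and> card A \<le> M) \<or> (finite B \<and> card B \<le> M) \<or>
    (finite {a\<in>A. nat \<bar>n\<bar> ^ C \<le> a} \<and> card {a\<in>A. nat \<bar>n\<bar> ^ C \<le> a} \<le> 7 \<and>
     finite {b\<in>B. nat \<bar>n\<bar> ^ C \<le> b} \<and> card {b\<in>B. nat \<bar>n\<bar> ^ C \<le> b} \<le> 7)"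
    using reduction_to_small_elements[OF assms] by blast
  obtain R N0 where R: "R > 0" and sieve: "\<And>n A B. N0 \<le> nat \<bar>n\<bar> \<Longrightarrow> bipartite_diophantine k n A B \<Longrightarrow>
    real (card {a\<in>A. a < nat \<bar>n\<bar> ^ C}) \<ge> 5 * ln (ln (real (nat \<bar>n\<bar>))) \<Longrightarrow>
    real (card {b\<in>B. b < nat \<bar>n\<bar> ^ C}) \<le> R * ln (real (nat \<bar>n\<bar>)) * (ln (ln (real (nat \<bar>n\<bar>))))\<^sup>2"
    using sieve_small_elements[OF assms, of C] by blast
  have "\<forall>\<^sub>F N in sequentially. ln (ln (real N)) \<ge> 1 \<and> ln (real N) \<ge> 1"
    by (rule eventually_conj) real_asymp+
  then obtain N1 where N1: "\<And>N. N \<ge> N1 \<Longrightarrow> ln (ln (real N)) \<ge> 1 \<and> ln (real N) \<ge> 1"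
    by (auto simp: eventually_sequentially)
  define N2 where "N2 = max (64 * k ^ 3) (max N0 N1)"
  show ?thesis
  \<comment> \<open>\<open>M\<close> covers sets that are bounded outright; 12 is
    \<open>5 + 7\<close>, and \<open>R + 7\<close> adds the seven exceptional elements to the sieve
    bound. Constants are absorbed because \<open>\<mu> \<ge> 1\<close> and
    \<open>lg * \<mu>\<^sup>2 \<ge> 1\<close>.\<close>
  proof (rule exI[of _ "real M + 12"], rule exI[of _ "real M + R + 7"], rule exI[of _ "int N2"], intro allI impI)
    fix n :: int and A B :: "nat set"
    assume n: "int N2 \<le> \<bar>n\<bar>" and BD: "bipartite_diophantine k n A B"
    define N where "N = nat \<bar>n\<bar>"
    have Nn: "real_of_int \<bar>n\<bar> = real N" by (simp add: N_def)
    have N: "64 * k ^ 3 \<le> N" "N0 \<le> N" "N1 \<le> N" using n by (auto simp: N_def N2_def)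
    define lg where "lg = ln (real N)"
    define \<mu> where "\<mu> = ln lg"
    have \<mu>: "\<mu> \<ge> 1" and lg: "lg \<ge> 1" using N1[OF N(3)] by (simp_all add: lg_def \<mu>_def)
    have lg\<mu>: "lg * \<mu>\<^sup>2 \<ge> 1" using mult_mono[OF lg, of 1 "\<mu>\<^sup>2"] \<mu> lg by simp
    have C1: "real M + 12 * \<mu> \<le> (real M + 12) * \<mu>"
      using mult_left_mono[OF \<mu>, of "real M"] by (simp add: algebra_simps)
    have C2: "real M + R * (lg * \<mu>\<^sup>2) + 7 \<le> (real M + R + 7) * (lg * \<mu>\<^sup>2)"
      using mult_left_mono[OF lg\<mu>, of "real M + 7"] by (simp add: algebra_simps)
    have R0: "R * (lg * \<mu>\<^sup>2) \<ge> 0" using R lg\<mu> by simp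
    have "(finite A \<and> real (card A) \<le> (real M + 12) * \<mu>) \<or> (finite B \<and> real (card B) \<le> (real M + R + 7) * (lg * \<mu>\<^sup>2))"
      using red[OF N(1)[unfolded N_def] BD]
    proof (elim disjE conjE)
      assume "finite A" "card A \<le> M"
      then show ?thesis using C1 \<mu> by linarith
    next
      assume "finite B" "card B \<le> M"
      then show ?thesis using C2 R0 by linarith
    next
      assume A: "finite {a\<in>A. nat \<bar>n\<bar> ^ C \<le> a}" "card {a\<in>A. nat \<bar>n\<bar> ^ C \<le> a} \<le> 7"
        and B: "finite {b\<in>B. nat \<bar>n\<bar> ^ C \<le> b}" "card {b\<in>B. nat \<bar>n\<bar> ^ C \<le> b} \<le> 7"
      show ?thesis
      proof (cases "5 * \<mu> \<le> real (card {a\<in>A. a < nat \<bar>n\<bar> ^ C})")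
        case True
        then have "real (card {b\<in>B. b < nat \<bar>n\<bar> ^ C}) \<le> R * lg * \<mu>\<^sup>2"
          using sieve[OF N(2)[unfolded N_def] BD] by (simp add: \<mu>_def lg_def N_def)
        then have "real (card B) \<le> R * (lg * \<mu>\<^sup>2) + 7" using card_split_le(2)[OF B] by (simp add: mult.assoc)
        then show ?thesis using card_split_le(1)[OF B] C2 by linarith
      next
        case False
        then have "real (card A) \<le> 5 * \<mu> + 7" using card_split_le(2)[OF A] by linarith
        then show ?thesis using card_split_le(1)[OF A] C1 \<mu> by linarith
      qed
    qed
    then show "(finite A \<and> real (card A) \<le> (real M + 12) * ln (ln (real_of_int \<bar>n\<bar>))) \<or>
      (finite B \<and> real (card B) \<le> (real M + R + 7) * ln (real_of_int \<bar>n\<bar>) * (ln (ln (real_of_int \<bar>n\<bar>)))\<^sup>2)"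
      unfolding Nn \<mu>_def lg_def by (simp only: mult.assoc)
  qed
qed

end
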